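(* Let $\mathcal{A}$ be a free (central) arrangement in $\mathbb{C}^3$ with $\exp(\mathcal{A})=(1,a,b)$. If $\min(a,b)\leq 4$, then $\mathcal{A}$ is either inductively free or a dual Hesse arrangement.
   Context: A central arrangement $\mathcal{A}$ in $\mathbb{C}^3$ is a finite set of linear planes (two-dimensional linear subspaces) in $V=\mathbb{C}^3$. For each $H\in\mathcal{A}$ fix a linear form $\alpha_H\in V^*$ with kernel $H$. Let $S=\mathbb{C}[x_1,x_2,x_3]$ and $$D(\mathcal{A})=\Big\{\theta\in\bigoplus_{i=1}^3 S\,\partial/\partial x_i \;\Big|\; \theta(\alpha_H)\in S\alpha_H \text{ for all } H\in\mathcal{A}\Big\}.$$ $\mathcal{A}$ is free with exponents $\exp(\mathcal{A})=(d_1,d_2,d_3)$ if $D(\mathcal{A})$ has a homogeneous free $S$-basis $\theta_1,\theta_2,\theta_3$ with $\deg\theta_i=d_i$, where the degree of a homogeneous derivation $\sum f_i\,\partial/\partial x_i$ is the common degree of the nonzero $f_i$. Exponents are considered up to order, and for nonempty free $\mathcal{A}$ they always contain $1$ (from the Euler derivation). $\mathcal{A}$ with $|\mathcal{A}|=\ell$ is inductively free if there is a filtration of subarrangements $\mathcal{A}_1\subset\mathcal{A}_2\subset\cdots\subset\mathcal{A}_\ell=\mathcal{A}$ such that $|\mathcal{A}_i|=i$ and $\mathcal{A}_i$ is free for all $1\le i\le\ell$. A dual Hesse arrangement is an arrangement $\mathcal{A}$ in $\mathbb{C}^3$ with $|\mathcal{A}|=9$ whose set of codimension $2$ intersections (lines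 through the origin arising as intersections of planes of $\mathcal{A}$) consists of $12$ triple lines, i.e. $12$ lines each contained in exactly $3$ planes of $\mathcal{A}$. *)

theory Defs
  imports "HOL-Analysis.Analysis" "HOL-Library.Poly_Mapping"
begin

section \<open>The polynomial ring in three variables\<close>

text \<open>An exponent vector is a finitely supported map from the index type \<^typ>\<open>3\<close> to
  \<^typ>\<open>nat\<close>, and a polynomial is a finitely supported map from exponent vectors to
  coefficients.  The product of \<^theory>\<open>HOL-Library.Poly_Mapping\<close> is convolution.\<close>

type_synonym poly3 = "(3 \<Rightarrow>\<^sub>0 nat) \<Rightarrow>\<^sub>0 complex"

definition homogeneous :: "nat \<Rightarrow> poly3 \<Rightarrow> bool" where
  "homogeneous d p \<longleftrightarrow> (\<forall>m\<in>Poly_Mapping.keys p. (\<Sum>i\<in>UNIV. Poly_Mapping.lookup m i) = d)"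

text \<open>If the variable does not occur in a monomial, the truncated subtraction of
  exponents is harmless, because the coefficient is then zero.\<close>

definition partial_deriv :: "3 \<Rightarrow> poly3 \<Rightarrow> poly3" where
  "partial_deriv i p =
     (\<Sum>m\<in>Poly_Mapping.keys p.
        Poly_Mapping.single (m - Poly_Mapping.single i 1)
          (of_nat (Poly_Mapping.lookup m i) * Poly_Mapping.lookup p m))"


section \<open>Central arrangements and defining linear forms\<close>

definition central_arrangement :: "(complex^3) set set \<Rightarrow> bool" where
  "central_arrangement A \<longleftrightarrow> finite A \<and> (\<forall>H\<in>A. vec.subspace H \<and> vec.dim H = 2)"

text \<open>The coefficient vector \<open>a\<close> stands for the linear form
  \<open>a\<^sub>1 x\<^sub>1 + a\<^sub>2 x\<^sub>2 + a\<^sub>3 x\<^sub>3\<close>, which is used both as a polynomial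
  and as a functional on the space (through its kernel).\<close>

definition linear_form :: "complex^3 \<Rightarrow> poly3" where
  "linear_form a = (\<Sum>i\<in>UNIV. Poly_Mapping.single (Poly_Mapping.single i 1) (a $ i))"

definition linear_form_kernel :: "complex^3 \<Rightarrow> (complex^3) set" where
  "linear_form_kernel a = {v. (\<Sum>i\<in>UNIV. a $ i * v $ i) = 0}"

definition defining_form :: "(complex^3) set \<Rightarrow> poly3" where
  "defining_form H = linear_form (SOME a. linear_form_kernel a = H)"


section \<open>The module of logarithmic derivations\<close>

text \<open>The vector \<open>\<theta>\<close> of polynomials stands for the derivation
  \<open>\<theta>\<^sub>1 \<partial>/\<partial>x\<^sub>1 + \<theta>\<^sub>2 \<partial>/\<partial>x\<^sub>2 + \<theta>\<^sub>3 \<partial>/\<partial>x\<^sub>3\<close>.\<close>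

definition apply_derivation :: "poly3^3 \<Rightarrow> poly3 \<Rightarrow> poly3" where
  "apply_derivation \<theta> p = (\<Sum>i\<in>UNIV. \<theta> $ i * partial_deriv i p)"

definition log_derivations :: "(complex^3) set set \<Rightarrow> (poly3^3) set" where
  "log_derivations A = {\<theta>. \<forall>H\<in>A. defining_form H dvd apply_derivation \<theta> (defining_form H)}"

text \<open>The zero derivation is homogeneous of every degree here, but it never belongs to a basis.\<close>

definition homogeneous_derivation :: "nat \<Rightarrow> poly3^3 \<Rightarrow> bool" where
  "homogeneous_derivation d \<theta> \<longleftrightarrow> (\<forall>i. homogeneous d (\<theta> $ i))"

interpretation der: module "(*s) :: poly3 \<Rightarrow> poly3^3 \<Rightarrow> poly3^3"
  by unfold_locales (simp_all add: vec_eq_iff algebra_simps)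


section \<open>Freeness, inductive freeness, dual Hesse arrangements\<close>

definition free_with_exponents :: "(complex^3) set set \<Rightarrow> nat \<Rightarrow> nat \<Rightarrow> nat \<Rightarrow> bool" where
  "free_with_exponents A d1 d2 d3 \<longleftrightarrow>
     (\<exists>\<theta>1 \<theta>2 \<theta>3.
        homogeneous_derivation d1 \<theta>1 \<and> homogeneous_derivation d2 \<theta>2 \<and> homogeneous_derivation d3 \<theta>3 \<and>
        distinct [\<theta>1, \<theta>2, \<theta>3] \<and>
        der.independent {\<theta>1, \<theta>2, \<theta>3} \<and>
        der.span {\<theta>1, \<theta>2, \<theta>3} = log_derivations A)"

definition free_arrangement :: "(complex^3) set set \<Rightarrow> bool" where
  "free_arrangement A \<longleftrightarrow> (\<exists>d1 d2 d3. free_with_exponents A d1 d2 d3)"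

definition inductively_free :: "(complex^3) set set \<Rightarrow> bool" where
  "inductively_free A \<longleftrightarrow>
     (\<exists>F :: nat \<Rightarrow> (complex^3) set set.
        F (card A) = A \<and>
        (\<forall>i. 1 \<le> i \<and> i < card A \<longrightarrow> F i \<subset> F (Suc i)) \<and>
        (\<forall>i. 1 \<le> i \<and> i \<le> card A \<longrightarrow> card (F i) = i \<and> free_arrangement (F i)))"

text \<open>In three-dimensional space, codimension two means dimension one.\<close>

definition codim2_intersections :: "(complex^3) set set \<Rightarrow> (complex^3) set set" where
  "codim2_intersections A = {X. \<exists>B\<subseteq>A. X = \<Inter>B \<and> vec.dim X = 1}"

definition dual_hesse :: "(complex^3) set set \<Rightarrow> bool" where
  "dual_hesse A \<longleftrightarrow>
     central_arrangement A \<and> card A = 9 \<and>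
     card (codim2_intersections A) = 12 \<and>
     (\<forall>X\<in>codim2_intersections A. card {H\<in>A. X \<subseteq> H} = 3)"

end

theory Submission
  imports Defs "HOL-Library.Function_Algebras" "HOL-Computational_Algebra.Polynomial"
begin

text \<open>A homogeneous derivation of degree \<open>d\<close> is a vector field \<open>\<theta>\<close> on \<open>\<complex>\<^sup>3\<close> with homogeneous polynomial
coefficients, and \<open>\<theta> \<in> D(A)\<close> means that \<open>\<theta>\<close> is tangent to every plane \<open>H \<in> A\<close>, that is
\<open>\<theta> v \<in> H\<close> for \<open>v \<in> H\<close>.  Everything below is done with these polynomial maps; polynomials as formal
objects appear only when freeness is translated.  Let \<open>A\<close> be free with basis \<open>E, \<theta>, \<phi>\<close>, where
\<open>E v = v\<close> is the Euler field and \<open>\<theta>, \<phi>\<close> have degrees \<open>a \<le> b\<close>.  Write \<open>n\<^sub>H\<close> for the number of points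
on \<open>H\<close>, that is of lines \<open>H \<inter> K\<close> with \<open>K \<in> A - {H}\<close>.  Three facts carry the proof.

\<^item> If \<open>n\<^sub>H > a\<close> for some \<open>H\<close>, then \<open>A - {H}\<close> is free with exponents \<open>(1, a - 1, b)\<close> or \<open>(1, a, b - 1)\<close>
  (\<open>free_exp_delete\<close>).  With an area form \<open>om\<close> on \<open>H\<close>, the function \<open>om v (\<theta> v)\<close> measures how far \<open>\<theta>\<close>
  is from being radial on \<open>H\<close>.  It is a form of degree \<open>a + 1\<close> on a plane that vanishes on \<open>n\<^sub>H\<close> lines.
  So it is zero, or \<open>n\<^sub>H = a + 1\<close> and it is the product of the equations of these lines up to
  a constant, which divides \<open>om v (\<phi> v)\<close>.
  Either way \<open>\<theta>\<close> or \<open>\<phi>\<close> becomes divisible by the equation of \<open>H\<close> after subtracting multiples of the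
  other basis fields, and dividing by that equation gives a basis for \<open>A - {H}\<close>.

\<^item> \<open>card A = 1 + a + b\<close>, and the sum \<open>betti2 A\<close> of \<open>m\<^sub>X - 1\<close> over all points \<open>X\<close>, where \<open>m\<^sub>X\<close> planes contain
  \<open>X\<close>, is \<open>a + b + a * b\<close> (\<open>free_exp_numerics\<close>).  The space of logarithmic forms of large degree \<open>d\<close> has
  a dimension that depends on \<open>d\<close>, \<open>card A\<close> and \<open>betti2 A\<close> only (\<open>hilbert_polynomial\<close>): those
  vanishing on \<open>H\<close> are the logarithmic forms of \<open>A - {H}\<close> times an equation of \<open>H\<close>, and in large degree the
  restrictions to \<open>H\<close> are all fields on \<open>H\<close> tangent to its points.  A basis gives the same dimension in terms of \<open>a\<close> and \<open>b\<close>.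

\<^item> If \<open>n\<^sub>H \<le> a \<le> 4\<close> for all \<open>H\<close>, and \<open>A\<close> has at least two planes, then \<open>A\<close> is a dual Hesse
  arrangement (\<open>few_points_dual_hesse\<close>).  This is double counting of incidences.  The case \<open>a = 4\<close> uses
  \<open>(k - 2) * (k - 3) \<ge> 0\<close> for \<open>k = m\<^sub>X - 1\<close>, which forces \<open>b = 4\<close> and equality, hence twelve points
  with \<open>m\<^sub>X = 3\<close>.

By induction on \<open>card A\<close> only one situation is left: the plane \<open>H\<close> that can be removed leaves a dual Hesse
arrangement.  The numbers then show that \<open>H\<close> joins two of the twelve points and meets three of the nine planes in new points.
The plane through one of the new points can be removed instead, and what remains is not dual Hesse, because it has
a point on four planes (\<open>dual_hesse_extension\<close>).\<close>

section \<open>Homogeneous polynomial functions\<close>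

definition dot :: "complex^3 \<Rightarrow> complex^3 \<Rightarrow> complex" (infixl "\<bullet>c" 75) where
  "a \<bullet>c v = (\<Sum>i\<in>UNIV. a $ i * v $ i)"

lemma dot_add_right: "a \<bullet>c (v + w) = a \<bullet>c v + a \<bullet>c w"
  by (simp add: dot_def algebra_simps sum.distrib)

lemma dot_scale_right: "a \<bullet>c (t *s v) = t * (a \<bullet>c v)"
  by (simp add: dot_def algebra_simps sum_distrib_left)

lemma dot_diff_right: "a \<bullet>c (v - w) = a \<bullet>c v - a \<bullet>c w"
  by (simp add: dot_def algebra_simps sum_subtractf)

lemma dot_zero_right [simp]: "a \<bullet>c 0 = 0"
  by (simp add: dot_def)

lemmas dot_linear = dot_add_right dot_scale_right dot_diff_right

text \<open>Degrees are integers and the only form of negative degree is zero.  Dividing a form of degree \<open>d\<close> by a linear form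
then always gives a form of degree \<open>d - 1\<close>, and homogeneous coefficients with respect to a basis can be written
down without comparing degrees.\<close>

inductive form :: "int \<Rightarrow> (complex^3 \<Rightarrow> complex) \<Rightarrow> bool" where
  form_zero: "form d (\<lambda>_. 0)"
| form_const: "form 0 (\<lambda>_. c)"
| form_coord: "form 1 (\<lambda>v. v $ i)"
| form_add: "form d f \<Longrightarrow> form d g \<Longrightarrow> form d (\<lambda>v. f v + g v)"
| form_mult: "form d f \<Longrightarrow> form e g \<Longrightarrow> form (d + e) (\<lambda>v. f v * g v)"

lemma form_mult': "form d f \<Longrightarrow> form e g \<Longrightarrow> n = d + e \<Longrightarrow> form n (\<lambda>v. f v * g v)"
  using form_mult by blast

lemma form_scale: "form d f \<Longrightarrow> form d (\<lambda>v. c * f v)"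
  by (rule form_mult'[OF form_const]) auto

lemma form_diff: "form d f \<Longrightarrow> form d g \<Longrightarrow> form d (\<lambda>v. f v - g v)"
  using form_add[OF _ form_scale[of d g "-1"]] by simp

lemma form_sum: "(\<And>i. i \<in> I \<Longrightarrow> form d (f i)) \<Longrightarrow> form d (\<lambda>v. \<Sum>i\<in>I. f i v)"
  by (induction I rule: infinite_finite_induct) (auto intro: form_zero form_add)

lemma form_prod:
  "finite I \<Longrightarrow> (\<And>i. i \<in> I \<Longrightarrow> form (d i) (f i)) \<Longrightarrow> form (\<Sum>i\<in>I. d i) (\<lambda>v. \<Prod>i\<in>I. f i v)"
  by (induction I rule: finite_induct) (auto intro: form_const form_mult)

lemma form_prod_linear:
  "finite I \<Longrightarrow> (\<And>i. i \<in> I \<Longrightarrow> form 1 (f i)) \<Longrightarrow> form (int (card I)) (\<lambda>v. \<Prod>i\<in>I. f i v)"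
  using form_prod[of I "\<lambda>_. 1" f] by simp

lemma form_power: "form d f \<Longrightarrow> form (int n * d) (\<lambda>v. f v ^ n)"
  by (induction n) (auto intro: form_const form_mult' simp: algebra_simps)

lemma form_dot: "form 1 (\<lambda>v. a \<bullet>c v)"
  unfolding dot_def by (intro form_sum form_scale form_coord)

lemma form_negative_degree: "form d f \<Longrightarrow> d < 0 \<Longrightarrow> f v = 0"
  by (induction rule: form.induct) force+

lemma form_homogeneous: "form d f \<Longrightarrow> f (t *s v) = t ^ nat d * f v"
proof (induction rule: form.induct)
  case (form_mult d f e g)
  show ?case
  proof (cases "d < 0 \<or> e < 0")
    case True
    then show ?thesis using form_mult form_negative_degree by auto
  next
    case False
    then show ?thesis using form_mult by (simp add: nat_add_distrib power_add)
  qed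
qed (auto simp: algebra_simps)

lemma form_vanish_scale: "form d f \<Longrightarrow> f v = 0 \<Longrightarrow> f (t *s v) = 0"
  by (simp add: form_homogeneous)

lemma form_continuous: "form d f \<Longrightarrow> continuous_on UNIV f"
  by (induction rule: form.induct) (auto intro!: continuous_intros)

lemma form_degree_zero: "form d f \<Longrightarrow> d = 0 \<Longrightarrow> f v = f 0"
  using form_homogeneous[of d f 0 v] by simp

text \<open>The map \<open>v \<mapsto> v - (b \<bullet>c v) *s e\<close> changes every coordinate by a multiple of \<open>b \<bullet>c v\<close>, hence every polynomial too.
If \<open>b \<bullet>c e = 1\<close>, it is the projection onto the kernel of \<open>b\<close> along \<open>e\<close>, and this becomes the factor theorem below.\<close>

lemma form_split:
  "form d p \<Longrightarrow> \<exists>q. form (d - 1) q \<and> (\<forall>v. p v = p (v - (b \<bullet>c v) *s e) + (b \<bullet>c v) * q v)"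
proof (induction rule: form.induct)
  case (form_zero d)
  then show ?case by (intro exI[of _ "\<lambda>_. 0"]) (auto intro: form.intros)
next
  case (form_const c)
  then show ?case by (intro exI[of _ "\<lambda>_. 0"]) (auto intro: form.intros)
next
  case (form_coord i)
  show ?case by (intro exI[of _ "\<lambda>_. e $ i"]) (auto intro: form.intros)
next
  case (form_add d f g)
  from form_add.IH(1) obtain q where q: "form (d-1) q"
    "\<And>v. f v = f (v - (b \<bullet>c v) *s e) + (b \<bullet>c v) * q v" by auto
  from form_add.IH(2) obtain r where r: "form (d-1) r"
    "\<And>v. g v = g (v - (b \<bullet>c v) *s e) + (b \<bullet>c v) * r v" by auto
  show ?case
  proof (intro exI[of _ "\<lambda>v. q v + r v"] conjI allI)
    show "form (d - 1) (\<lambda>v. q v + r v)" using q r by (auto intro: form.intros)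
    show "f v + g v = f (v - (b \<bullet>c v) *s e) + g (v - (b \<bullet>c v) *s e) + (b \<bullet>c v) * (q v + r v)" for v
      unfolding distrib_left by (subst q(2)[of v], subst r(2)[of v]) (simp only: ac_simps)
  qed
next
  case (form_mult d f d' g)
  from form_mult.IH(1) obtain q where q: "form (d-1) q"
    "\<And>v. f v = f (v - (b \<bullet>c v) *s e) + (b \<bullet>c v) * q v" by auto
  from form_mult.IH(2) obtain r where r: "form (d'-1) r"
    "\<And>v. g v = g (v - (b \<bullet>c v) *s e) + (b \<bullet>c v) * r v" by auto
  \<comment> \<open>\<open>f g - f' g' = (f - f') g + f (g - g') - (f - f') (g - g')\<close>, with \<open>f', g'\<close> the projected values\<close>
  show ?case
  proof (intro exI[of _ "\<lambda>v. q v * g v + (f v * r v - (b \<bullet>c v) * (q v * r v))"] conjI allI)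
    have "form (d + d' - 1) (\<lambda>v. q v * g v)"
      by (rule form_mult'[OF q(1) form_mult.hyps(2)]) simp
    moreover have "form (d + d' - 1) (\<lambda>v. f v * r v)"
      by (rule form_mult'[OF form_mult.hyps(1) r(1)]) simp
    moreover have "form (d + d' - 1) (\<lambda>v. (b \<bullet>c v) * (q v * r v))"
      by (rule form_mult'[OF form_dot form_mult'[OF q(1) r(1) refl]]) simp
    ultimately show "form (d + d' - 1) (\<lambda>v. q v * g v + (f v * r v - (b \<bullet>c v) * (q v * r v)))"
      by (intro form_add form_diff)
    fix v
    let ?w = "v - (b \<bullet>c v) *s e"
    have "F * G = A * B + t * (Q * G + (F * R - t * (Q * R)))"
      if "F = A + t * Q" "G = B + t * R" for F G A B Q R t :: complex
      unfolding that by (simp add: algebra_simps)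
    from this[OF q(2)[of v] r(2)[of v]]
    show "f v * g v = f ?w * g ?w + (b \<bullet>c v) * (q v * g v + (f v * r v - (b \<bullet>c v) * (q v * r v)))" .
  qed
qed

text \<open>The factor theorem on a subspace \<open>W\<close>: used with \<open>W\<close> the whole space to divide by the equation of a plane, and with
\<open>W\<close> a plane to divide by the equation of a line in it.\<close>

lemma form_divide_on:
  assumes "form d p" "vec.subspace W" "e \<in> W" "b \<bullet>c e = 1"
    and "\<And>v. v \<in> W \<Longrightarrow> b \<bullet>c v = 0 \<Longrightarrow> p v = 0"
  shows "\<exists>q. form (d - 1) q \<and> (\<forall>v\<in>W. p v = (b \<bullet>c v) * q v)"
proof -
  obtain q where q: "form (d-1) q" "\<And>v. p v = p (v - (b \<bullet>c v) *s e) + (b \<bullet>c v) * q v"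
    using form_split[OF assms(1), of b e] by blast
  have "p (v - (b \<bullet>c v) *s e) = 0" if "v \<in> W" for v
    using assms that by (intro assms(5)) (auto simp: dot_linear vec.subspace_diff vec.subspace_scale)
  then show ?thesis using q by (metis add_0)
qed

text \<open>Linear factors can be cancelled on a subspace because the complement of a hyperplane is dense in it.\<close>

lemma continuous_cancel_dot:
  fixes f :: "complex^3 \<Rightarrow> complex"
  assumes f: "continuous_on UNIV f" and W: "vec.subspace W" "e \<in> W" "b \<bullet>c e \<noteq> 0"
    and eq: "\<And>v. v \<in> W \<Longrightarrow> (b \<bullet>c v) * f v = 0" and v: "v \<in> W"
  shows "f v = 0"
proof (cases "b \<bullet>c v = 0")
  case False
  then show ?thesis using eq[OF v] by simp
next
  case True
  \<comment> \<open>Along \<open>v + e/n\<close> the linear form does not vanish, so \<open>f\<close> does.\<close>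
  define x where "x n = v + (1 / of_nat (Suc n)) *s e" for n :: nat
  have "f (x n) = 0" for n
  proof -
    have "x n \<in> W" using W v unfolding x_def by (intro vec.subspace_add vec.subspace_scale)
    moreover have "b \<bullet>c x n \<noteq> 0" using True W(3) by (simp add: x_def dot_linear del: of_nat_Suc)
    ultimately show ?thesis using eq by fastforce
  qed
  moreover have "(\<lambda>n. f (x n)) \<longlonglongrightarrow> f v"
  proof (rule continuous_on_tendsto_compose[OF f])
    have "(\<lambda>n. 1 / complex_of_nat (Suc n)) \<longlonglongrightarrow> 0"
      using LIMSEQ_Suc[OF lim_1_over_n[where 'a=complex]] by simp
    then have "(\<lambda>n. v $ i + 1 / complex_of_nat (Suc n) * e $ i) \<longlonglongrightarrow> v $ i + 0 * e $ i" for i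
      by (intro tendsto_add tendsto_mult tendsto_const)
    then show "x \<longlonglongrightarrow> v" unfolding x_def
      by (intro vec_tendstoI) simp
  qed simp_all
  ultimately show ?thesis by (simp add: LIMSEQ_const_iff)
qed

lemma form_cancel_dot:
  assumes "form d f" "vec.subspace W" "e \<in> W" "b \<bullet>c e \<noteq> 0"
    and "\<And>v. v \<in> W \<Longrightarrow> (b \<bullet>c v) * f v = 0" and "v \<in> W"
  shows "f v = 0"
  using continuous_cancel_dot[OF form_continuous[OF assms(1)] assms(2-6)] .

section \<open>Coordinates adapted to a plane\<close>

lemma dot_scale_left: "(t *s a) \<bullet>c v = t * (a \<bullet>c v)"
  by (simp add: dot_def algebra_simps sum_distrib_left)

lemma dot_diff_left: "(a - b) \<bullet>c v = a \<bullet>c v - b \<bullet>c v"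
  by (simp add: dot_def algebra_simps sum_subtractf)

lemma subspace_dot_kernel: "vec.subspace {v. a \<bullet>c v = 0}"
  by (auto simp: vec.subspace_def dot_linear)

definition vform :: "int \<Rightarrow> (complex^3 \<Rightarrow> complex^3) \<Rightarrow> bool" where
  "vform d \<theta> \<longleftrightarrow> (\<forall>i. form d (\<lambda>v. \<theta> v $ i))"

lemma vform_add: "vform d \<theta> \<Longrightarrow> vform d \<phi> \<Longrightarrow> vform d (\<lambda>v. \<theta> v + \<phi> v)"
  by (auto simp: vform_def intro: form_add)

lemma vform_diff: "vform d \<theta> \<Longrightarrow> vform d \<phi> \<Longrightarrow> vform d (\<lambda>v. \<theta> v - \<phi> v)"
  by (auto simp: vform_def intro: form_diff)

lemma vform_mult: "form d f \<Longrightarrow> vform e \<theta> \<Longrightarrow> n = d + e \<Longrightarrow> vform n (\<lambda>v. f v *s \<theta> v)"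
  by (auto simp: vform_def intro: form_mult')

lemma vform_id: "vform 1 (\<lambda>v. v)"
  by (auto simp: vform_def intro: form_coord)

lemma vform_const: "vform 0 (\<lambda>_. w)"
  by (auto simp: vform_def intro: form_const)

lemma vform_zero: "vform d (\<lambda>_. 0)"
  by (auto simp: vform_def intro: form_zero)

lemma vform_negative_degree: "vform d \<theta> \<Longrightarrow> d < 0 \<Longrightarrow> \<theta> v = 0"
  by (auto simp: vform_def vec_eq_iff dest: form_negative_degree)

lemma form_dot_vform: "vform d \<theta> \<Longrightarrow> form d (\<lambda>v. a \<bullet>c \<theta> v)"
  unfolding dot_def vform_def by (auto intro!: form_sum form_scale)

text \<open>Linear coordinates \<open>al, xi, et\<close> of the whole space and the dual basis \<open>e0, e1, e2\<close>, chosen so that \<open>al\<close> is an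
equation of \<open>H\<close>.  On \<open>H\<close> itself \<open>xi\<close> and \<open>et\<close> are coordinates.\<close>

locale plane_chart =
  fixes H :: "(complex^3) set" and al xi et e0 e1 e2 :: "complex^3"
  assumes H_eq: "H = {v. al \<bullet>c v = 0}"
    and decomp: "\<And>v. v = (al \<bullet>c v) *s e0 + (xi \<bullet>c v) *s e1 + (et \<bullet>c v) *s e2"
    and dual_basis: "al \<bullet>c e0 = 1" "al \<bullet>c e1 = 0" "al \<bullet>c e2 = 0"
      "xi \<bullet>c e0 = 0" "xi \<bullet>c e1 = 1" "xi \<bullet>c e2 = 0"
      "et \<bullet>c e0 = 0" "et \<bullet>c e1 = 0" "et \<bullet>c e2 = 1"
begin

lemma mem_H: "v \<in> H \<longleftrightarrow> al \<bullet>c v = 0"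
  by (simp add: H_eq)

lemma subspace_H: "vec.subspace H"
  unfolding H_eq by (rule subspace_dot_kernel)

lemma e1_mem: "e1 \<in> H" and e2_mem: "e2 \<in> H"
  by (simp_all add: mem_H dual_basis)

lemma e1_nonzero: "e1 \<noteq> 0" and e2_nonzero: "e2 \<noteq> 0"
  using dual_basis by auto

lemma decomp_H: "v \<in> H \<Longrightarrow> v = (xi \<bullet>c v) *s e1 + (et \<bullet>c v) *s e2"
  using decomp[of v] by (simp add: mem_H)

text \<open>The area form of \<open>H\<close> in the coordinates \<open>xi, et\<close>: vectors of \<open>H\<close> are parallel exactly if \<open>om\<close> vanishes on them.
For fixed \<open>x \<in> H\<close> it serves as the equation, on \<open>H\<close>, of the line through \<open>x\<close>.\<close>

definition om :: "complex^3 \<Rightarrow> complex^3 \<Rightarrow> complex" where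
  "om v w = (xi \<bullet>c v) * (et \<bullet>c w) - (et \<bullet>c v) * (xi \<bullet>c w)"

definition om_form :: "complex^3 \<Rightarrow> complex^3" where
  "om_form w = (et \<bullet>c w) *s xi - (xi \<bullet>c w) *s et"

lemma om_form: "om v w = om_form w \<bullet>c v"
  by (simp add: om_def om_form_def dot_scale_left dot_diff_left)

lemma om_self [simp]: "om v v = 0"
  by (simp add: om_def)

lemma om_linear_right:
  "om v (w + w') = om v w + om v w'" "om v (w - w') = om v w - om v w'" "om v (t *s w) = t * om v w"
  by (simp_all add: om_def dot_linear algebra_simps)

lemma om_linear_left:
  "om (w + w') v = om w v + om w' v" "om (w - w') v = om w v - om w' v" "om (t *s w) v = t * om w v"
  by (simp_all add: om_def dot_linear algebra_simps)

lemma om_e2: "om v e2 = xi \<bullet>c v"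
  by (simp add: om_def dual_basis)

lemma form_om_const: "form 1 (\<lambda>v. om v w)"
  by (simp add: om_form form_dot)

lemma form_om: "vform d \<theta> \<Longrightarrow> form (d + 1) (\<lambda>v. om v (\<theta> v))"
  unfolding om_def by (intro form_diff form_mult'[OF form_dot form_dot_vform]) auto

lemma om_unit:
  assumes "x \<in> H" "x \<noteq> 0" obtains e where "e \<in> H" "om e x = 1"
proof (cases "et \<bullet>c x = 0")
  case False
  then show ?thesis
    by (intro that[of "(1 / (et \<bullet>c x)) *s e1"])
      (auto simp: om_def dot_linear dual_basis mem_H)
next
  case True
  then have "xi \<bullet>c x \<noteq> 0" using decomp_H[OF assms(1)] assms(2) by auto
  then show ?thesis
    by (intro that[of "(- 1 / (xi \<bullet>c x)) *s e2"])
      (auto simp: om_def dot_linear dual_basis mem_H simp del: vec.scale_minus_left)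
qed

lemma om_zero_parallel:
  assumes "v \<in> H" "x \<in> H" "x \<noteq> 0" "om v x = 0"
  shows "\<exists>c. v = c *s x"
proof -
  obtain e where e: "e \<in> H" "om e x = 1" using om_unit assms by blast
  \<comment> \<open>In dimension two \<open>om e x v = om v x e + om e v x\<close>.\<close>
  have "om e x * (xi \<bullet>c v) = om v x * (xi \<bullet>c e) + om e v * (xi \<bullet>c x)"
    "om e x * (et \<bullet>c v) = om v x * (et \<bullet>c e) + om e v * (et \<bullet>c x)"
    by (simp_all add: om_def algebra_simps)
  then have "v = om e v *s ((xi \<bullet>c x) *s e1 + (et \<bullet>c x) *s e2)"
    using decomp_H[OF assms(1)] e(2) assms(4) by (simp add: vec.scale_right_distrib)
  then show ?thesis using decomp_H[OF assms(2)] by metis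
qed

lemma divide_plane:
  assumes "form d p" "\<And>v. v \<in> H \<Longrightarrow> p v = 0"
  shows "\<exists>q. form (d - 1) q \<and> (\<forall>v. p v = (al \<bullet>c v) * q v)"
  using form_divide_on[OF assms(1) vec.subspace_UNIV _ dual_basis(1)] assms(2) by (simp add: mem_H)

lemma vform_divide_plane:
  assumes "vform d \<theta>" "\<And>v. v \<in> H \<Longrightarrow> \<theta> v = 0"
  shows "\<exists>\<psi>. vform (d - 1) \<psi> \<and> (\<forall>v. \<theta> v = (al \<bullet>c v) *s \<psi> v)"
proof -
  have "\<forall>i. \<exists>q. form (d - 1) q \<and> (\<forall>v. \<theta> v $ i = (al \<bullet>c v) * q v)"
    using assms by (intro allI divide_plane) (auto simp: vform_def)
  then obtain q where "\<And>i. form (d - 1) (q i)" "\<And>i v. \<theta> v $ i = (al \<bullet>c v) * q i v" by metis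
  then show ?thesis
    by (intro exI[of _ "\<lambda>v. \<chi> i. q i v"]) (auto simp: vform_def vec_eq_iff)
qed

lemma divide_point:
  assumes p: "form d p" "p x = 0" and x: "x \<in> H" "x \<noteq> 0"
  shows "\<exists>q. form (d - 1) q \<and> (\<forall>v\<in>H. p v = om v x * q v)"
proof -
  obtain e where e: "e \<in> H" "om e x = 1" using om_unit x by blast
  have "p v = 0" if "v \<in> H" "om_form x \<bullet>c v = 0" for v
    using om_zero_parallel[of v x] that x form_vanish_scale[OF p] by (auto simp: om_form)
  then show ?thesis
    using form_divide_on[OF p(1) subspace_H e(1), of "om_form x"] e by (simp add: om_form)
qed

lemma cancel_point:
  assumes "form d f" "x \<in> H" "x \<noteq> 0" "\<And>v. v \<in> H \<Longrightarrow> om v x * f v = 0" "v \<in> H"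
  shows "f v = 0"
proof -
  obtain e where e: "e \<in> H" "om e x = 1" using om_unit assms by blast
  then show ?thesis
    using form_cancel_dot[OF assms(1) subspace_H e(1), of "om_form x"] assms by (simp add: om_form)
qed

lemma cancel_plane:
  assumes "form d f" "\<And>v. (al \<bullet>c v) * f v = 0"
  shows "f v = 0"
  using form_cancel_dot[OF assms(1) vec.subspace_UNIV, of e0 al] assms dual_basis by simp

text \<open>In coordinates \<open>(p, q)\<close> of \<open>\<theta>\<close> on \<open>H\<close> the hypothesis reads \<open>xi * q = et * p\<close>.  The two coordinates are coprime,
so \<open>p = xi * f\<close>, and then \<open>q = et * f\<close>.\<close>

lemma radial_on_plane:
  assumes \<theta>: "vform d \<theta>" and tan: "\<And>v. v \<in> H \<Longrightarrow> \<theta> v \<in> H" and par: "\<And>v. v \<in> H \<Longrightarrow> om v (\<theta> v) = 0"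
  shows "\<exists>f. form (d - 1) f \<and> (\<forall>v\<in>H. \<theta> v = f v *s v)"
proof -
  have fp: "form d (\<lambda>v. xi \<bullet>c \<theta> v)" and fq: "form d (\<lambda>v. et \<bullet>c \<theta> v)"
    using \<theta> by (auto intro: form_dot_vform)
  have eq: "(xi \<bullet>c v) * (et \<bullet>c \<theta> v) = (et \<bullet>c v) * (xi \<bullet>c \<theta> v)" if "v \<in> H" for v
    using par[OF that] by (simp add: om_def)
  have "xi \<bullet>c \<theta> e2 = 0" using eq[OF e2_mem] by (simp add: dual_basis)
  from divide_point[OF fp this e2_mem e2_nonzero] obtain f where
    f: "form (d - 1) f" "\<And>v. v \<in> H \<Longrightarrow> xi \<bullet>c \<theta> v = (xi \<bullet>c v) * f v" by (auto simp: om_e2)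
  have "et \<bullet>c \<theta> v - (et \<bullet>c v) * f v = 0" if "v \<in> H" for v
  proof (rule cancel_point[OF _ e2_mem e2_nonzero _ that])
    show "form d (\<lambda>v. et \<bullet>c \<theta> v - (et \<bullet>c v) * f v)"
      by (intro form_diff fq form_mult'[OF form_dot f(1)]) auto
    show "om w e2 * (et \<bullet>c \<theta> w - (et \<bullet>c w) * f w) = 0" if "w \<in> H" for w
      using eq[OF that] f(2)[OF that] by (simp add: om_e2 algebra_simps)
  qed
  then have "\<theta> v = f v *s v" if "v \<in> H" for v
    using decomp_H[OF tan[OF that]] decomp_H[OF that] f(2)[OF that] that
    by (metis (no_types, lifting) eq_iff_diff_eq_0 mult.commute vec.scale_right_distrib vec.scale_scale)
  then show ?thesis using f(1) by blast
qed

text \<open>A form on a plane that vanishes on pairwise different lines is divisible by the product of their equations.  If there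
are more lines than the degree, the quotient has negative degree and the form is zero on the plane.\<close>

lemma vanish_factor:
  assumes "finite R" "form d p"
    and "\<And>x. x \<in> R \<Longrightarrow> x \<in> H" "\<And>x y. x \<in> R \<Longrightarrow> y \<in> R \<Longrightarrow> x \<noteq> y \<Longrightarrow> om x y \<noteq> 0" "0 \<notin> R"
    and "\<And>x. x \<in> R \<Longrightarrow> p x = 0"
  shows "\<exists>q. form (d - int (card R)) q \<and> (\<forall>v\<in>H. p v = (\<Prod>x\<in>R. om v x) * q v)"
  using assms
proof (induction R arbitrary: d p rule: finite_induct)
  case empty
  then show ?case by auto
next
  case (insert z R)
  obtain p' where p': "form (d - 1) p'" "\<And>v. v \<in> H \<Longrightarrow> p v = om v z * p' v"
    using divide_point[OF insert.prems(1), of z] insert.prems by fastforce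
  have "p' x = 0" if "x \<in> R" for x
    using p'(2)[of x] insert.prems(2,3,5) that insert.hyps(2) by (metis insertCI mult_eq_0_iff)
  then obtain q where q: "form (d - 1 - int (card R)) q" "\<And>v. v \<in> H \<Longrightarrow> p' v = (\<Prod>x\<in>R. om v x) * q v"
    using insert.IH[OF p'(1)] insert.prems by auto
  show ?case
    using q p' insert.hyps by (intro exI[of _ q]) (auto simp: algebra_simps)
qed

end

text \<open>A basis \<open>e1, e2\<close> of \<open>H\<close> is completed by any \<open>e0\<close> outside \<open>H\<close>; the coordinates are the rows of the inverse matrix.\<close>

lemma plane_chart_exists:
  assumes "vec.subspace H" "vec.dim H = 2"
  shows "\<exists>al xi et e0 e1 e2. plane_chart H al xi et e0 e1 e2"
proof -
  obtain B where B: "B \<subseteq> H" "vec.independent B" "H \<subseteq> vec.span B" "card B = 2"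
    using vec.basis_exists[of H] assms(2) by metis
  then obtain e1 e2 where e: "B = {e1, e2}" "e1 \<noteq> e2" by (meson card_2_iff)
  have eH: "e1 \<in> H" "e2 \<in> H" using B e by auto
  have "H \<noteq> UNIV" using assms(2) vec.dim_UNIV by (auto simp: card_cart_basis)
  then obtain e0 where e0: "e0 \<notin> H" by auto
  define E where "E = (\<lambda>j::3. if j = 1 then e0 else if j = 2 then e1 else e2)"
  define M :: "complex^3^3" where "M = (\<chi> i j. E j $ i)"
  have col: "column j M = E j" for j by (simp add: column_def M_def vec_eq_iff)
  have ind: "c i = 0" if "(\<Sum>j\<in>UNIV. c j *s column j M) = 0" for c :: "3 \<Rightarrow> complex" and i
  proof -
    have s: "c 1 *s e0 + (c 2 *s e1 + c 3 *s e2) = 0"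
      using that by (simp add: col sum_3 E_def add.assoc)
    have "c 1 = 0"
    proof (rule ccontr)
      assume "c 1 \<noteq> 0"
      then have "e0 = (- 1 / c 1) *s (c 2 *s e1 + c 3 *s e2)"
        using s by (simp add: vec_eq_iff field_simps eq_neg_iff_add_eq_0 add.commute add.left_commute)
      moreover have "c 2 *s e1 + c 3 *s e2 \<in> H"
        using eH assms(1) by (intro vec.subspace_add vec.subspace_scale)
      ultimately show False using e0 assms(1) vec.subspace_scale by metis
    qed
    moreover have "c 2 = 0 \<and> c 3 = 0"
    proof -
      have "(\<Sum>v\<in>{e1,e2}. (if v = e1 then c 2 else c 3) *s v) = 0"
        using s \<open>c 1 = 0\<close> e(2) by simp
      then show ?thesis
        using vec.independentD[OF B(2), of "{e1,e2}" "\<lambda>v. if v = e1 then c 2 else c 3"] e by fastforce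
    qed
    ultimately show ?thesis using exhaust_3[of i] by auto
  qed
  then obtain N where N: "N ** M = mat 1"
    using matrix_left_invertible_independent_columns[of M] by blast
  then have MN: "M ** N = mat 1" using matrix_left_right_inverse by blast
  have dotN: "N $ j \<bullet>c v = (N *v v) $ j" for j v
    by (simp add: dot_def matrix_vector_mult_def)
  have dual: "N $ i \<bullet>c E j = (if i = j then 1 else 0)" for i j
    using N by (simp add: dot_def matrix_matrix_mult_def vec_eq_iff M_def mat_def)
  have dec: "v = (N $ 1 \<bullet>c v) *s e0 + (N $ 2 \<bullet>c v) *s e1 + (N $ 3 \<bullet>c v) *s e2" for v
  proof -
    have "v = M *v (N *v v)" by (simp add: matrix_vector_mul_assoc MN)
    also have "\<dots> = (\<Sum>j\<in>UNIV. (N *v v) $ j *s E j)" by (simp add: matrix_mult_sum col)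
    finally show ?thesis by (simp add: sum_3 dotN E_def)
  qed
  have "H = {v. N $ 1 \<bullet>c v = 0}"
  proof safe
    fix v assume v: "v \<in> H"
    show "N $ 1 \<bullet>c v = 0"
    proof (rule ccontr)
      assume nz: "N $ 1 \<bullet>c v \<noteq> 0"
      let ?w = "(N $ 2 \<bullet>c v) *s e1 + (N $ 3 \<bullet>c v) *s e2"
      have "v - ?w \<in> H"
        using v eH assms(1) by (intro vec.subspace_diff vec.subspace_add vec.subspace_scale)
      moreover have "v - ?w = (N $ 1 \<bullet>c v) *s e0" by (subst (1) dec) simp
      ultimately have "(1 / (N $ 1 \<bullet>c v)) *s ((N $ 1 \<bullet>c v) *s e0) \<in> H"
        using assms(1) by (metis vec.subspace_scale)
      then show False using nz e0 by simp
    qed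
  next
    fix v assume "N $ 1 \<bullet>c v = 0"
    then show "v \<in> H"
      using eH assms(1) by (subst dec) (auto intro!: vec.subspace_add vec.subspace_scale)
  qed
  then have "plane_chart H (N$1) (N$2) (N$3) e0 e1 e2"
    using dual[of _ 1] dual[of _ 2] dual[of _ 3] dec by unfold_locales (auto simp: E_def)
  then show ?thesis by blast
qed

section \<open>Logarithmic forms and their bases\<close>

text \<open>The degree \<open>d\<close> part of \<open>D(A)\<close>, as polynomial maps.  Tangency to \<open>H\<close> is divisibility of \<open>\<theta>(\<alpha>\<^sub>H)\<close> by \<open>\<alpha>\<^sub>H\<close>,
by the factor theorem; see \<open>log_derivations_iff\<close>.\<close>

definition log_forms :: "(complex^3) set set \<Rightarrow> int \<Rightarrow> (complex^3 \<Rightarrow> complex^3) set" where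
  "log_forms A d = {\<theta>. vform d \<theta> \<and> (\<forall>H\<in>A. \<forall>v\<in>H. \<theta> v \<in> H)}"

text \<open>A homogeneous basis of \<open>D(A)\<close>, stated degree by degree so that only forms occur as coefficients.\<close>

definition log_basis ::
  "(complex^3) set set \<Rightarrow> int \<Rightarrow> int \<Rightarrow> int \<Rightarrow>
     (complex^3 \<Rightarrow> complex^3) \<Rightarrow> (complex^3 \<Rightarrow> complex^3) \<Rightarrow> (complex^3 \<Rightarrow> complex^3) \<Rightarrow> bool" where
  "log_basis A d1 d2 d3 \<theta>1 \<theta>2 \<theta>3 \<longleftrightarrow>
     \<theta>1 \<in> log_forms A d1 \<and> \<theta>2 \<in> log_forms A d2 \<and> \<theta>3 \<in> log_forms A d3 \<and>
     (\<forall>d. \<forall>\<psi>\<in>log_forms A d. \<exists>f g h. form (d - d1) f \<and> form (d - d2) g \<and> form (d - d3) h \<and>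
        (\<forall>v. \<psi> v = f v *s \<theta>1 v + g v *s \<theta>2 v + h v *s \<theta>3 v)) \<and>
     (\<forall>d f g h. form (d - d1) f \<longrightarrow> form (d - d2) g \<longrightarrow> form (d - d3) h \<longrightarrow>
        (\<forall>v. f v *s \<theta>1 v + g v *s \<theta>2 v + h v *s \<theta>3 v = 0) \<longrightarrow> (\<forall>v. f v = 0 \<and> g v = 0 \<and> h v = 0))"

abbreviation free_basis ::
  "(complex^3) set set \<Rightarrow> int \<Rightarrow> int \<Rightarrow> (complex^3 \<Rightarrow> complex^3) \<Rightarrow> (complex^3 \<Rightarrow> complex^3) \<Rightarrow> bool" where
  "free_basis A a b \<theta> \<phi> \<equiv> log_basis A 1 a b (\<lambda>v. v) \<theta> \<phi>"

definition free_exp :: "(complex^3) set set \<Rightarrow> int \<Rightarrow> int \<Rightarrow> bool" where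
  "free_exp A a b \<longleftrightarrow> (\<exists>\<theta> \<phi>. free_basis A a b \<theta> \<phi>)"

definition points_on :: "(complex^3) set set \<Rightarrow> (complex^3) set \<Rightarrow> (complex^3) set set" where
  "points_on A H = (\<lambda>K. H \<inter> K) ` (A - {H})"

lemma log_basis_memD:
  assumes "log_basis A d1 d2 d3 \<theta>1 \<theta>2 \<theta>3"
  shows "\<theta>1 \<in> log_forms A d1" "\<theta>2 \<in> log_forms A d2" "\<theta>3 \<in> log_forms A d3"
  using assms unfolding log_basis_def by blast+

lemma log_basis_spanD:
  assumes "log_basis A d1 d2 d3 \<theta>1 \<theta>2 \<theta>3" "\<psi> \<in> log_forms A d"
  obtains f g h where "form (d - d1) f" "form (d - d2) g" "form (d - d3) h"
    "\<And>v. \<psi> v = f v *s \<theta>1 v + g v *s \<theta>2 v + h v *s \<theta>3 v"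
  using assms unfolding log_basis_def by metis

lemma log_basis_indepD:
  assumes "log_basis A d1 d2 d3 \<theta>1 \<theta>2 \<theta>3" "form (d - d1) f" "form (d - d2) g" "form (d - d3) h"
    "\<And>v. f v *s \<theta>1 v + g v *s \<theta>2 v + h v *s \<theta>3 v = 0"
  shows "f v = 0" "g v = 0" "h v = 0"
  using assms unfolding log_basis_def by metis+

lemma log_basis_swap12:
  assumes B: "log_basis A d1 d2 d3 \<theta>1 \<theta>2 \<theta>3"
  shows "log_basis A d2 d1 d3 \<theta>2 \<theta>1 \<theta>3"
  unfolding log_basis_def
  proof (intro conjI allI ballI impI log_basis_memD[OF B])
  fix d \<psi> assume "\<psi> \<in> log_forms A d"
  from log_basis_spanD[OF B this] obtain f g h where fgh: "form (d - d1) f" "form (d - d2) g" "form (d - d3) h"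
    and eq: "\<And>v. \<psi> v = f v *s \<theta>1 v + g v *s \<theta>2 v + h v *s \<theta>3 v" by metis
  show "\<exists>f g h. form (d - d2) f \<and> form (d - d1) g \<and> form (d - d3) h \<and>
      (\<forall>v. \<psi> v = f v *s \<theta>2 v + g v *s \<theta>1 v + h v *s \<theta>3 v)"
  proof (intro exI conjI allI)
    show "\<psi> v = g v *s \<theta>2 v + f v *s \<theta>1 v + h v *s \<theta>3 v" for v
      unfolding eq by (simp only: add.commute add.left_commute)
  qed fact+
  next
  fix d f g h v
  assume fgh: "form (d - d2) f" "form (d - d1) g" "form (d - d3) h"
    and eq: "\<forall>v. f v *s \<theta>2 v + g v *s \<theta>1 v + h v *s \<theta>3 v = 0"
  have "g w *s \<theta>1 w + f w *s \<theta>2 w + h w *s \<theta>3 w = 0" for w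
    using eq by (metis add.commute)
  from log_basis_indepD[OF B fgh(2,1,3) this] show "f v = 0" "g v = 0" "h v = 0" by auto
  qed
lemma log_basis_swap23:
  assumes B: "log_basis A d1 d2 d3 \<theta>1 \<theta>2 \<theta>3"
  shows "log_basis A d1 d3 d2 \<theta>1 \<theta>3 \<theta>2"
  unfolding log_basis_def
proof (intro conjI allI ballI impI log_basis_memD[OF B])
  fix d \<psi> assume "\<psi> \<in> log_forms A d"
  from log_basis_spanD[OF B this] obtain f g h where fgh: "form (d - d1) f" "form (d - d2) g" "form (d - d3) h"
    and eq: "\<And>v. \<psi> v = f v *s \<theta>1 v + g v *s \<theta>2 v + h v *s \<theta>3 v" by metis
  show "\<exists>f g h. form (d - d1) f \<and> form (d - d3) g \<and> form (d - d2) h \<and>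
      (\<forall>v. \<psi> v = f v *s \<theta>1 v + g v *s \<theta>3 v + h v *s \<theta>2 v)"
  proof (intro exI conjI allI)
    show "\<psi> v = f v *s \<theta>1 v + h v *s \<theta>3 v + g v *s \<theta>2 v" for v
      unfolding eq by (simp only: add.commute add.left_commute)
  qed fact+
next
  fix d f g h v
  assume fgh: "form (d - d1) f" "form (d - d3) g" "form (d - d2) h"
    and eq: "\<forall>v. f v *s \<theta>1 v + g v *s \<theta>3 v + h v *s \<theta>2 v = 0"
  have "f w *s \<theta>1 w + h w *s \<theta>2 w + g w *s \<theta>3 w = 0" for w
    using eq[rule_format, of w] by (simp only: add.commute add.left_commute)
  from log_basis_indepD[OF B fgh(1,3,2) this] show "f v = 0" "g v = 0" "h v = 0" by auto
qed

lemma free_exp_sym: "free_exp A a b \<Longrightarrow> free_exp A b a"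
  unfolding free_exp_def using log_basis_swap23 by blast

lemma central_arrangementD:
  assumes "central_arrangement A" "H \<in> A"
  shows "vec.subspace H" "vec.dim H = 2"
  using assms by (auto simp: central_arrangement_def)

lemma log_forms_add:
  "central_arrangement A \<Longrightarrow> \<theta> \<in> log_forms A d \<Longrightarrow> \<phi> \<in> log_forms A d \<Longrightarrow> (\<lambda>v. \<theta> v + \<phi> v) \<in> log_forms A d"
  by (auto simp: log_forms_def intro!: vform_add vec.subspace_add dest: central_arrangementD)

lemma log_forms_diff:
  "central_arrangement A \<Longrightarrow> \<theta> \<in> log_forms A d \<Longrightarrow> \<phi> \<in> log_forms A d \<Longrightarrow> (\<lambda>v. \<theta> v - \<phi> v) \<in> log_forms A d"
  by (auto simp: log_forms_def intro!: vform_diff vec.subspace_diff dest: central_arrangementD)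

lemma log_forms_mult:
  "central_arrangement A \<Longrightarrow> form d f \<Longrightarrow> \<theta> \<in> log_forms A e \<Longrightarrow> n = d + e \<Longrightarrow>
    (\<lambda>v. f v *s \<theta> v) \<in> log_forms A n"
  by (auto simp: log_forms_def intro!: vform_mult vec.subspace_scale dest: central_arrangementD)

lemma log_forms_id: "(\<lambda>v. v) \<in> log_forms A 1"
  by (auto simp: log_forms_def vform_id)

text \<open>Adding to \<open>\<phi>\<close> multiples of the other two basis fields is a unimodular change of basis.\<close>

lemma free_basis_change:
  assumes A: "central_arrangement A" and basis: "free_basis A a b \<theta> \<phi>"
    and p: "form (b - 1) p" and q: "form (b - a) q"
  shows "free_basis A a b \<theta> (\<lambda>v. \<phi> v - q v *s \<theta> v - p v *s v)"
  unfolding log_basis_def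
proof (intro conjI allI ballI impI)
  show "(\<lambda>v. v) \<in> log_forms A 1" by (rule log_forms_id)
  have \<theta>: "\<theta> \<in> log_forms A a" and \<phi>: "\<phi> \<in> log_forms A b" using basis by (auto simp: log_basis_def)
  show "\<theta> \<in> log_forms A a" by fact
  show "(\<lambda>v. \<phi> v - q v *s \<theta> v - p v *s v) \<in> log_forms A b"
    by (intro log_forms_diff A \<phi> log_forms_mult[OF A q \<theta>] log_forms_mult[OF A p log_forms_id]) auto
next
  fix d \<psi> assume "\<psi> \<in> log_forms A d"
  from log_basis_spanD[OF basis this] obtain f g h where
    fgh: "form (d - 1) f" "form (d - a) g" "form (d - b) h"
    "\<And>v. \<psi> v = f v *s v + g v *s \<theta> v + h v *s \<phi> v" by metis
  show "\<exists>f g h. form (d - 1) f \<and> form (d - a) g \<and> form (d - b) h \<and>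
      (\<forall>v. \<psi> v = f v *s v + g v *s \<theta> v + h v *s (\<phi> v - q v *s \<theta> v - p v *s v))"
  proof (intro exI conjI allI)
    show "form (d - 1) (\<lambda>v. f v + h v * p v)" "form (d - a) (\<lambda>v. g v + h v * q v)"
      by (intro form_add fgh form_mult'[OF fgh(3) p] form_mult'[OF fgh(3) q]; simp)+
    show "form (d - b) h" by fact
    fix v
    show "\<psi> v = (f v + h v * p v) *s v + (g v + h v * q v) *s \<theta> v + h v *s (\<phi> v - q v *s \<theta> v - p v *s v)"
      by (simp add: fgh(4) vec_eq_iff algebra_simps)
  qed
next
  fix d f g h v
  assume fgh: "form (d - 1) f" "form (d - a) g" "form (d - b) h"
    "\<forall>v. f v *s v + g v *s \<theta> v + h v *s (\<phi> v - q v *s \<theta> v - p v *s v) = 0"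
  have 1: "form (d - 1) (\<lambda>v. f v - h v * p v)"
    by (intro form_diff fgh form_mult'[OF fgh(3) p]) simp
  have 2: "form (d - a) (\<lambda>v. g v - h v * q v)"
    by (intro form_diff fgh form_mult'[OF fgh(3) q]) simp
  have 3: "(f w - h w * p w) *s w + (g w - h w * q w) *s \<theta> w + h w *s \<phi> w = 0" for w
  proof -
    have "(f w - h w * p w) *s w + (g w - h w * q w) *s \<theta> w + h w *s \<phi> w
        = f w *s w + g w *s \<theta> w + h w *s (\<phi> w - q w *s \<theta> w - p w *s w)"
      by (simp add: vec_eq_iff algebra_simps)
    also have "\<dots> = 0" by (rule fgh(4)[rule_format])
    finally show ?thesis .
  qed
  note z = log_basis_indepD[OF basis 1 2 fgh(3) 3]
  show "h v = 0" by (rule z(3))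
  then show "f v = 0" "g v = 0" using z(1)[of v] z(2)[of v] by auto
qed

section \<open>Deleting a plane with many points\<close>

lemma plane_not_subset:
  assumes "vec.subspace H" "vec.dim H = 2" "vec.subspace K" "vec.dim K = 2" "H \<noteq> K"
  shows "\<exists>e\<in>K. e \<notin> H"
  using assms vec.subspace_dim_equal[of K H] by fastforce

text \<open>Tangency to \<open>K\<close> survives division by a linear form that does not vanish identically on \<open>K\<close>.\<close>

lemma tangent_cancel:
  assumes K: "vec.subspace K" "vec.dim K = 2" and e: "e \<in> K" "a \<bullet>c e \<noteq> 0"
    and \<psi>: "vform d \<psi>" and tan: "\<And>v. v \<in> K \<Longrightarrow> (a \<bullet>c v) *s \<psi> v \<in> K" and v: "v \<in> K"
  shows "\<psi> v \<in> K"
proof -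
  obtain b xi et f0 f1 f2 where "plane_chart K b xi et f0 f1 f2" using plane_chart_exists[OF K] by blast
  then interpret K: plane_chart K b xi et f0 f1 f2 .
  have "b \<bullet>c \<psi> v = 0"
    using tan by (intro form_cancel_dot[OF form_dot_vform[OF \<psi>] K(1) e _ v]) (simp add: K.mem_H dot_linear)
  then show ?thesis by (simp add: K.mem_H)
qed

context plane_chart
begin

text \<open>On \<open>H\<close> the equation \<open>b\<close> of another plane is a nonzero linear form, so it is \<open>om\<close> against a vector \<open>x\<close> that spans
the common line.\<close>

lemma meet_plane:
  assumes K: "vec.subspace K" "vec.dim K = 2" "K \<noteq> H" and dimH: "vec.dim H = 2"
  obtains b x where "K = {v. b \<bullet>c v = 0}" "x \<in> H" "x \<noteq> 0" "H \<inter> K = range (\<lambda>c. c *s x)"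
    "\<And>v. v \<in> H \<Longrightarrow> b \<bullet>c v = - om v x"
proof -
  obtain b xi' et' f0 f1 f2 where "plane_chart K b xi' et' f0 f1 f2" using plane_chart_exists[OF K(1,2)] by blast
  then interpret K: plane_chart K b xi' et' f0 f1 f2 .
  define x where "x = (b \<bullet>c e2) *s e1 - (b \<bullet>c e1) *s e2"
  have xH: "x \<in> H" unfolding x_def
    by (intro vec.subspace_diff vec.subspace_scale subspace_H e1_mem e2_mem)
  have bx: "b \<bullet>c v = - om v x" if "v \<in> H" for v
    by (subst decomp_H[OF that]) (simp add: x_def om_def dot_linear dual_basis algebra_simps)
  obtain e where e: "e \<in> H" "e \<notin> K" using plane_not_subset[OF K(1,2) subspace_H dimH K(3)] by blast
  have x0: "x \<noteq> 0" using e bx[OF e(1)] by (auto simp: K.mem_H om_def)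
  have "H \<inter> K = range (\<lambda>c. c *s x)"
  proof safe
    fix v assume v: "v \<in> H" "v \<in> K"
    then have "om v x = 0" using bx by (simp add: K.mem_H)
    then show "v \<in> range (\<lambda>c. c *s x)" using om_zero_parallel[OF v(1) xH x0] by auto
  next
    fix c show "c *s x \<in> H" using xH subspace_H by (rule vec.subspace_scale[rotated])
    then show "c *s x \<in> K" using bx by (simp add: K.mem_H om_linear_left)
  qed
  then show ?thesis using that[of b x] xH x0 bx K.H_eq by blast
qed

lemma meet_plane_rep:
  assumes K: "vec.subspace K" "vec.dim K = 2" "K \<noteq> H" and dimH: "vec.dim H = 2"
    and x: "H \<inter> K = range (\<lambda>c. c *s x)"
  shows "\<exists>b k. K = {v. b \<bullet>c v = 0} \<and> k \<noteq> 0 \<and> (\<forall>v\<in>H. b \<bullet>c v = k * om v x)"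
proof -
  obtain b y where b: "K = {v. b \<bullet>c v = 0}" "y \<in> H" "y \<noteq> 0" "H \<inter> K = range (\<lambda>c. c *s y)"
    "\<And>v. v \<in> H \<Longrightarrow> b \<bullet>c v = - om v y"
    using meet_plane[OF K dimH] by metis
  have "1 *s y \<in> H \<inter> K" unfolding b(4) by blast
  then obtain c where c: "y = c *s x" using x by auto
  then show ?thesis
    using b by (intro exI[of _ b] exI[of _ "- c"]) (auto simp: om_linear_right)
qed

text \<open>A point of \<open>A\<close> on \<open>H\<close> is a line through the origin; \<open>rep\<close> picks a nonzero vector on each of them.\<close>

definition point_reps :: "(complex^3) set set \<Rightarrow> ((complex^3) set \<Rightarrow> complex^3) \<Rightarrow> bool" where
  "point_reps A rep \<longleftrightarrow>
     (\<forall>X\<in>points_on A H. rep X \<in> H \<and> rep X \<noteq> 0 \<and> X = range (\<lambda>c. c *s rep X)) \<and>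
     (\<forall>X\<in>points_on A H. \<forall>Y\<in>points_on A H. X \<noteq> Y \<longrightarrow> om (rep X) (rep Y) \<noteq> 0) \<and>
     inj_on rep (points_on A H)"

lemma point_repsD:
  assumes "point_reps A rep"
  shows "X \<in> points_on A H \<Longrightarrow> rep X \<in> H \<and> rep X \<noteq> 0 \<and> X = range (\<lambda>c. c *s rep X)"
    "X \<in> points_on A H \<Longrightarrow> Y \<in> points_on A H \<Longrightarrow> X \<noteq> Y \<Longrightarrow> om (rep X) (rep Y) \<noteq> 0"
    "inj_on rep (points_on A H)"
proof -
  note r = assms[unfolded point_reps_def]
  show "X \<in> points_on A H \<Longrightarrow> rep X \<in> H \<and> rep X \<noteq> 0 \<and> X = range (\<lambda>c. c *s rep X)"
    by (rule bspec[OF conjunct1[OF r]])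
  show "X \<in> points_on A H \<Longrightarrow> Y \<in> points_on A H \<Longrightarrow> X \<noteq> Y \<Longrightarrow> om (rep X) (rep Y) \<noteq> 0"
    by (rule bspec[OF bspec[OF conjunct1[OF conjunct2[OF r]]], THEN mp])
  show "inj_on rep (points_on A H)" by (rule conjunct2[OF conjunct2[OF r]])
qed

lemma points_on_reps:
  assumes A: "central_arrangement A" and H: "H \<in> A"
  shows "\<exists>rep. point_reps A rep"
proof -
  have "\<exists>x. x \<in> H \<and> x \<noteq> 0 \<and> X = range (\<lambda>c. c *s x)" if X: "X \<in> points_on A H" for X
  proof -
    obtain K where K: "K \<in> A" "K \<noteq> H" "X = H \<inter> K" using X by (auto simp: points_on_def)
    show ?thesis
      using meet_plane[OF central_arrangementD[OF A K(1)] K(2) central_arrangementD(2)[OF A H]] K(3) by metis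
  qed
  then obtain rep where rep: "\<And>X. X \<in> points_on A H \<Longrightarrow> rep X \<in> H \<and> rep X \<noteq> 0 \<and> X = range (\<lambda>c. c *s rep X)"
    by metis
  have "om (rep X) (rep Y) \<noteq> 0" if XY: "X \<in> points_on A H" "Y \<in> points_on A H" "X \<noteq> Y" for X Y
  proof
    assume "om (rep X) (rep Y) = 0"
    then obtain c where c: "rep X = c *s rep Y"
      using om_zero_parallel[of "rep X" "rep Y"] rep XY by auto
    then have c0: "c \<noteq> 0" using rep[OF XY(1)] by auto
    have "range (\<lambda>t. t *s (c *s rep Y)) = range (\<lambda>t. t *s rep Y)"
    proof safe
      fix t
      have "t *s rep Y = (t / c) *s (c *s rep Y)" using c0 by simp
      then show "t *s rep Y \<in> range (\<lambda>t. t *s (c *s rep Y))" by blast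
    qed auto
    then have "X = Y" using rep[OF XY(1)] rep[OF XY(2)] c by metis
    then show False using XY(3) by simp
  qed
  then have reps_om: "\<forall>X\<in>points_on A H. \<forall>Y\<in>points_on A H. X \<noteq> Y \<longrightarrow> om (rep X) (rep Y) \<noteq> 0" by blast
  have reps_inj: "inj_on rep (points_on A H)" using rep by (metis inj_onI)
  have "\<forall>X\<in>points_on A H. rep X \<in> H \<and> rep X \<noteq> 0 \<and> X = range (\<lambda>c. c *s rep X)"
    by (rule ballI) (rule rep)
  from conjI[OF this conjI[OF reps_om reps_inj]] have "point_reps A rep" unfolding point_reps_def .
  then show ?thesis by (rule exI[of "point_reps A"])
qed

text \<open>On the line \<open>H \<inter> K\<close> a field tangent to both planes is tangent to the line, that is radial.\<close>

lemma om_log_vanishes: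
  assumes A: "central_arrangement A" and H: "H \<in> A" and \<theta>: "\<theta> \<in> log_forms A d"
    and X: "X \<in> points_on A H" "X = range (\<lambda>c. c *s x)"
  shows "om x (\<theta> x) = 0"
proof -
  obtain K where K: "K \<in> A" "X = H \<inter> K" using X by (auto simp: points_on_def)
  have "1 *s x \<in> X" using X(2) by blast
  then have "\<theta> x \<in> X" using K \<theta> H by (auto simp: log_forms_def)
  then show ?thesis using X(2) by (auto simp: om_linear_right)
qed

lemma om_log_factor:
  assumes A: "central_arrangement A" and H: "H \<in> A"
    and reps: "point_reps A rep" and \<theta>: "\<theta> \<in> log_forms A d"
  shows "\<exists>q. form (d + 1 - int (card (points_on A H))) q \<and>
    (\<forall>v\<in>H. om v (\<theta> v) = (\<Prod>x\<in>rep ` points_on A H. om v x) * q v)"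
proof -
  note rep = point_repsD[OF reps]
  have fin: "finite (points_on A H)" using A by (auto simp: points_on_def central_arrangement_def)
  have "form (d + 1) (\<lambda>v. om v (\<theta> v))" using \<theta> by (auto simp: log_forms_def intro: form_om)
  moreover have "om x (\<theta> x) = 0" if "x \<in> rep ` points_on A H" for x
    using that om_log_vanishes[OF A H \<theta>] rep(1) by auto
  moreover have "om x y \<noteq> 0" if "x \<in> rep ` points_on A H" "y \<in> rep ` points_on A H" "x \<noteq> y" for x y
    using that rep(2) by auto
  moreover have "0 \<notin> rep ` points_on A H" using rep(1) by fastforce
  ultimately have "\<exists>q. form (d + 1 - int (card (rep ` points_on A H))) q \<and>
    (\<forall>v\<in>H. om v (\<theta> v) = (\<Prod>x\<in>rep ` points_on A H. om v x) * q v)"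
    using rep(1) fin by (intro vanish_factor) auto
  then show ?thesis by (simp add: card_image[OF rep(3)])
qed

lemma cancel_prod:
  assumes "finite I" "\<And>i. i \<in> I \<Longrightarrow> \<exists>e\<in>H. b i \<bullet>c e \<noteq> 0"
    and "form d g" "\<And>v. v \<in> H \<Longrightarrow> (\<Prod>i\<in>I. b i \<bullet>c v) * g v = 0" "v \<in> H"
  shows "g v = 0"
  using assms
proof (induction I arbitrary: d g v rule: finite_induct)
  case (insert i I)
  obtain e where e: "e \<in> H" "b i \<bullet>c e \<noteq> 0" using insert.prems(1) by blast
  have "(b i \<bullet>c w) * g w = 0" if "w \<in> H" for w
  proof (rule insert.IH[OF _ form_mult[OF form_dot insert.prems(2)] _ that])
    show "(\<Prod>j\<in>I. b j \<bullet>c v) * ((b i \<bullet>c v) * g v) = 0" if "v \<in> H" for v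
      using insert.prems(3)[OF that] insert.hyps by auto
  qed (use insert.prems in auto)
  then show ?case using form_cancel_dot[OF insert.prems(2) subspace_H e] insert.prems(4) by blast
qed simp

text \<open>If \<open>A\<close> has a basis \<open>E, \<theta>, al \<cdot> \<psi>\<close>, then \<open>\<theta>\<close> is not radial on \<open>H\<close>: some logarithmic field is not, and modulo \<open>al\<close> it
is a combination of \<open>E\<close> and \<open>\<theta>\<close>.  Since \<open>om v (\<theta> v)\<close> divides a product of linear forms nonzero on \<open>H\<close>, it can
be cancelled.\<close>

lemma free_basis_om_cancel:
  assumes A: "central_arrangement A" and H: "H \<in> A"
    and basis: "free_basis A a b \<theta> (\<lambda>v. (al \<bullet>c v) *s \<psi> v)"
    and g: "form d g" "\<And>v. v \<in> H \<Longrightarrow> g v * om v (\<theta> v) = 0" and v: "v \<in> H"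
  shows "g v = 0"
proof -
  have "\<forall>K\<in>A - {H}. \<exists>b. K = {v. b \<bullet>c v = 0}"
    using plane_chart_exists[OF central_arrangementD[OF A]] plane_chart.H_eq by (metis DiffD1)
  then obtain k where k: "\<And>K. K \<in> A - {H} \<Longrightarrow> K = {v. k K \<bullet>c v = 0}" by metis
  define Q where "Q v = (\<Prod>K\<in>A - {H}. k K \<bullet>c v)" for v
  have fin: "finite (A - {H})" using A by (simp add: central_arrangement_def)
  have Q: "form (int (card (A - {H}))) Q" unfolding Q_def by (intro form_prod_linear fin form_dot)
  \<comment> \<open>A derivation along \<open>H\<close> that is not radial there: the constant field \<open>e2\<close> times the other forms.\<close>
  have "(\<lambda>v. Q v *s e2) \<in> log_forms A (int (card (A - {H})))"
    unfolding log_forms_def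
  proof (intro CollectI conjI ballI)
    show "vform (int (card (A - {H}))) (\<lambda>v. Q v *s e2)" by (rule vform_mult[OF Q vform_const]) simp
    fix K v assume K: "K \<in> A" "v \<in> K"
    show "Q v *s e2 \<in> K"
    proof (cases "K = H")
      case True
      then show ?thesis using e2_mem subspace_H by (auto intro: vec.subspace_scale)
    next
      case False
      then have "k K \<bullet>c v = 0" using k K by blast
      then have "Q v = 0" unfolding Q_def using False K fin by auto
      then show ?thesis using central_arrangementD[OF A K(1)] by (simp add: vec.subspace_0)
    qed
  qed
  from log_basis_spanD[OF basis this] obtain f0 g0 h0 where
    0: "\<And>v. Q v *s e2 = f0 v *s v + g0 v *s \<theta> v + h0 v *s ((al \<bullet>c v) *s \<psi> v)" by metis
  have om0: "Q v * om v e2 = g0 v * om v (\<theta> v)" if "v \<in> H" for v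
  proof -
    have "om v (Q v *s e2) = om v (f0 v *s v + g0 v *s \<theta> v)" using 0[of v] that by (simp add: mem_H)
    then show ?thesis by (simp add: om_linear_right)
  qed
  have "Q v * (om v e2 * g v) = 0" if "v \<in> H" for v
    using om0[OF that] g(2)[OF that] by (metis mult.assoc mult.commute mult_zero_right)
  moreover have "\<exists>e\<in>H. k K \<bullet>c e \<noteq> 0" if "K \<in> A - {H}" for K
    using plane_not_subset[of K H] central_arrangementD[OF A] H that k[OF that] by fast
  ultimately have "om v e2 * g v = 0" if "v \<in> H" for v
    unfolding Q_def using that
    by (intro cancel_prod[OF fin _ form_mult[OF form_om_const g(1)], of k]) auto
  then show ?thesis using cancel_point[OF g(1) e2_mem e2_nonzero _ v] by blast
qed

text \<open>For \<open>\<rho>\<close> tangent to the remaining planes \<open>al \<cdot> \<rho>\<close> is logarithmic, so \<open>al \<cdot> \<rho> = f E + g \<theta> + h al \<psi>\<close>.  On \<open>H\<close> the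
fields \<open>E\<close> and \<open>\<theta>\<close> are independent, so \<open>f\<close> and \<open>g\<close> vanish there and \<open>al\<close> cancels from the whole equation.\<close>

lemma free_basis_delete:
  assumes A: "central_arrangement A" and H: "H \<in> A"
    and basis: "free_basis A a b \<theta> (\<lambda>v. (al \<bullet>c v) *s \<psi> v)" and \<psi>: "vform (b - 1) \<psi>"
  shows "free_basis (A - {H}) a (b - 1) \<theta> \<psi>"
  unfolding log_basis_def
proof (intro conjI allI ballI impI)
  show "(\<lambda>v. v) \<in> log_forms (A - {H}) 1" by (rule log_forms_id)
  show "\<theta> \<in> log_forms (A - {H}) a" using basis by (auto simp: log_basis_def log_forms_def)
  have "\<psi> v \<in> K" if K: "K \<in> A - {H}" "v \<in> K" for v K
  proof -
    obtain e where e: "e \<in> K" "e \<notin> H"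
      using plane_not_subset[of H K] central_arrangementD[OF A] H K by blast
    show ?thesis
    proof (rule tangent_cancel[OF _ _ e(1) _ \<psi> _ K(2)])
      show "vec.subspace K" "vec.dim K = 2" using central_arrangementD[OF A] K by auto
      show "al \<bullet>c e \<noteq> 0" using e by (simp add: mem_H)
      show "(al \<bullet>c v) *s \<psi> v \<in> K" if "v \<in> K" for v
        using basis K that by (auto simp: log_basis_def log_forms_def)
    qed
  qed
  then show "\<psi> \<in> log_forms (A - {H}) (b - 1)" using \<psi> by (auto simp: log_forms_def)
next
  fix d \<rho> assume \<rho>: "\<rho> \<in> log_forms (A - {H}) d"
  have "(\<lambda>v. (al \<bullet>c v) *s \<rho> v) \<in> log_forms A (d + 1)"
    unfolding log_forms_def
  proof (intro CollectI conjI ballI)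
    show "vform (d + 1) (\<lambda>v. (al \<bullet>c v) *s \<rho> v)"
      using \<rho> by (intro vform_mult[OF form_dot]) (auto simp: log_forms_def)
    fix K v assume K: "K \<in> A" "v \<in> K"
    note sub = central_arrangementD(1)[OF A K(1)]
    show "(al \<bullet>c v) *s \<rho> v \<in> K"
    proof (cases "K = H")
      case True
      then show ?thesis using K sub by (simp add: mem_H vec.subspace_0)
    next
      case False
      then show ?thesis using \<rho> K sub by (auto simp: log_forms_def intro!: vec.subspace_scale)
    qed
  qed
  from log_basis_spanD[OF basis this] obtain f g h where
    fgh: "form d f" "form (d + 1 - a) g" "form (d + 1 - b) h"
    "\<And>v. (al \<bullet>c v) *s \<rho> v = f v *s v + g v *s \<theta> v + h v *s ((al \<bullet>c v) *s \<psi> v)" by auto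
  have on_H: "f v *s v + g v *s \<theta> v = 0" if "v \<in> H" for v
    using fgh(4)[of v] that by (simp add: mem_H)
  have gH: "g v = 0" if "v \<in> H" for v
  proof (rule free_basis_om_cancel[OF A H basis fgh(2) _ that])
    fix v assume "v \<in> H"
    from on_H[OF this] have "om v (f v *s v + g v *s \<theta> v) = om v 0" by simp
    then show "g v * om v (\<theta> v) = 0" by (simp add: om_linear_right) (simp add: om_def)
  qed
  have fH: "f v = 0" if "v \<in> H" for v
  proof (rule cancel_point[OF fgh(1) e2_mem e2_nonzero _ that])
    fix v assume v: "v \<in> H"
    have "f v *s v = 0" using on_H[OF v] gH[OF v] by simp
    then show "om v e2 * f v = 0" by (auto simp: om_def)
  qed
  obtain f' where f': "form (d - 1) f'" "\<And>v. f v = (al \<bullet>c v) * f' v"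
    using divide_plane[OF fgh(1) fH] by blast
  obtain g' where g': "form (d + 1 - a - 1) g'" "\<And>v. g v = (al \<bullet>c v) * g' v"
    using divide_plane[OF fgh(2) gH] by blast
  show "\<exists>f g h. form (d - 1) f \<and> form (d - a) g \<and> form (d - (b - 1)) h \<and>
      (\<forall>v. \<rho> v = f v *s v + g v *s \<theta> v + h v *s \<psi> v)"
  proof (intro exI conjI allI)
    show f1: "form (d - 1) f'" by fact
    show g1: "form (d - a) g'" using g'(1) by (simp add: algebra_simps)
    show h1: "form (d - (b - 1)) h" using fgh(3) by (simp add: algebra_simps)
    have va: "vform a \<theta>" using basis by (simp add: log_basis_def log_forms_def)
    have v\<rho>: "vform d \<rho>" using \<rho> by (simp add: log_forms_def)
    fix v
    have "vform d (\<lambda>v. f' v *s v)" "vform d (\<lambda>v. g' v *s \<theta> v)" "vform d (\<lambda>v. h v *s \<psi> v)"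
      using vform_mult[OF f1 vform_id, of d] vform_mult[OF g1 va, of d] vform_mult[OF h1 \<psi>, of d] by simp_all
    from vform_diff[OF v\<rho> vform_add[OF vform_add[OF this(1,2)] this(3)]]
    have v\<rho>': "vform d (\<lambda>v. \<rho> v - (f' v *s v + g' v *s \<theta> v + h v *s \<psi> v))" .
    have "(\<rho> v - (f' v *s v + g' v *s \<theta> v + h v *s \<psi> v)) $ i = 0" for i
    proof (rule cancel_plane[where f = "\<lambda>v. (\<rho> v - (f' v *s v + g' v *s \<theta> v + h v *s \<psi> v)) $ i"])
      show "form d (\<lambda>v. (\<rho> v - (f' v *s v + g' v *s \<theta> v + h v *s \<psi> v)) $ i)"
        using v\<rho>' by (simp only: vform_def)
      fix v
      have "(al \<bullet>c v) *s (\<rho> v - (f' v *s v + g' v *s \<theta> v + h v *s \<psi> v)) = 0"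
        using fgh(4)[of v] by (simp add: f' g' vec_eq_iff algebra_simps)
      then show "(al \<bullet>c v) * (\<rho> v - (f' v *s v + g' v *s \<theta> v + h v *s \<psi> v)) $ i = 0"
        by (metis vector_smult_component zero_index)
    qed
    then show "\<rho> v = f' v *s v + g' v *s \<theta> v + h v *s \<psi> v" by (simp add: vec_eq_iff)
  qed
next
  fix d f g h v
  assume fgh: "form (d - 1) f" "form (d - a) g" "form (d - (b - 1)) h"
    "\<forall>v. f v *s v + g v *s \<theta> v + h v *s \<psi> v = 0"
  have 1: "form (d + 1 - 1) (\<lambda>v. (al \<bullet>c v) * f v)" by (rule form_mult'[OF form_dot fgh(1)]) simp
  have 2: "form (d + 1 - a) (\<lambda>v. (al \<bullet>c v) * g v)" by (rule form_mult'[OF form_dot fgh(2)]) simp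
  have 3: "form (d + 1 - b) h" using fgh(3) by (simp add: algebra_simps)
  have 4: "((al \<bullet>c v) * f v) *s v + ((al \<bullet>c v) * g v) *s \<theta> v + h v *s ((al \<bullet>c v) *s \<psi> v) = 0" for v
  proof -
    have "(al \<bullet>c v) *s (f v *s v + g v *s \<theta> v + h v *s \<psi> v) = 0"
      by (simp only: fgh(4)[rule_format] vec.scale_zero_right)
    then show ?thesis by (simp add: vec_eq_iff algebra_simps)
  qed
  note z = log_basis_indepD[OF basis 1 2 3 4]
  show "f v = 0" by (rule cancel_plane[OF fgh(1) z(1)])
  show "g v = 0" by (rule cancel_plane[OF fgh(2) z(2)])
  show "h v = 0" by (rule z(3))
qed

end

text \<open>With at least \<open>a + 1\<close> points on \<open>H\<close>, the form \<open>om v (\<theta> v)\<close> of degree \<open>a + 1\<close> is a constant multiple \<open>c\<close> of the product of the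
equations of the points.  If it is zero, \<open>\<theta>\<close> is radial on \<open>H\<close>.  Otherwise this product divides \<open>om v (\<phi> v)\<close>, and
subtracting a multiple of \<open>\<theta>\<close> makes \<open>\<phi>\<close> radial on \<open>H\<close>.\<close>

theorem free_exp_delete:
  assumes A: "central_arrangement A" and free: "free_exp A a b" and H: "H \<in> A"
    and ab: "a \<le> b" and large: "a < int (card (points_on A H))"
  shows "free_exp (A - {H}) (a - 1) b \<or> free_exp (A - {H}) a (b - 1)"
proof -
  obtain \<theta> \<phi> where basis: "free_basis A a b \<theta> \<phi>" using free by (auto simp: free_exp_def)
  then have \<theta>: "\<theta> \<in> log_forms A a" and \<phi>: "\<phi> \<in> log_forms A b" by (auto simp: log_basis_def)
  obtain al xi et e0 e1 e2 where "plane_chart H al xi et e0 e1 e2"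
    using plane_chart_exists[OF central_arrangementD[OF A H]] by blast
  then interpret plane_chart H al xi et e0 e1 e2 .
  obtain rep where reps: "point_reps A rep" using points_on_reps[OF A H] by blast
  \<comment> \<open>Once a basis element is radial on \<open>H\<close>, subtracting a multiple of the Euler field makes it divisible.\<close>
  have delete: "free_exp (A - {H}) a' (b' - 1)"
    if bas: "free_basis A a' b' \<theta>' \<phi>'" and rad: "\<And>v. v \<in> H \<Longrightarrow> om v (\<phi>' v) = 0" for a' b' \<theta>' \<phi>'
  proof -
    have \<phi>': "\<phi>' \<in> log_forms A b'" using bas by (simp add: log_basis_def)
    obtain f where f: "form (b' - 1) f" "\<And>v. v \<in> H \<Longrightarrow> \<phi>' v = f v *s v"
      using radial_on_plane[of b' \<phi>'] \<phi>' rad H by (auto simp: log_forms_def)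
    define \<phi>'' where "\<phi>'' v = \<phi>' v - 0 *s \<theta>' v - f v *s v" for v
    have bas'': "free_basis A a' b' \<theta>' \<phi>''"
      unfolding \<phi>''_def by (rule free_basis_change[OF A bas f(1) form_zero])
    then have "vform b' \<phi>''" by (simp add: log_basis_def log_forms_def)
    then obtain \<psi> where \<psi>: "vform (b' - 1) \<psi>" "\<And>v. \<phi>'' v = (al \<bullet>c v) *s \<psi> v"
      using vform_divide_plane[of b' \<phi>''] f(2) by (auto simp: \<phi>''_def)
    have "\<phi>'' = (\<lambda>v. (al \<bullet>c v) *s \<psi> v)" using \<psi>(2) by auto
    then show ?thesis
      using free_basis_delete[OF A H _ \<psi>(1), of a' \<theta>'] bas'' by (auto simp: free_exp_def)
  qed
  let ?P = "\<lambda>v. \<Prod>x\<in>rep ` points_on A H. om v x"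
  obtain q where q: "form (a + 1 - int (card (points_on A H))) q"
    "\<And>v. v \<in> H \<Longrightarrow> om v (\<theta> v) = ?P v * q v"
    using om_log_factor[OF A H reps \<theta>] by blast
  show ?thesis
  proof (cases "\<forall>v\<in>H. om v (\<theta> v) = 0")
    case True
    then show ?thesis using delete[OF log_basis_swap23[OF basis]] free_exp_sym by blast
  next
    case False
    then obtain v0 where "q v0 \<noteq> 0" using q(2) by fastforce
    then have card: "int (card (points_on A H)) = a + 1"
      using form_negative_degree[OF q(1)] large by force
    define c where "c = q 0"
    have qc: "q v = c" for v using form_degree_zero[OF q(1)] card by (simp add: c_def)
    then have c0: "c \<noteq> 0" using \<open>q v0 \<noteq> 0\<close> by simp
    obtain r where r: "form (b + 1 - int (card (points_on A H))) r"
      "\<And>v. v \<in> H \<Longrightarrow> om v (\<phi> v) = ?P v * r v"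
      using om_log_factor[OF A H reps \<phi>] by blast
    have r': "form (b - a) (\<lambda>v. (1 / c) * r v)" using r(1) card by (intro form_scale) simp
    have "free_basis A a b \<theta> (\<lambda>v. \<phi> v - ((1 / c) * r v) *s \<theta> v - 0 *s v)"
      by (rule free_basis_change[OF A basis form_zero r'])
    moreover have "om v (\<phi> v - ((1 / c) * r v) *s \<theta> v - 0 *s v) = 0" if "v \<in> H" for v
      using q(2)[OF that] r(2)[OF that] qc c0 by (simp add: om_linear_right)
    ultimately show ?thesis using delete by blast
  qed
qed

section \<open>Dimensions of spaces of forms\<close>

lemma sum_lessThan_plus:
  "(\<Sum>i<k + m. F i) = (\<Sum>i<k. F i) + (\<Sum>i<m. F (k + i))" for F :: "nat \<Rightarrow> 'x::comm_monoid_add"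
  by (induction m) (auto simp: add.assoc)

context vector_space
begin

definition coordinates :: "'b set \<Rightarrow> nat \<Rightarrow> (nat \<Rightarrow> 'b) \<Rightarrow> bool" where
  "coordinates V n b \<longleftrightarrow> V = range (\<lambda>c. \<Sum>i<n. scale (c i) (b i)) \<and>
     (\<forall>c. (\<Sum>i<n. scale (c i) (b i)) = 0 \<longrightarrow> (\<forall>i<n. c i = 0))"

text \<open>Spaces of polynomial functions sit inside infinite-dimensional function spaces, where finite dimension of a
subspace has to be part of the statement; a bare dimension function would not tell the zero space from
an infinite-dimensional one.\<close>

definition hasdim :: "'b set \<Rightarrow> nat \<Rightarrow> bool" where
  "hasdim V n \<longleftrightarrow> (\<exists>b. local.coordinates V n b)"

lemma coordinatesD:
  assumes "local.coordinates V n b"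
  shows "V = range (\<lambda>c. \<Sum>i<n. scale (c i) (b i))"
    "(\<Sum>i<n. scale (c i) (b i)) = 0 \<Longrightarrow> i < n \<Longrightarrow> c i = 0"
  using assms by (simp_all add: local.coordinates_def)

lemma hasdim_dim: assumes "local.hasdim V n" shows "local.dim V = n"
proof -
  obtain b where "local.coordinates V n b" using assms by (auto simp: local.hasdim_def)
  note V = local.coordinatesD(1)[OF this] and ind = local.coordinatesD(2)[OF this]
  have inj: "inj_on b {..<n}"
  proof (rule inj_onI, rule ccontr)
    fix i j assume ij: "i \<in> {..<n}" "j \<in> {..<n}" "b i = b j" "i \<noteq> j"
    let ?c = "\<lambda>l. if l = i then 1 else if l = j then - 1 else 0"
    have "(\<Sum>l<n. scale (?c l) (b l)) = (\<Sum>l\<in>{i, j}. scale (?c l) (b l))"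
      using ij by (intro sum.mono_neutral_right) auto
    also have "\<dots> = 0" using ij by simp
    finally show False using ind[of ?c i] ij by simp
  qed
  have "local.independent (b ` {..<n})"
  proof (rule local.independent_if_scalars_zero)
    fix f x assume f: "(\<Sum>x\<in>b ` {..<n}. scale (f x) x) = 0" and x: "x \<in> b ` {..<n}"
    then show "f x = 0" using ind[of "\<lambda>i. f (b i)"] by (auto simp: sum.reindex[OF inj])
  qed simp
  moreover have "local.span (b ` {..<n}) = V"
  proof -
    have 1: "(\<Sum>i<n. scale (c i) (b i)) = (\<Sum>x\<in>b ` {..<n}. scale (c (the_inv_into {..<n} b x)) x)" for c
      by (simp add: sum.reindex[OF inj] the_inv_into_f_f[OF inj])
    have 2: "(\<Sum>x\<in>b ` {..<n}. scale (u x) x) = (\<Sum>i<n. scale (u (b i)) (b i))" for u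
      by (simp add: sum.reindex[OF inj])
    show ?thesis
      unfolding V local.span_finite[OF finite_imageI[OF finite_lessThan]]
    proof (intro equalityI image_subsetI)
      show "(\<Sum>x\<in>b ` {..<n}. scale (u x) x) \<in> range (\<lambda>c. \<Sum>i<n. scale (c i) (b i))" for u
        unfolding 2 by (rule rangeI)
      show "(\<Sum>i<n. scale (c i) (b i)) \<in> range (\<lambda>u. \<Sum>x\<in>b ` {..<n}. scale (u x) x)" for c
        unfolding 1 by (rule rangeI)
    qed
  qed
  ultimately have "local.dim V = card (b ` {..<n})"
    by (metis local.dim_eq_card local.span_span)
  then show ?thesis by (simp add: card_image[OF inj])
qed

lemma hasdim_unique: "local.hasdim V m \<Longrightarrow> local.hasdim V n \<Longrightarrow> m = n"
  using local.hasdim_dim by blast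

lemma hasdim_zero: "local.hasdim {0} 0"
  by (auto simp: local.hasdim_def local.coordinates_def)

end

context vector_space_pair
begin

lemma hasdim_image:
  assumes f: "Vector_Spaces.linear s1 s2 f"
    and V: "vs1.hasdim V n" and inj: "\<And>v. v \<in> V \<Longrightarrow> f v = 0 \<Longrightarrow> v = 0"
  shows "vs2.hasdim (f ` V) n"
proof -
  interpret f: Vector_Spaces.linear s1 s2 f by fact
  obtain b where "vs1.coordinates V n b" using V by (auto simp: vs1.hasdim_def)
  note V = vs1.coordinatesD(1)[OF this] and ind = vs1.coordinatesD(2)[OF this]
  have f_sum: "f (\<Sum>i<n. s1 (c i) (b i)) = (\<Sum>i<n. s2 (c i) (f (b i)))" for c
    by (simp add: f.sum f.scale)
  show ?thesis
    unfolding vs2.hasdim_def vs2.coordinates_def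
  proof (intro exI[of _ "\<lambda>i. f (b i)"] conjI allI impI)
    have "(\<lambda>c. f (\<Sum>i<n. s1 (c i) (b i))) = (\<lambda>c. \<Sum>i<n. s2 (c i) (f (b i)))"
      by (rule ext) (rule f_sum)
    then show "f ` V = range (\<lambda>c. \<Sum>i<n. s2 (c i) (f (b i)))"
      by (simp only: V image_image)
    fix c i assume "(\<Sum>i<n. s2 (c i) (f (b i))) = 0" "i < n"
    moreover have "(\<Sum>i<n. s1 (c i) (b i)) \<in> V" unfolding V by (rule rangeI)
    ultimately show "c i = 0" using inj[of "\<Sum>i<n. s1 (c i) (b i)"] ind[of c i] f_sum[of c] by simp
  qed
qed

text \<open>All dimensions below come from this: a basis of the kernel and preimages of a basis of the image together form a basis.\<close>

lemma hasdim_rank_nullity: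
  assumes f: "Vector_Spaces.linear s1 s2 f" and U: "vs1.subspace U"
    and ker: "vs1.hasdim {u \<in> U. f u = 0} k" and im: "vs2.hasdim (f ` U) m"
  shows "vs1.hasdim U (k + m)"
proof -
  interpret f: Vector_Spaces.linear s1 s2 f by fact
  obtain b where "vs1.coordinates {u \<in> U. f u = 0} k b" using ker by (auto simp: vs1.hasdim_def)
  note K = vs1.coordinatesD(1)[OF this] and indb = vs1.coordinatesD(2)[OF this]
  obtain e where "vs2.coordinates (f ` U) m e" using im by (auto simp: vs2.hasdim_def)
  note I = vs2.coordinatesD(1)[OF this] and inde = vs2.coordinatesD(2)[OF this]
  have "\<exists>u\<in>U. f u = e i" if "i < m" for i
  proof -
    have "(\<Sum>j<m. s2 (if j = i then 1 else 0) (e j)) = (\<Sum>j\<in>{i}. s2 (if j = i then 1 else 0) (e j))"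
      using that by (intro sum.mono_neutral_right) auto
    also have "\<dots> = e i" by simp
    finally have "e i \<in> f ` U" unfolding I by (intro range_eqI) (rule sym)
    then show ?thesis by auto
  qed
  then obtain g where g: "\<And>i. i < m \<Longrightarrow> g i \<in> U" "\<And>i. i < m \<Longrightarrow> f (g i) = e i" by metis
  define h where "h i = (if i < k then b i else g (i - k))" for i
  have split: "(\<Sum>i<k + m. s1 (c i) (h i)) =
      (\<Sum>i<k. s1 (c i) (b i)) + (\<Sum>i<m. s1 (c (k + i)) (g i))" for c
    by (simp add: sum_lessThan_plus h_def)
  have f_g: "f (\<Sum>i<m. s1 (c i) (g i)) = (\<Sum>i<m. s2 (c i) (e i))" for c
    by (simp add: f.sum f.scale g)
  have f_b: "(\<Sum>i<k. s1 (c i) (b i)) \<in> U" "f (\<Sum>i<k. s1 (c i) (b i)) = 0" for c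
    using K by blast+
  have g_U: "(\<Sum>i<m. s1 (c i) (g i)) \<in> U" for c
    using g U by (intro vs1.subspace_sum vs1.subspace_scale) auto
  show ?thesis
    unfolding vs1.hasdim_def vs1.coordinates_def
  proof (intro exI[of _ h] conjI allI impI)
    show "U = range (\<lambda>c. \<Sum>i<k + m. s1 (c i) (h i))"
    proof safe
      fix u assume u: "u \<in> U"
      then obtain c where c: "f u = (\<Sum>i<m. s2 (c i) (e i))" using I by blast
      have "u - (\<Sum>i<m. s1 (c i) (g i)) \<in> {u \<in> U. f u = 0}"
        using u U g_U c by (simp add: vs1.subspace_diff f.diff f_g)
      then obtain c' where c': "u - (\<Sum>i<m. s1 (c i) (g i)) = (\<Sum>i<k. s1 (c' i) (b i))"
        unfolding K by blast
      have "u = (\<Sum>i<k + m. s1 (if i < k then c' i else c (i - k)) (h i))"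
        unfolding split using c' by (simp add: algebra_simps)
      then show "u \<in> range (\<lambda>c. \<Sum>i<k + m. s1 (c i) (h i))"
        by (rule range_eqI[where x = "\<lambda>i. if i < k then c' i else c (i - k)"])
    next
      fix c show "(\<Sum>i<k + m. s1 (c i) (h i)) \<in> U"
        unfolding split using U f_b g_U by (intro vs1.subspace_add) auto
    qed
    fix c i assume z: "(\<Sum>i<k + m. s1 (c i) (h i)) = 0" and i: "i < k + m"
    have "f (\<Sum>i<k + m. s1 (c i) (h i)) = (\<Sum>i<m. s2 (c (k + i)) (e i))"
      unfolding split by (simp add: f.add f_b f_g)
    then have c_m: "c (k + i) = 0" if "i < m" for i
      using inde[of "\<lambda>i. c (k + i)" i] that z f.zero by auto
    then have "(\<Sum>i<k. s1 (c i) (b i)) = 0" using z unfolding split by simp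
    then have "c i = 0" if "i < k" for i using indb that by blast
    then show "c i = 0" using c_m[of "i - k"] i by (cases "i < k") auto
  qed
qed

end

definition sscale :: "complex \<Rightarrow> ('x \<Rightarrow> complex) \<Rightarrow> 'x \<Rightarrow> complex" where
  "sscale c f = (\<lambda>v. c * f v)"

definition vscale :: "complex \<Rightarrow> ('x \<Rightarrow> complex^3) \<Rightarrow> 'x \<Rightarrow> complex^3" where
  "vscale c f = (\<lambda>v. c *s f v)"

interpretation sfun: vector_space sscale
  by unfold_locales (auto simp: sscale_def fun_eq_iff algebra_simps)

interpretation vfun: vector_space vscale
  by unfold_locales (auto simp: vscale_def fun_eq_iff vec_eq_iff algebra_simps)

interpretation ss: vector_space_pair sscale sscale ..
interpretation sv: vector_space_pair sscale vscale ..
interpretation vs: vector_space_pair vscale sscale ..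
interpretation vv: vector_space_pair vscale vscale ..

lemmas linear_fun_simps = Vector_Spaces.linear_iff sscale_def vscale_def fun_eq_iff vec_eq_iff

lemma sfun_subspaceI:
  assumes "(\<lambda>_. 0) \<in> V" "\<And>f g. f \<in> V \<Longrightarrow> g \<in> V \<Longrightarrow> (\<lambda>v. f v + g v) \<in> V"
    "\<And>c f. f \<in> V \<Longrightarrow> (\<lambda>v. c * f v) \<in> V"
  shows "sfun.subspace V"
  using assms by (simp add: sfun.subspace_def sscale_def plus_fun_def zero_fun_def)

lemma vfun_subspaceI:
  assumes "(\<lambda>_. 0) \<in> V" "\<And>f g. f \<in> V \<Longrightarrow> g \<in> V \<Longrightarrow> (\<lambda>v. f v + g v) \<in> V"
    "\<And>c f. f \<in> V \<Longrightarrow> (\<lambda>v. c *s f v) \<in> V"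
  shows "vfun.subspace V"
  using assms by (simp add: vfun.subspace_def vscale_def plus_fun_def zero_fun_def)

text \<open>Restriction to \<open>H\<close>, with the value zero elsewhere so that restrictions stay in the same function space.\<close>

definition cutoff :: "'x set \<Rightarrow> ('x \<Rightarrow> 'y::zero) \<Rightarrow> 'x \<Rightarrow> 'y" where
  "cutoff H f = (\<lambda>v. if v \<in> H then f v else 0)"

lemma cutoff_eq_zero_iff: "cutoff H f = 0 \<longleftrightarrow> (\<forall>v\<in>H. f v = 0)"
  by (auto simp: cutoff_def fun_eq_iff)

lemma linear_cutoff_s: "Vector_Spaces.linear sscale sscale (cutoff H)"
  and linear_cutoff_v: "Vector_Spaces.linear vscale vscale (cutoff H)"
  by (auto simp: linear_fun_simps cutoff_def sfun.vector_space_axioms vfun.vector_space_axioms)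

lemma subspace_forms: "sfun.subspace {f. form d f}"
  by (rule sfun_subspaceI) (auto intro: form_zero form_add form_scale)

lemma forms_negative: "d < 0 \<Longrightarrow> {f. form d f} = {0}"
  by (auto simp: zero_fun_def intro: form_zero form_negative_degree)

lemma subspace_cutoff_forms: "sfun.subspace (cutoff H ` {f. form d f})"
  by (rule ss.linear_subspace_image[OF linear_cutoff_s subspace_forms])

context plane_chart
begin

text \<open>Forms of degree \<open>n - 1\<close> in two variables.  Evaluation at \<open>e2\<close> has as kernel the multiples of the equation of the line
through \<open>e2\<close>, which are the forms of one degree less.\<close>

lemma hasdim_plane_forms: "sfun.hasdim (cutoff H ` {f. form (int n - 1) f}) n"
proof (induction n)
  case 0
  have "cutoff H ` {0 :: complex^3 \<Rightarrow> complex} = {0}" by (auto simp: cutoff_def fun_eq_iff)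
  moreover have "{f. form (int 0 - 1) f} = {0}" by (rule forms_negative) simp
  ultimately show ?case using sfun.hasdim_zero by (simp only:)
next
  case (Suc n)
  define ev :: "(complex^3 \<Rightarrow> complex) \<Rightarrow> complex^3 \<Rightarrow> complex" where "ev f = (\<lambda>_. f e2)" for f
  define mul :: "(complex^3 \<Rightarrow> complex) \<Rightarrow> complex^3 \<Rightarrow> complex" where "mul f = (\<lambda>v. om v e2 * f v)" for f
  have lin_ev: "Vector_Spaces.linear sscale sscale ev" and lin_mul: "Vector_Spaces.linear sscale sscale mul"
    by (auto simp: linear_fun_simps ev_def mul_def sfun.vector_space_axioms algebra_simps)
  let ?U = "cutoff H ` {f. form (int n) f}"
  have "sfun.hasdim (mul ` cutoff H ` {f. form (int n - 1) f}) n"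
  proof (rule ss.hasdim_image[OF lin_mul Suc.IH])
    fix u assume "u \<in> cutoff H ` {f. form (int n - 1) f}" "mul u = 0"
    then obtain f where f: "form (int n - 1) f" "u = cutoff H f" "\<And>v. v \<in> H \<Longrightarrow> om v e2 * f v = 0"
      by (auto simp: mul_def fun_eq_iff cutoff_def) (metis mult_eq_0_iff)
    then show "u = 0" using cancel_point[OF f(1) e2_mem e2_nonzero f(3)] by (auto simp: cutoff_eq_zero_iff)
  qed
  also have "mul ` cutoff H ` {f. form (int n - 1) f} = {u \<in> ?U. ev u = 0}"
  proof (intro set_eqI iffI)
    fix u assume "u \<in> mul ` cutoff H ` {f. form (int n - 1) f}"
    then obtain f where f: "form (int n - 1) f" "u = mul (cutoff H f)" by auto
    then have "u = cutoff H (\<lambda>v. om v e2 * f v)" by (auto simp: mul_def cutoff_def)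
    moreover have "form (int n) (\<lambda>v. om v e2 * f v)" by (rule form_mult'[OF form_om_const f(1)]) simp
    moreover have "ev u = 0" using f by (auto simp: ev_def mul_def)
    ultimately show "u \<in> {u \<in> ?U. ev u = 0}" by blast
  next
    fix u assume "u \<in> {u \<in> ?U. ev u = 0}"
    then obtain f where f: "form (int n) f" "u = cutoff H f" "f e2 = 0"
      using e2_mem by (auto simp: ev_def cutoff_def fun_eq_iff)
    obtain q where q: "form (int n - 1) q" "\<And>v. v \<in> H \<Longrightarrow> f v = om v e2 * q v"
      using divide_point[OF f(1,3) e2_mem e2_nonzero] by blast
    have "u = mul (cutoff H q)" using q(2) f(2) by (auto simp: mul_def cutoff_def)
    then show "u \<in> mul ` cutoff H ` {f. form (int n - 1) f}" using q(1) by blast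
  qed
  finally have ker: "sfun.hasdim {u \<in> ?U. ev u = 0} n" .
  have "ev ` ?U = range (\<lambda>c. \<Sum>i<1::nat. sscale (c i) (\<lambda>_. 1))"
  proof (intro set_eqI iffI)
    fix u assume "u \<in> ev ` ?U"
    then obtain f where "u = ev f" by blast
    then have "u = (\<Sum>i<1::nat. sscale (f e2) (\<lambda>_. 1))" by (simp add: ev_def sscale_def)
    then show "u \<in> range (\<lambda>c. \<Sum>i<1::nat. sscale (c i) (\<lambda>_. 1))"
      by (rule range_eqI[where x = "\<lambda>_. f e2"])
  next
    fix u :: "complex^3 \<Rightarrow> complex" assume "u \<in> range (\<lambda>c. \<Sum>i<1::nat. sscale (c i) (\<lambda>_. 1))"
    then obtain c where "u = (\<lambda>_. c)" by (auto simp: sscale_def)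
    moreover have "ev (cutoff H (\<lambda>v. c * (et \<bullet>c v) ^ n)) = (\<lambda>_. c)"
      by (simp add: ev_def cutoff_def e2_mem dual_basis)
    ultimately have "u = ev (cutoff H (\<lambda>v. c * (et \<bullet>c v) ^ n))" by simp
    moreover have "form (int n) (\<lambda>v. c * (et \<bullet>c v) ^ n)"
      using form_scale[OF form_power[OF form_dot, of n et]] by simp
    ultimately show "u \<in> ev ` ?U" by blast
  qed
  then have im: "sfun.hasdim (ev ` ?U) 1"
    unfolding sfun.hasdim_def sfun.coordinates_def by (intro exI[of _ "\<lambda>_ _. 1"]) (auto simp: sscale_def fun_eq_iff)
  show ?case
    using ss.hasdim_rank_nullity[OF lin_ev subspace_cutoff_forms ker im] by simp
qed

text \<open>Restriction to \<open>H\<close> has as kernel the multiples of \<open>al\<close>, so the numbers of the previous lemma add up.\<close>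

lemma hasdim_forms_aux: "\<exists>k. sfun.hasdim {f. form (int n - 1) f} k \<and> 2 * int k = int n * (int n + 1)"
proof (induction n)
  case 0
  have "{f. form (int 0 - 1) f} = {0}" by (rule forms_negative) simp
  then have "sfun.hasdim {f. form (int 0 - 1) f} 0" using sfun.hasdim_zero by (simp only:)
  then show ?case by (intro exI[of _ 0]) simp
next
  case (Suc n)
  then obtain k where k: "sfun.hasdim {f. form (int n - 1) f} k" "2 * int k = int n * (int n + 1)" by blast
  define mul :: "(complex^3 \<Rightarrow> complex) \<Rightarrow> complex^3 \<Rightarrow> complex" where "mul f = (\<lambda>v. (al \<bullet>c v) * f v)" for f
  have lin: "Vector_Spaces.linear sscale sscale mul"
    by (auto simp: linear_fun_simps mul_def sfun.vector_space_axioms algebra_simps)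
  have "sfun.hasdim (mul ` {f. form (int n - 1) f}) k"
  proof (rule ss.hasdim_image[OF lin k(1)])
    fix f assume "f \<in> {f. form (int n - 1) f}" "mul f = 0"
    then show "f = 0" using cancel_plane[of "int n - 1" f] by (auto simp: mul_def fun_eq_iff)
  qed
  also have "mul ` {f. form (int n - 1) f} = {f \<in> {f. form (int n) f}. cutoff H f = 0}"
  proof (intro set_eqI iffI)
    fix u assume "u \<in> mul ` {f. form (int n - 1) f}"
    then obtain f where "form (int n - 1) f" "u = mul f" by blast
    then show "u \<in> {f \<in> {f. form (int n) f}. cutoff H f = 0}"
      by (auto simp: cutoff_eq_zero_iff mul_def mem_H intro!: form_mult'[OF form_dot])
  next
    fix u assume "u \<in> {f \<in> {f. form (int n) f}. cutoff H f = 0}"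
    then obtain q where "form (int n - 1) q" "\<And>v. u v = (al \<bullet>c v) * q v"
      using divide_plane[of "int n" u] by (auto simp: cutoff_eq_zero_iff)
    then show "u \<in> mul ` {f. form (int n - 1) f}" by (auto simp: mul_def fun_eq_iff)
  qed
  finally have "sfun.hasdim {f. form (int n) f} (k + Suc n)"
    using ss.hasdim_rank_nullity[OF linear_cutoff_s subspace_forms _ , of n H k "Suc n"]
      hasdim_plane_forms[of "Suc n"] by simp
  then show ?case using k(2) by (intro exI[of _ "k + Suc n"]) (simp add: algebra_simps)
qed

end

lemma dot_axis: "axis i 1 \<bullet>c v = v $ i"
  by (simp add: dot_def axis_def if_distrib[where f = "\<lambda>x. x * _"] cong: if_cong)

lemma coordinate_chart: "plane_chart {v. axis 1 1 \<bullet>c v = 0} (axis 1 1) (axis 2 1) (axis 3 1) (axis 1 1) (axis 2 1) (axis 3 1)"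
  by unfold_locales (auto simp: dot_axis vec_eq_iff forall_3, simp_all add: axis_def)

lemma hasdim_forms:
  assumes "d \<ge> -1"
  shows "\<exists>k. sfun.hasdim {f. form d f} k \<and> 2 * int k = (d + 1) * (d + 2)"
  using plane_chart.hasdim_forms_aux[OF coordinate_chart, of "nat (d + 1)"] assms by (simp add: algebra_simps)

lemma hasdim_form_triples:
  assumes "\<And>i. sfun.hasdim {f. form (e i) f} (k i)"
  shows "vfun.hasdim {F. \<forall>i. form (e i) (\<lambda>v. F v $ i)} (k 1 + k 2 + k 3)"
proof -
  define pr :: "3 \<Rightarrow> (complex^3 \<Rightarrow> complex^3) \<Rightarrow> complex^3 \<Rightarrow> complex" where "pr i F = (\<lambda>v. F v $ i)" for i F
  define inj :: "3 \<Rightarrow> (complex^3 \<Rightarrow> complex) \<Rightarrow> complex^3 \<Rightarrow> complex^3" where "inj i f = (\<lambda>v. axis i (f v))" for i f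
  have lin: "Vector_Spaces.linear vscale sscale (pr i)" "Vector_Spaces.linear sscale vscale (inj i)" for i
    by (auto simp: linear_fun_simps pr_def inj_def axis_def sfun.vector_space_axioms vfun.vector_space_axioms)
  let ?W = "\<lambda>I. {F. \<forall>i. if i \<in> I then form (e i) (\<lambda>v. F v $ i) else (\<forall>v. F v $ i = 0)}"
  have sub: "vfun.subspace (?W I)" for I
    by (rule vfun_subspaceI) (auto intro: form_zero form_add form_scale split: if_splits)
  have step: "vfun.hasdim (?W (insert i I)) (n + k i)" if "vfun.hasdim (?W I) n" "i \<notin> I" for i I n
  proof (rule vs.hasdim_rank_nullity[OF lin(1)[of i] sub])
    have "F \<in> ?W (insert i I) \<and> pr i F = 0 \<longleftrightarrow> F \<in> ?W I" for F
    proof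
      assume F: "F \<in> ?W (insert i I) \<and> pr i F = 0"
      then have zero: "\<forall>v. F v $ i = 0" by (simp add: pr_def fun_eq_iff)
      have "if j \<in> I then form (e j) (\<lambda>v. F v $ j) else (\<forall>v. F v $ j = 0)" for j
        using conjunct1[OF F, THEN CollectD, rule_format, of j] zero that(2) by (cases "j = i") auto
      then show "F \<in> ?W I" by simp
    next
      assume F: "F \<in> ?W I"
      then have zero: "(\<lambda>v. F v $ i) = (\<lambda>_. 0)"
        using F[THEN CollectD, rule_format, of i] that(2) by auto
      have "if j \<in> insert i I then form (e j) (\<lambda>v. F v $ j) else (\<forall>v. F v $ j = 0)" for j
      proof (cases "j = i")
        case True
        then show ?thesis using zero form_zero[of "e i"] by simp
      next
        case False
        then show ?thesis using F[THEN CollectD, rule_format, of j] by auto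
      qed
      then show "F \<in> ?W (insert i I) \<and> pr i F = 0" using zero by (simp add: pr_def zero_fun_def)
    qed
    then have "{F \<in> ?W (insert i I). pr i F = 0} = ?W I" by blast
    then show "vfun.hasdim {F \<in> ?W (insert i I). pr i F = 0} n" using that(1) by simp
    have "pr i ` ?W (insert i I) = {f. form (e i) f}"
    proof (intro set_eqI iffI)
      fix f assume f: "f \<in> {f. form (e i) f}"
      have "if j \<in> insert i I then form (e j) (\<lambda>v. inj i f v $ j) else (\<forall>v. inj i f v $ j = 0)" for j
        using f by (cases "j = i") (auto simp: inj_def axis_def intro: form_zero)
      then have "inj i f \<in> ?W (insert i I)" by simp
      moreover have "f = pr i (inj i f)" by (simp add: inj_def pr_def axis_def)
      ultimately show "f \<in> pr i ` ?W (insert i I)" by blast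
    qed (auto simp: pr_def)
    then show "sfun.hasdim (pr i ` ?W (insert i I)) (k i)" using assms by simp
  qed
  have "?W {} = {0}" by (auto simp: fun_eq_iff vec_eq_iff)
  then have "vfun.hasdim (?W {}) 0" using vfun.hasdim_zero by simp
  from step[OF step[OF step[OF this, of 1], of 2], of 3]
  have "vfun.hasdim (?W {3, 2, 1}) (k 1 + k 2 + k 3)" by simp
  moreover have "{3, 2, 1} = (UNIV :: 3 set)" using exhaust_3 by auto
  ultimately show ?thesis by simp
qed

lemma hasdim_free:
  assumes A: "central_arrangement A" and basis: "free_basis A a b \<theta> \<phi>" and d: "d \<ge> 0" "d \<ge> a" "d \<ge> b"
  shows "\<exists>k. vfun.hasdim (log_forms A d) k \<and>
    2 * int k = d * (d + 1) + (d - a + 1) * (d - a + 2) + (d - b + 1) * (d - b + 2)"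
proof -
  define e where "e = (\<lambda>i::3. if i = 1 then d - 1 else if i = 2 then d - a else d - b)"
  have "e i \<ge> -1" for i using d by (auto simp: e_def)
  then have "\<forall>i. \<exists>k. sfun.hasdim {f. form (e i) f} k \<and> 2 * int k = (e i + 1) * (e i + 2)"
    using hasdim_forms by blast
  from choice[OF this] obtain k where
    "\<forall>i. sfun.hasdim {f. form (e i) f} (k i) \<and> 2 * int (k i) = (e i + 1) * (e i + 2)" by blast
  then have k: "\<And>i. sfun.hasdim {f. form (e i) f} (k i)" "\<And>i. 2 * int (k i) = (e i + 1) * (e i + 2)"
    by blast+
  have e: "e 1 = d - 1" "e 2 = d - a" "e 3 = d - b" by (simp_all add: e_def)
  define comb :: "(complex^3 \<Rightarrow> complex^3) \<Rightarrow> complex^3 \<Rightarrow> complex^3"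
    where "comb F = (\<lambda>v. (F v $ 1) *s v + (F v $ 2) *s \<theta> v + (F v $ 3) *s \<phi> v)" for F
  let ?T = "{F. \<forall>i. form (e i) (\<lambda>v. F v $ i)}"
  have lin: "Vector_Spaces.linear vscale vscale comb"
    by (auto simp: linear_fun_simps comb_def vfun.vector_space_axioms algebra_simps)
  have "vfun.hasdim (comb ` ?T) (k 1 + k 2 + k 3)"
  proof (rule vv.hasdim_image[OF lin hasdim_form_triples[OF k(1)]])
    fix F assume F: "F \<in> ?T" "comb F = 0"
    have c: "(F v $ 1) *s v + (F v $ 2) *s \<theta> v + (F v $ 3) *s \<phi> v = 0" for v
      using F(2) by (simp add: comb_def fun_eq_iff)
    have f: "form (d - 1) (\<lambda>v. F v $ 1)" "form (d - a) (\<lambda>v. F v $ 2)" "form (d - b) (\<lambda>v. F v $ 3)"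
      using F(1) by (auto simp flip: e)
    show "F = 0"
      using log_basis_indepD[OF basis f c] by (simp add: fun_eq_iff vec_eq_iff forall_3)
  qed
  also have "comb ` ?T = log_forms A d"
  proof (intro set_eqI iffI)
    fix \<psi> assume "\<psi> \<in> comb ` ?T"
    then obtain F where F: "\<And>i. form (e i) (\<lambda>v. F v $ i)" "\<psi> = comb F" by blast
    have \<theta>: "\<theta> \<in> log_forms A a" "\<phi> \<in> log_forms A b" using basis by (auto simp: log_basis_def)
    show "\<psi> \<in> log_forms A d"
      unfolding F(2) comb_def
      by (intro log_forms_add[OF A] log_forms_mult[OF A F(1) log_forms_id]
          log_forms_mult[OF A F(1) \<theta>(1)] log_forms_mult[OF A F(1) \<theta>(2)]) (auto simp: e)
  next
    fix \<psi> assume "\<psi> \<in> log_forms A d"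
    from log_basis_spanD[OF basis this] obtain f g h where
      fgh: "form (d - 1) f" "form (d - a) g" "form (d - b) h"
      "\<And>v. \<psi> v = f v *s v + g v *s \<theta> v + h v *s \<phi> v" by metis
    have "(\<lambda>v. vector [f v, g v, h v]) \<in> ?T" using fgh by (auto simp: forall_3 e vector_3)
    moreover have "\<psi> = comb (\<lambda>v. vector [f v, g v, h v])" using fgh(4) by (auto simp: comb_def vector_3)
    ultimately show "\<psi> \<in> comb ` ?T" by blast
  qed
  finally have "vfun.hasdim (log_forms A d) (k 1 + k 2 + k 3)" .
  then show ?thesis using k(2)[of 1] k(2)[of 2] k(2)[of 3] unfolding e
    by (intro exI[of _ "k 1 + k 2 + k 3"]) (simp add: algebra_simps)
qed

section \<open>Counting incidences\<close>

text \<open>The points of \<open>A\<close> are the lines in which two of its planes meet, seen as points of the projective plane.\<close>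

definition points :: "(complex^3) set set \<Rightarrow> (complex^3) set set" where
  "points A = {H \<inter> K | H K. H \<in> A \<and> K \<in> A \<and> H \<noteq> K}"

definition planes_through :: "(complex^3) set set \<Rightarrow> (complex^3) set \<Rightarrow> nat" where
  "planes_through A X = card {H \<in> A. X \<subseteq> H}"

text \<open>The coefficient of \<open>t\<close> in the characteristic polynomial of \<open>A\<close>.\<close>

definition betti2 :: "(complex^3) set set \<Rightarrow> nat" where
  "betti2 A = (\<Sum>X\<in>points A. planes_through A X - 1)"

lemma meet_line:
  assumes A: "central_arrangement A" and HK: "H \<in> A" "K \<in> A" "H \<noteq> K"
  shows "vec.subspace (H \<inter> K)" "vec.dim (H \<inter> K) = 1"
proof -
  obtain al xi et e0 e1 e2 where "plane_chart H al xi et e0 e1 e2"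
    using plane_chart_exists[OF central_arrangementD[OF A HK(1)]] by blast
  then interpret plane_chart H al xi et e0 e1 e2 .
  obtain x where x: "x \<noteq> 0" "H \<inter> K = range (\<lambda>c. c *s x)"
    using meet_plane[OF central_arrangementD[OF A HK(2)] HK(3)[symmetric] central_arrangementD(2)[OF A HK(1)]]
    by metis
  then have "H \<inter> K = vec.span {x}" by (simp add: vec.span_singleton)
  then show "vec.subspace (H \<inter> K)" "vec.dim (H \<inter> K) = 1" using x(1) by simp_all
qed

lemma line_eqI:
  assumes A: "central_arrangement A" and HK: "H \<in> A" "K \<in> A" "H \<noteq> K"
    and X: "vec.subspace X" "vec.dim X = 1" "X \<subseteq> H" "X \<subseteq> K"
  shows "X = H \<inter> K"
  using vec.subspace_dim_equal[OF X(1) meet_line(1)[OF A HK]] meet_line(2)[OF A HK] X by simp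

lemma pointsE:
  assumes "central_arrangement A" "X \<in> points A"
  shows "vec.subspace X" "vec.dim X = 1"
  using assms meet_line[OF assms(1)] by (auto simp: points_def)

lemma point_eq:
  assumes "central_arrangement A" "X \<in> points A" "H \<in> A" "K \<in> A" "H \<noteq> K" "X \<subseteq> H" "X \<subseteq> K"
  shows "X = H \<inter> K"
  using assms by (intro line_eqI[OF assms(1,3-5)] pointsE[OF assms(1,2)])

lemma finite_central: "central_arrangement A \<Longrightarrow> finite A"
  by (simp add: central_arrangement_def)

lemma central_subset: "central_arrangement A \<Longrightarrow> B \<subseteq> A \<Longrightarrow> central_arrangement B"
  by (auto simp: central_arrangement_def intro: finite_subset)

lemma finite_points: "finite A \<Longrightarrow> finite (points A)"
proof -
  assume "finite A"
  then have "finite ((\<lambda>(H, K). H \<inter> K) ` (A \<times> A))" by simp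
  then show ?thesis by (rule rev_finite_subset) (auto simp: points_def)
qed

lemma points_on_eq:
  assumes "central_arrangement A" "H \<in> A"
  shows "points_on A H = {X \<in> points A. X \<subseteq> H}"
proof (intro set_eqI iffI)
  fix X assume "X \<in> points_on A H"
  then show "X \<in> {X \<in> points A. X \<subseteq> H}" using assms by (auto simp: points_on_def points_def)
next
  fix X assume X: "X \<in> {X \<in> points A. X \<subseteq> H}"
  then obtain K L where KL: "K \<in> A" "L \<in> A" "K \<noteq> L" "X = K \<inter> L" by (auto simp: points_def)
  obtain M where M: "M \<in> A" "M \<noteq> H" "X \<subseteq> M" using KL by (cases "K = H") auto
  then have "X = H \<inter> M" using point_eq[OF assms(1), of X H M] X assms(2) by auto
  then show "X \<in> points_on A H" using M by (auto simp: points_on_def)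
qed

lemma sum_fibre_cards: "finite S \<Longrightarrow> (\<Sum>y\<in>f ` S. card {x \<in> S. f x = y}) = card S"
  using sum.image_gen[of S "\<lambda>_. 1::nat" f] by simp

lemma planes_through_on:
  assumes A: "central_arrangement A" and H: "H \<in> A" and X: "X \<in> points_on A H"
  shows "{K \<in> A. X \<subseteq> K} = insert H {K \<in> A - {H}. H \<inter> K = X}"
    and "planes_through A X = Suc (card {K \<in> A - {H}. H \<inter> K = X})"
proof -
  have X': "X \<in> points A" "X \<subseteq> H" using X points_on_eq[OF A H] by auto
  show eq: "{K \<in> A. X \<subseteq> K} = insert H {K \<in> A - {H}. H \<inter> K = X}"
  proof (intro set_eqI iffI)
    fix K assume "K \<in> {K \<in> A. X \<subseteq> K}"
    then show "K \<in> insert H {K \<in> A - {H}. H \<inter> K = X}"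
      using point_eq[OF A X'(1) H, of K] X'(2) by auto
  next
    fix K assume "K \<in> insert H {K \<in> A - {H}. H \<inter> K = X}"
    then show "K \<in> {K \<in> A. X \<subseteq> K}" using H X'(2) by auto
  qed
  show "planes_through A X = Suc (card {K \<in> A - {H}. H \<inter> K = X})"
    unfolding planes_through_def eq using finite_central[OF A] by simp
qed

lemma planes_through_ge_2:
  assumes A: "central_arrangement A" and X: "X \<in> points A"
  shows "planes_through A X \<ge> 2"
proof -
  obtain H K where HK: "H \<in> A" "K \<in> A" "H \<noteq> K" "X = H \<inter> K" using X by (auto simp: points_def)
  then have "card {H, K} \<le> card {H \<in> A. X \<subseteq> H}"
    using finite_central[OF A] by (intro card_mono) auto
  then show ?thesis using HK by (simp add: planes_through_def)
qed

text \<open>The planes other than \<open>H\<close> are grouped by the point in which they meet \<open>H\<close>.\<close>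

lemma sum_planes_through_on:
  assumes A: "central_arrangement A" and H: "H \<in> A"
  shows "(\<Sum>X\<in>points_on A H. planes_through A X - 1) = card A - 1"
proof -
  have "(\<Sum>X\<in>points_on A H. planes_through A X - 1) = (\<Sum>X\<in>points_on A H. card {K \<in> A - {H}. H \<inter> K = X})"
    by (intro sum.cong refl) (simp add: planes_through_on[OF A H])
  also have "\<dots> = card (A - {H})"
    unfolding points_on_def using finite_central[OF A] by (intro sum_fibre_cards) simp
  finally show ?thesis using H finite_central[OF A] by simp
qed

lemma sum_incidences:
  assumes A: "central_arrangement A"
  shows "(\<Sum>X\<in>points A. planes_through A X * g X) = (\<Sum>H\<in>A. \<Sum>X\<in>points_on A H. g X :: nat)"
proof -
  have "(\<Sum>X\<in>points A. planes_through A X * g X) = (\<Sum>X\<in>points A. \<Sum>H | H \<in> A \<and> X \<subseteq> H. g X)"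
    by (simp add: planes_through_def)
  also have "\<dots> = (\<Sum>H\<in>A. \<Sum>X | X \<in> points A \<and> X \<subseteq> H. g X)"
    using finite_central[OF A] finite_points by (intro sum.swap_restrict) auto
  finally show ?thesis by (simp add: points_on_eq[OF A])
qed

lemma sum_planes_through: "central_arrangement A \<Longrightarrow> (\<Sum>X\<in>points A. planes_through A X) = (\<Sum>H\<in>A. card (points_on A H))"
  using sum_incidences[of A "\<lambda>_. 1"] by simp

lemma sum_planes_through_pairs:
  assumes "central_arrangement A"
  shows "(\<Sum>X\<in>points A. planes_through A X * (planes_through A X - 1)) = card A * (card A - 1)"
  using sum_incidences[OF assms, of "\<lambda>X. planes_through A X - 1"] sum_planes_through_on[OF assms] by simp

lemma planes_through_delete:
  assumes "finite A" "H \<in> A"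
  shows "planes_through A X = planes_through (A - {H}) X + (if X \<subseteq> H then 1 else 0)"
proof (cases "X \<subseteq> H")
  case True
  then have "{K \<in> A. X \<subseteq> K} = insert H {K \<in> A - {H}. X \<subseteq> K}" using assms by auto
  then show ?thesis using assms True by (simp add: planes_through_def)
next
  case False
  then have "{K \<in> A. X \<subseteq> K} = {K \<in> A - {H}. X \<subseteq> K}" by auto
  then show ?thesis using False by (simp add: planes_through_def)
qed

lemma points_of_subarrangement:
  assumes A: "central_arrangement A" and B: "B \<subseteq> A" and X: "X \<in> points A" and m: "planes_through B X \<ge> 2"
  shows "X \<in> points B"
proof -
  have fin: "finite {H \<in> B. X \<subseteq> H}" using finite_subset[OF B finite_central[OF A]] by simp
  have "\<not> card {H \<in> B. X \<subseteq> H} \<le> Suc 0" using m by (simp add: planes_through_def)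
  then obtain H K where HK: "H \<in> B" "X \<subseteq> H" "K \<in> B" "X \<subseteq> K" "H \<noteq> K"
    unfolding card_le_Suc0_iff_eq[OF fin] by blast
  then have "X = H \<inter> K" using point_eq[OF A X, of H K] B by blast
  then show ?thesis using HK by (auto simp: points_def)
qed

text \<open>Each point on \<open>H\<close> loses one plane.  A point on only two planes disappears, but it then contributed one, the same loss.\<close>

lemma betti2_delete:
  assumes A: "central_arrangement A" and H: "H \<in> A"
  shows "betti2 A = betti2 (A - {H}) + card (points_on A H)"
proof -
  let ?B = "A - {H}"
  note fin = finite_central[OF A]
  have B: "central_arrangement ?B" using A by (rule central_subset) auto
  have "planes_through A X - 1 = (planes_through ?B X - 1) + (if X \<subseteq> H then 1 else 0)" if X: "X \<in> points A" for X
    using planes_through_delete[OF fin H, of X] planes_through_ge_2[OF A X] by auto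
  then have "betti2 A = (\<Sum>X\<in>points A. (planes_through ?B X - 1) + (if X \<subseteq> H then 1 else 0))"
    unfolding betti2_def by simp
  also have "\<dots> = (\<Sum>X\<in>points A. planes_through ?B X - 1) + card (points_on A H)"
    using finite_points[OF fin] by (simp add: sum.distrib points_on_eq[OF A H] sum.If_cases Int_def)
  also have "(\<Sum>X\<in>points A. planes_through ?B X - 1) = betti2 ?B"
    unfolding betti2_def
  proof (rule sum.mono_neutral_right[OF finite_points[OF fin]])
    show "points ?B \<subseteq> points A" by (auto simp: points_def)
    show "\<forall>X\<in>points A - points ?B. planes_through ?B X - 1 = 0"
    proof
      fix X assume "X \<in> points A - points ?B"
      then have "planes_through ?B X < 2" using points_of_subarrangement[OF A, of ?B X] by force
      then show "planes_through ?B X - 1 = 0" by simp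
    qed
  qed
  finally show ?thesis .
qed

text \<open>The planes through \<open>X\<close> meet a plane \<open>H\<close> not containing \<open>X\<close> in different points.\<close>

lemma planes_through_le_points_on:
  assumes A: "central_arrangement A" and X: "X \<in> points A" and H: "H \<in> A" "\<not> X \<subseteq> H"
  shows "planes_through A X \<le> card (points_on A H)"
  unfolding planes_through_def
proof (rule card_inj_on_le[of "\<lambda>K. H \<inter> K"])
  show "inj_on (\<lambda>K. H \<inter> K) {K \<in> A. X \<subseteq> K}"
  proof (rule inj_onI, rule ccontr)
    fix K L assume K: "K \<in> {K \<in> A. X \<subseteq> K}" and L: "L \<in> {K \<in> A. X \<subseteq> K}"
      and eq: "H \<inter> K = H \<inter> L" and "K \<noteq> L"
    then have XKL: "X = K \<inter> L" using point_eq[OF A X, of K L] by auto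
    have "H \<noteq> K" using K H(2) by auto
    then have "H \<inter> K = K \<inter> L"
      using line_eqI[OF A, of K L "H \<inter> K"] meet_line[OF A H(1), of K] K L eq \<open>K \<noteq> L\<close> by auto
    then show False using XKL H(2) by auto
  qed
  show "(\<lambda>K. H \<inter> K) ` {K \<in> A. X \<subseteq> K} \<subseteq> points_on A H" using H(2) by (auto simp: points_on_def)
  show "finite (points_on A H)" using finite_central[OF A] by (simp add: points_on_def)
qed

lemma codim2_eq_points:
  assumes A: "central_arrangement A"
  shows "codim2_intersections A = points A"
proof (intro set_eqI iffI)
  fix X assume "X \<in> codim2_intersections A"
  then obtain B where B: "B \<subseteq> A" "X = \<Inter>B" "vec.dim X = 1" by (auto simp: codim2_intersections_def)
  have "\<not> (\<exists>H. B \<subseteq> {H})"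
  proof
    assume "\<exists>H. B \<subseteq> {H}"
    then consider "B = {}" | H where "B = {H}" by blast
    then show False
    proof cases
      case 1
      then have "X = UNIV" using B(2) by simp
      then show False using B(3) vec.dim_UNIV by (simp add: card_cart_basis)
    next
      case 2
      then show False using B central_arrangementD(2)[OF A] by auto
    qed
  qed
  then obtain H K where HK: "H \<in> B" "K \<in> B" "H \<noteq> K" by blast
  have "vec.subspace X" unfolding B(2) using B(1) central_arrangementD(1)[OF A] by (intro vec.subspace_Inter) auto
  then have "X = H \<inter> K" using B HK by (intro line_eqI[OF A]) auto
  then show "X \<in> points A" using HK B(1) by (auto simp: points_def)
next
  fix X assume X: "X \<in> points A"
  then obtain H K where HK: "H \<in> A" "K \<in> A" "H \<noteq> K" "X = H \<inter> K" by (auto simp: points_def)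
  then have "{H, K} \<subseteq> A" "X = \<Inter>{H, K}" "vec.dim X = 1" using pointsE[OF A X] by auto
  then show "X \<in> codim2_intersections A" unfolding codim2_intersections_def by blast
qed

lemma dual_hesse_iff:
  assumes "central_arrangement A"
  shows "dual_hesse A \<longleftrightarrow> card A = 9 \<and> card (points A) = 12 \<and> (\<forall>X\<in>points A. planes_through A X = 3)"
  using assms by (auto simp: dual_hesse_def codim2_eq_points planes_through_def)

text \<open>A plane off \<open>X\<close> has at least as many points as there are planes through \<open>X\<close>, so \<open>m\<^sub>X \<le> a\<close>, and counting the planes
met on one \<open>H\<close> gives \<open>a + b \<le> a * (a - 1)\<close>.  This leaves \<open>a = b = 3\<close>, excluded by counting, and \<open>a = 4\<close>, \<open>b \<le> 8\<close>.  In the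
latter case let \<open>P\<close> be the number of points and \<open>S = betti2 A\<close>.  The incidences give \<open>S + P \<le> 4 * card A\<close>, and
\<open>(m\<^sub>X - 3) * (m\<^sub>X - 4) \<ge> 0\<close> sums to \<open>card A * (card A - 1) - 6 * S + 6 * P \<ge> 0\<close>; together they amount to
\<open>b\<^sup>2 - 27 * b + 92 \<ge> 0\<close>, which among \<open>4, \<dots>, 8\<close> holds only for \<open>b = 4\<close>, with equality throughout.\<close>

theorem few_points_dual_hesse:
  fixes a b :: int
  assumes A: "central_arrangement A" and n: "card A \<ge> 2"
    and card: "int (card A) = 1 + a + b" and betti2: "int (betti2 A) = a + b + a * b"
    and few: "\<And>H. H \<in> A \<Longrightarrow> int (card (points_on A H)) \<le> a"
    and ab: "a \<le> b" "a \<le> 4"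
  shows "dual_hesse A"
proof -
  note fin = finite_central[OF A]
  note finP = finite_points[OF fin]
  define S where "S = (\<Sum>X\<in>points A. int (planes_through A X) - 1)"
  define P where "P = int (card (points A))"
  have m2: "planes_through A X \<ge> 2" if "X \<in> points A" for X using planes_through_ge_2[OF A that] .
  have S: "S = a + b + a * b"
  proof -
    have "S = int (betti2 A)" unfolding S_def betti2_def of_nat_sum
      using m2 by (intro sum.cong refl) (auto simp: of_nat_diff dest: m2)
    then show ?thesis using betti2 by simp
  qed
  have SP: "S + P \<le> a * (1 + a + b)"
  proof -
    have "S + P = (\<Sum>X\<in>points A. int (planes_through A X))" by (simp add: S_def P_def sum_subtractf)
    also have "\<dots> = (\<Sum>H\<in>A. int (card (points_on A H)))"
      using sum_planes_through[OF A] by (metis of_nat_sum)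
    also have "\<dots> \<le> (\<Sum>H\<in>A. a)" using few by (rule sum_mono)
    finally show ?thesis using card by (simp add: mult.commute)
  qed
  have pairs: "(\<Sum>X\<in>points A. int (planes_through A X) * (int (planes_through A X) - 1)) = (1 + a + b) * (a + b)"
  proof -
    have "(\<Sum>X\<in>points A. int (planes_through A X) * (int (planes_through A X) - 1)) = int (\<Sum>X\<in>points A. planes_through A X * (planes_through A X - 1))"
      unfolding of_nat_sum using m2 by (intro sum.cong refl) (auto simp: of_nat_diff dest: m2)
    also have "\<dots> = int (card A) * (int (card A) - 1)"
      unfolding sum_planes_through_pairs[OF A] using n by (simp add: of_nat_diff)
    finally show ?thesis using card by simp
  qed
  obtain H where H: "H \<in> A" using n by fastforce
  obtain K where K: "K \<in> A" "K \<noteq> H" using n H fin by (metis card_le_Suc0_iff_eq not_less_eq_eq numeral_2_eq_2)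
  have "points_on A H \<noteq> {}" using K by (auto simp: points_on_def)
  then have "card (points_on A H) > 0" using fin by (simp add: points_on_def card_gt_0_iff)
  then have a1: "a \<ge> 1" using few[OF H] by linarith
  \<comment> \<open>A point on all planes would give \<open>betti2 A = card A - 1\<close>, that is \<open>a * b = 0\<close>.\<close>
  have not_all: "\<exists>H\<in>A. \<not> X \<subseteq> H" if X: "X \<in> points A" for X
  proof (rule ccontr)
    assume "\<not> ?thesis"
    then have all: "\<And>H. H \<in> A \<Longrightarrow> X \<subseteq> H" by blast
    have "points A = {X}"
    proof (intro set_eqI iffI)
      fix Y assume "Y \<in> points A"
      then obtain H K where "H \<in> A" "K \<in> A" "H \<noteq> K" "Y = H \<inter> K" by (auto simp: points_def)
      then show "Y \<in> {X}" using point_eq[OF A X, of H K] all by auto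
    qed (use X in simp)
    moreover have "planes_through A X = card A" unfolding planes_through_def using all by (intro arg_cong[of _ _ card]) auto
    ultimately have "S = a + b" using card by (simp add: S_def)
    then show False using S a1 ab(1) by auto
  qed
  have m_le: "int (planes_through A X) \<le> a" if X: "X \<in> points A" for X
    using not_all[OF X] planes_through_le_points_on[OF A X] few by fastforce
  have deg: "a + b \<le> a * (a - 1)"
  proof -
    have "a + b = int (\<Sum>X\<in>points_on A H. planes_through A X - 1)"
      using sum_planes_through_on[OF A H] card n by (simp add: of_nat_diff)
    also have "\<dots> = (\<Sum>X\<in>points_on A H. int (planes_through A X - 1))" by simp
    also have "\<dots> \<le> (\<Sum>X\<in>points_on A H. a - 1)"
      using m_le m2 points_on_eq[OF A H] by (intro sum_mono) (fastforce simp: of_nat_diff)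
    also have "\<dots> = int (card (points_on A H)) * (a - 1)" by simp
    also have "\<dots> \<le> a * (a - 1)" using few[OF H] a1 by (intro mult_right_mono) auto
    finally show ?thesis .
  qed
  \<comment> \<open>\<open>(k - 2) (k - 3) \<ge> 0\<close> for the integers \<open>k = planes_through A X - 1\<close>\<close>
  have pos: "(int (planes_through A X) - 3) * (int (planes_through A X) - 4) \<ge> 0" for X
    by (cases "int (planes_through A X) \<le> 3") (auto intro: mult_nonneg_nonneg mult_nonpos_nonpos)
  have quad: "(\<Sum>X\<in>points A. (int (planes_through A X) - 3) * (int (planes_through A X) - 4)) = (1 + a + b) * (a + b) - 6 * S + 6 * P"
  proof -
    have "(\<Sum>X\<in>points A. (int (planes_through A X) - 3) * (int (planes_through A X) - 4)) =
        (\<Sum>X\<in>points A. int (planes_through A X) * (int (planes_through A X) - 1) - 6 * (int (planes_through A X) - 1) + 6)"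
      by (intro sum.cong refl) (simp add: algebra_simps)
    also have "\<dots> = (1 + a + b) * (a + b) - 6 * S + 6 * P"
      by (simp add: sum.distrib sum_subtractf pairs S_def P_def sum_distrib_left[symmetric])
    finally show ?thesis .
  qed
  have quad_nonneg: "(1 + a + b) * (a + b) - 6 * S + 6 * P \<ge> 0"
    unfolding quad[symmetric] using pos by (intro sum_nonneg)
  have "a = 1 \<or> a = 2 \<or> a = 3 \<or> a = 4" using a1 ab(2) by linarith
  then have a4: "a = 4"
  proof (elim disjE)
    assume a: "a = 3"
    then have "b = 3" using deg ab(1) by simp
    then have "S = 15" "P \<le> 6" using S SP a by auto
    moreover have "S \<le> (\<Sum>X\<in>points A. 2)" unfolding S_def using m_le a by (intro sum_mono) force
    then have "S \<le> 2 * P" by (simp add: P_def)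
    ultimately show ?thesis by simp
  qed (use deg ab(1) in auto)
  have "b \<le> 8" using deg a4 by simp
  then have "b \<in> {4, 5, 6, 7, 8}" using ab a4 by auto
  then have b4: "b = 4" using S SP quad_nonneg a4 by auto
  then have S24: "S = 24" and P12: "P = 12" using S SP quad_nonneg a4 by auto
  have z: "(\<Sum>X\<in>points A. (int (planes_through A X) - 3) * (int (planes_through A X) - 4)) = 0"
    unfolding quad using a4 b4 S24 P12 by simp
  have m34: "planes_through A X = 3 \<or> planes_through A X = 4" if "X \<in> points A" for X
    using z that pos by (subst (asm) sum_nonneg_eq_0_iff[OF finP]) auto
  have "(\<Sum>X\<in>points A. int (planes_through A X) - 3) = S - 2 * P"
    by (simp add: S_def P_def sum_subtractf)
  then have "(\<Sum>X\<in>points A. int (planes_through A X) - 3) = 0" using S24 P12 by simp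
  then have "planes_through A X = 3" if "X \<in> points A" for X
    using that m34 by (subst (asm) sum_nonneg_eq_0_iff[OF finP]) force+
  then show ?thesis unfolding dual_hesse_iff[OF A] using card a4 b4 P12 by (auto simp: P_def)
qed

section \<open>The Hilbert polynomial of the logarithmic forms\<close>

context plane_chart
begin

text \<open>In two variables \<open>G\<close> and the \<open>n\<close>-th power of a linear form not dividing it generate all forms of large degree: each
step changes \<open>c\<close> by a form that makes the remainder \<open>s\<close> vanish at \<open>z\<close>, so that one more linear factor splits off.\<close>

lemma coprime_split:
  assumes z: "z \<in> H" "z \<noteq> 0" and G: "form M G" "G z \<noteq> 0" and h: "form D h" "D \<ge> M + int n"
  shows "\<exists>c s. form (D - M) c \<and> form (D - int n) s \<and> (\<forall>v\<in>H. h v = c v * G v + om v z ^ n * s v)"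
  using h(2)
proof (induction n)
  case 0
  then show ?case using h(1) by (intro exI[of _ "\<lambda>_. 0"] exI[of _ h]) (auto intro: form_zero)
next
  case (Suc n)
  then obtain c s where c: "form (D - M) c" and s: "form (D - int n) s"
    and eq: "\<And>v. v \<in> H \<Longrightarrow> h v = c v * G v + om v z ^ n * s v" by auto
  obtain e where e: "e \<in> H" "om e z = 1" using om_unit[OF z] by blast
  define k where "k = nat (D - int n - M)"
  define t where "t v = (s z / G z) * (- om v e) ^ k" for v
  have "form (int k) t"
  proof -
    have "form 1 (\<lambda>v. - om v e)" using form_scale[OF form_om_const, of "-1" e] by simp
    from form_power[OF this, of k] have "form (int k) (\<lambda>v. (- om v e) ^ k)" by simp
    then show ?thesis unfolding t_def by (rule form_scale)
  qed
  then have t: "form (D - int n - M) t" using Suc.prems by (simp add: k_def)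
  have "om z e = - 1" using e(2) by (simp add: om_def algebra_simps)
  then have tz: "t z * G z = s z" using G(2) by (simp add: t_def)
  have "form (D - int n) (\<lambda>v. s v - t v * G v)" by (intro form_diff s form_mult'[OF t G(1)]) simp
  then obtain s' where s': "form (D - int n - 1) s'" "\<And>v. v \<in> H \<Longrightarrow> s v - t v * G v = om v z * s' v"
    using divide_point[of "D - int n" "\<lambda>v. s v - t v * G v" z] z tz by auto
  show ?case
  proof (intro exI conjI ballI)
    show "form (D - M) (\<lambda>v. c v + om v z ^ n * t v)"
      by (intro form_add c form_mult'[OF form_power[OF form_om_const] t]) simp
    show "form (D - int (Suc n)) s'" using s'(1) by (simp add: algebra_simps)
    fix v assume v: "v \<in> H"
    have "s v = t v * G v + om v z * s' v" using s'(2)[OF v] by (simp add: algebra_simps)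
    then show "h v = (c v + om v z ^ n * t v) * G v + om v z ^ Suc n * s' v"
      using eq[OF v] by (simp add: algebra_simps)
  qed
qed

text \<open>Here \<open>g y\<close> is the product of the equations of the planes meeting \<open>H\<close> in the point \<open>y\<close>, a power of the equation of \<open>y\<close> up to
a constant.  The summands on the right are of the kind that \<open>om_surjective_large_degree\<close> realises by a logarithmic field.
The induction adds a point \<open>z\<close>: after dividing \<open>h\<close> by its equation, \<open>coprime_split\<close> separates the summand of \<open>z\<close>
from a multiple of \<open>g z\<close>, to whose cofactor the induction hypothesis applies.\<close>

lemma vanishing_ideal_large_degree:
  assumes "finite R" "R \<noteq> {}"
    and "\<And>x. x \<in> R \<Longrightarrow> x \<in> H" "0 \<notin> R" "\<And>x y. x \<in> R \<Longrightarrow> y \<in> R \<Longrightarrow> x \<noteq> y \<Longrightarrow> om x y \<noteq> 0"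
    and "\<And>x. x \<in> R \<Longrightarrow> form (int (e x)) (g x)" "\<And>x. x \<in> R \<Longrightarrow> e x \<ge> 1" "\<And>x. x \<in> R \<Longrightarrow> k x \<noteq> 0"
    and "\<And>x v. x \<in> R \<Longrightarrow> v \<in> H \<Longrightarrow> g x v = k x * om v x ^ e x"
  shows "\<exists>N. \<forall>D\<ge>N. \<forall>h. form D h \<longrightarrow> (\<forall>x\<in>R. h x = 0) \<longrightarrow>
    (\<exists>c. (\<forall>x\<in>R. form (D - 1 - (\<Sum>y\<in>R - {x}. int (e y))) (c x)) \<and>
      (\<forall>v\<in>H. h v = (\<Sum>x\<in>R. c x v * (\<Prod>y\<in>R - {x}. g y v) * om v x)))"
  using assms
proof (induction R rule: finite_ne_induct)
  case (singleton z)
  show ?case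
  proof (intro exI[of _ "0::int"] allI impI)
    fix D h assume D: "D \<ge> 0" and h: "form D h" "\<forall>x\<in>{z}. h x = 0"
    obtain q where "form (D - 1) q" "\<forall>v\<in>H. h v = om v z * q v"
      using divide_point[OF h(1), of z] h(2) singleton.prems by auto
    then show "\<exists>c. (\<forall>x\<in>{z}. form (D - 1 - (\<Sum>y\<in>{z} - {x}. int (e y))) (c x)) \<and>
      (\<forall>v\<in>H. h v = (\<Sum>x\<in>{z}. c x v * (\<Prod>y\<in>{z} - {x}. g y v) * om v x))"
      by (intro exI[of _ "\<lambda>_. q"]) simp
  qed
next
  case (insert z R)
  have zR: "z \<notin> R" and finR: "finite R" by fact+
  have z: "z \<in> H" "z \<noteq> 0" using insert.prems by auto
  have "\<exists>N. \<forall>D\<ge>N. \<forall>h. form D h \<longrightarrow> (\<forall>x\<in>R. h x = 0) \<longrightarrow>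
    (\<exists>c. (\<forall>x\<in>R. form (D - 1 - (\<Sum>y\<in>R - {x}. int (e y))) (c x)) \<and>
      (\<forall>v\<in>H. h v = (\<Sum>x\<in>R. c x v * (\<Prod>y\<in>R - {x}. g y v) * om v x)))"
    by (rule insert.IH) (use insert.prems in blast)+
  then obtain N where N: "\<And>D h. D \<ge> N \<Longrightarrow> form D h \<Longrightarrow> \<forall>x\<in>R. h x = 0 \<Longrightarrow>
    \<exists>c. (\<forall>x\<in>R. form (D - 1 - (\<Sum>y\<in>R - {x}. int (e y))) (c x)) \<and>
      (\<forall>v\<in>H. h v = (\<Sum>x\<in>R. c x v * (\<Prod>y\<in>R - {x}. g y v) * om v x))"
    by blast
  define G where "G v = (\<Prod>y\<in>R. g y v)" for v
  define M where "M = (\<Sum>y\<in>R. int (e y))"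
  have G: "form M G" unfolding G_def M_def using insert.prems(4) finR by (intro form_prod) auto
  have Gz: "G z \<noteq> 0"
  proof
    assume "G z = 0"
    then obtain y where y: "y \<in> R" "g y z = 0" using finR by (auto simp: G_def)
    then have "om z y \<noteq> 0" using insert.prems(3)[of z y] zR by auto
    then show False using y insert.prems(6)[of y] insert.prems(7)[of y z] z by simp
  qed
  have ez: "e z \<ge> 1" and kz: "k z \<noteq> 0" using insert.prems by auto
  show ?case
  proof (intro exI[of _ "max (N + int (e z)) (M + int (e z))"] allI impI)
    fix D h assume D: "D \<ge> max (N + int (e z)) (M + int (e z))"
      and h: "form D h" "\<forall>x\<in>insert z R. h x = 0"
    obtain h1 where h1: "form (D - 1) h1" "\<And>v. v \<in> H \<Longrightarrow> h v = om v z * h1 v"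
      using divide_point[OF h(1), of z] h(2) z by auto
    have "D - 1 \<ge> M + int (e z - 1)" using D ez by simp
    from coprime_split[OF z G Gz h1(1) this] obtain cz s where
      cz: "form (D - 1 - M) cz" and s: "form (D - 1 - int (e z - 1)) s"
      and h1_eq: "\<And>v. v \<in> H \<Longrightarrow> h1 v = cz v * G v + om v z ^ (e z - 1) * s v" by blast
    define s' where "s' v = (1 / k z) * s v" for v
    have s': "form (D - int (e z)) s'"
      unfolding s'_def using form_scale[OF s, of "1 / k z"] ez by (simp add: of_nat_diff)
    have h_eq: "h v = cz v * G v * om v z + g z v * s' v" if v: "v \<in> H" for v
    proof -
      have "g z v = k z * om v z ^ e z" using insert.prems(7)[of z v] v by simp
      also have "om v z ^ e z = om v z * om v z ^ (e z - 1)" using ez by (simp add: power_eq_if)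
      finally have "g z v * s' v = om v z * om v z ^ (e z - 1) * s v" using kz by (simp add: s'_def)
      then show ?thesis using h1(2)[OF v] h1_eq[OF v] by (simp add: algebra_simps)
    qed
    have "s' x = 0" if x: "x \<in> R" for x
    proof -
      have xH: "x \<in> H" using insert.prems(1) x by simp
      have "om x z \<noteq> 0" using insert.prems(3)[of x z] x zR by auto
      then have gz: "g z x \<noteq> 0" using insert.prems(7)[of z x] xH kz by simp
      have "g x x = 0" using insert.prems(5)[of x] insert.prems(7)[of x x] x xH by simp
      then have "G x = 0" unfolding G_def using x finR by auto
      then show ?thesis using h_eq[OF xH] h(2) x gz by auto
    qed
    then obtain c where c: "\<And>x. x \<in> R \<Longrightarrow> form (D - int (e z) - 1 - (\<Sum>y\<in>R - {x}. int (e y))) (c x)"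
      and s'_eq: "\<And>v. v \<in> H \<Longrightarrow> s' v = (\<Sum>x\<in>R. c x v * (\<Prod>y\<in>R - {x}. g y v) * om v x)"
      using N[OF _ s'] D by auto
    have minus: "insert z R - {x} = insert z (R - {x})" if "x \<in> R" for x using that zR by auto
    have minus_z: "insert z R - {z} = R" using zR by auto
    define c' where "c' x = (if x = z then cz else c x)" for x
    show "\<exists>c. (\<forall>x\<in>insert z R. form (D - 1 - (\<Sum>y\<in>insert z R - {x}. int (e y))) (c x)) \<and>
      (\<forall>v\<in>H. h v = (\<Sum>x\<in>insert z R. c x v * (\<Prod>y\<in>insert z R - {x}. g y v) * om v x))"
    proof (intro exI[of _ c'] conjI ballI)
      fix x assume "x \<in> insert z R"
      then consider "x = z" | "x \<in> R" "x \<noteq> z" using zR by auto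
      then show "form (D - 1 - (\<Sum>y\<in>insert z R - {x}. int (e y))) (c' x)"
      proof cases
        case 1
        then show ?thesis using cz by (simp add: c'_def minus_z M_def)
      next
        case 2
        have "(\<Sum>y\<in>insert z R - {x}. int (e y)) = int (e z) + (\<Sum>y\<in>R - {x}. int (e y))"
          unfolding minus[OF 2(1)] using zR finR by simp
        then have "D - 1 - (\<Sum>y\<in>insert z R - {x}. int (e y)) = D - int (e z) - 1 - (\<Sum>y\<in>R - {x}. int (e y))"
          by simp
        then show ?thesis using c[OF 2(1)] 2(2) by (simp only: c'_def if_False)
      qed
    next
      fix v assume v: "v \<in> H"
      have "(\<Sum>x\<in>R. c' x v * (\<Prod>y\<in>insert z R - {x}. g y v) * om v x)
          = (\<Sum>x\<in>R. g z v * (c x v * (\<Prod>y\<in>R - {x}. g y v) * om v x))"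
      proof (rule sum.cong[OF refl])
        fix x assume x: "x \<in> R"
        have "(\<Prod>y\<in>insert z R - {x}. g y v) = g z v * (\<Prod>y\<in>R - {x}. g y v)"
          unfolding minus[OF x] using zR finR by simp
        moreover have "c' x = c x" using x zR by (auto simp: c'_def)
        ultimately show "c' x v * (\<Prod>y\<in>insert z R - {x}. g y v) * om v x
            = g z v * (c x v * (\<Prod>y\<in>R - {x}. g y v) * om v x)" by (simp add: mult_ac)
      qed
      also have "\<dots> = g z v * s' v" by (simp add: s'_eq[OF v] sum_distrib_left)
      finally show "h v = (\<Sum>x\<in>insert z R. c' x v * (\<Prod>y\<in>insert z R - {x}. g y v) * om v x)"
        using h_eq[OF v] zR finR by (simp add: minus_z c'_def G_def)
    qed
  qed
qed

text \<open>For a point \<open>x\<close> on \<open>H\<close> the constant field \<open>x\<close> is tangent to all planes through \<open>x\<close>.  Multiplied by the equations of the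
other planes it is logarithmic, and \<open>om\<close> takes it to the equation of \<open>x\<close> times these equations.  By the
previous lemma such products generate, in large degree, all forms on \<open>H\<close> that vanish at the points.\<close>

lemma om_surjective_large_degree:
  assumes A: "central_arrangement A" and HA: "H \<in> A"
    and reps: "point_reps A rep"
  shows "\<exists>N. \<forall>D\<ge>N. \<forall>h. form D h \<longrightarrow> (\<forall>X\<in>points_on A H. h (rep X) = 0) \<longrightarrow>
    (\<exists>\<theta>\<in>log_forms A (D - 1). \<forall>v\<in>H. om v (\<theta> v) = h v)"
proof (cases "points_on A H = {}")
  case True
  then have A_eq: "A = {H}" using HA by (auto simp: points_on_def)
  show ?thesis
  proof (intro exI[of _ "2::int"] allI impI)
    fix D h assume D: "D \<ge> 2" and h: "form D h"
    have "om e2 e1 \<noteq> 0" by (simp add: om_def dual_basis)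
    from coprime_split[OF e2_mem e2_nonzero form_om_const this h, of 1] D obtain c s where
      c: "form (D - 1) c" "form (D - 1) s" "\<And>v. v \<in> H \<Longrightarrow> h v = c v * om v e1 + om v e2 * s v" by auto
    have "vform (D - 1) (\<lambda>v. c v *s e1 + s v *s e2)"
      by (intro vform_add vform_mult[OF c(1) vform_const] vform_mult[OF c(2) vform_const]) simp_all
    moreover have "c v *s e1 + s v *s e2 \<in> H" for v
      using e1_mem e2_mem subspace_H by (intro vec.subspace_add vec.subspace_scale)
    ultimately have "(\<lambda>v. c v *s e1 + s v *s e2) \<in> log_forms A (D - 1)"
      by (simp add: A_eq log_forms_def)
    moreover have "\<forall>v\<in>H. om v (c v *s e1 + s v *s e2) = h v" by (simp add: om_linear_right c(3))
    ultimately show "\<exists>\<theta>\<in>log_forms A (D - 1). \<forall>v\<in>H. om v (\<theta> v) = h v"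
      by - (rule bexI[of _ "\<lambda>v. c v *s e1 + s v *s e2"])
  qed
next
  case False
  note fin = finite_central[OF A]
  note rep = point_repsD[OF reps]
  have finP: "finite (points_on A H)" using fin by (simp add: points_on_def)
  let ?R = "rep ` points_on A H"
  \<comment> \<open>the planes other than \<open>H\<close> through the point represented by \<open>x\<close>\<close>
  define fib where "fib x = {K \<in> A - {H}. H \<inter> K = range (\<lambda>c. c *s x)}" for x
  have "\<exists>b k. K = {v. b \<bullet>c v = 0} \<and> k \<noteq> 0 \<and> (\<forall>v\<in>H. b \<bullet>c v = k * om v x)" if K: "K \<in> fib x" for K x
    using meet_plane_rep[of K x] K central_arrangementD[OF A] HA by (auto simp: fib_def)
  then obtain b k where bk: "\<And>K x. K \<in> fib x \<Longrightarrow> K = {v. b K x \<bullet>c v = 0} \<and> k K x \<noteq> 0 \<and> (\<forall>v\<in>H. b K x \<bullet>c v = k K x * om v x)"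
    by metis
  have fin_fib: "finite (fib x)" for x using fin by (simp add: fib_def)
  define g where "g x v = (\<Prod>K\<in>fib x. b K x \<bullet>c v)" for x v
  have g: "form (int (card (fib x))) (g x)" for x
    unfolding g_def using fin_fib by (intro form_prod_linear form_dot)
  have g_eq: "g x v = (\<Prod>K\<in>fib x. k K x) * om v x ^ card (fib x)" if "v \<in> H" for x v
  proof -
    have "g x v = (\<Prod>K\<in>fib x. k K x * om v x)" unfolding g_def using bk that by (intro prod.cong) auto
    then show ?thesis by (simp add: prod.distrib)
  qed
  have "\<exists>N. \<forall>D\<ge>N. \<forall>h. form D h \<longrightarrow> (\<forall>x\<in>?R. h x = 0) \<longrightarrow>
    (\<exists>c. (\<forall>x\<in>?R. form (D - 1 - (\<Sum>y\<in>?R - {x}. int (card (fib y)))) (c x)) \<and>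
      (\<forall>v\<in>H. h v = (\<Sum>x\<in>?R. c x v * (\<Prod>y\<in>?R - {x}. g y v) * om v x)))"
  proof (rule vanishing_ideal_large_degree[where k = "\<lambda>x. \<Prod>K\<in>fib x. k K x"])
    show "finite ?R" "?R \<noteq> {}" using finP False by auto
    show "x \<in> H" if "x \<in> ?R" for x using that rep(1) by auto
    show "0 \<notin> ?R" using rep(1) by fastforce
    show "om x y \<noteq> 0" if "x \<in> ?R" "y \<in> ?R" "x \<noteq> y" for x y using that rep(2) by auto
    show "form (int (card (fib x))) (g x)" for x by (rule g)
    show "card (fib x) \<ge> 1" if x: "x \<in> ?R" for x
    proof -
      obtain X where X: "X \<in> points_on A H" "x = rep X" using x by auto
      obtain K where K: "K \<in> A" "K \<noteq> H" "X = H \<inter> K" using X(1) by (auto simp: points_on_def)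
      then have "K \<in> fib x" using rep(1)[OF X(1)] X(2) by (simp add: fib_def)
      then have "card (fib x) > 0" using fin_fib by (auto simp: card_gt_0_iff)
      then show ?thesis by simp
    qed
    show "(\<Prod>K\<in>fib x. k K x) \<noteq> 0" for x using bk fin_fib by (auto simp: prod_zero_iff)
    show "g x v = (\<Prod>K\<in>fib x. k K x) * om v x ^ card (fib x)" if "v \<in> H" for x v
      by (rule g_eq[OF that])
  qed
  then obtain N where N: "\<And>D h. D \<ge> N \<Longrightarrow> form D h \<Longrightarrow> \<forall>x\<in>?R. h x = 0 \<Longrightarrow>
    \<exists>c. (\<forall>x\<in>?R. form (D - 1 - (\<Sum>y\<in>?R - {x}. int (card (fib y)))) (c x)) \<and>
      (\<forall>v\<in>H. h v = (\<Sum>x\<in>?R. c x v * (\<Prod>y\<in>?R - {x}. g y v) * om v x))" by blast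
  show ?thesis
  proof (intro exI[of _ N] allI impI)
    fix D h assume D: "D \<ge> N" and h: "form D h" "\<forall>X\<in>points_on A H. h (rep X) = 0"
    then obtain c where c: "\<And>x. x \<in> ?R \<Longrightarrow> form (D - 1 - (\<Sum>y\<in>?R - {x}. int (card (fib y)))) (c x)"
      and h_eq: "\<And>v. v \<in> H \<Longrightarrow> h v = (\<Sum>x\<in>?R. c x v * (\<Prod>y\<in>?R - {x}. g y v) * om v x)"
      using N[OF D h(1)] by auto
    define f where "f x v = c x v * (\<Prod>y\<in>?R - {x}. g y v)" for x v
    have f: "form (D - 1) (f x)" if x: "x \<in> ?R" for x
    proof -
      have "form (\<Sum>y\<in>?R - {x}. int (card (fib y))) (\<lambda>v. \<Prod>y\<in>?R - {x}. g y v)"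
        using finP by (intro form_prod g) auto
      from form_mult'[OF c[OF x] this] show ?thesis unfolding f_def by simp
    qed
    let ?\<theta> = "\<lambda>v. \<Sum>x\<in>?R. f x v *s x"
    have "?\<theta> \<in> log_forms A (D - 1)"
      unfolding log_forms_def
    proof (intro CollectI conjI ballI)
      show "vform (D - 1) ?\<theta>"
        unfolding vform_def
      proof
        fix i
        have "form (D - 1) (\<lambda>v. \<Sum>x\<in>?R. x $ i * f x v)" by (intro form_sum form_scale f)
        then show "form (D - 1) (\<lambda>v. ?\<theta> v $ i)" by (simp add: sum_component mult.commute)
      qed
      fix K v assume K: "K \<in> A" "v \<in> K"
      note sub = central_arrangementD(1)[OF A K(1)]
      show "?\<theta> v \<in> K"
      proof (rule vec.subspace_sum[OF sub])
        fix x assume x: "x \<in> ?R"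
        then obtain X where X: "X \<in> points_on A H" "x = rep X" by auto
        have X_eq: "X = range (\<lambda>c. c *s x)" "x \<in> H" using rep(1)[OF X(1)] X(2) by auto
        show "f x v *s x \<in> K"
        proof (cases "K = H")
          case True
          then show ?thesis using X_eq(2) sub by (auto intro: vec.subspace_scale)
        next
          case KH: False
          then have Y: "H \<inter> K \<in> points_on A H" using K by (auto simp: points_on_def)
          define y where "y = rep (H \<inter> K)"
          have y: "H \<inter> K = range (\<lambda>c. c *s y)" "y \<in> ?R" using rep(1)[OF Y] Y by (auto simp: y_def)
          show ?thesis
          proof (cases "y = x")
            case True
            have "1 *s x \<in> H \<inter> K" unfolding y(1) True by blast
            then show ?thesis using sub by (auto intro: vec.subspace_scale)
          next
            case False
            have "K \<in> fib y" using K KH y by (simp add: fib_def)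
            then have "g y v = 0" unfolding g_def using bk[of K y] K(2) fin_fib by auto
            then have "f x v = 0" unfolding f_def using y(2) False finP by (auto simp: prod_zero_iff)
            then show ?thesis using sub by (simp add: vec.subspace_0)
          qed
        qed
      qed
    qed
    moreover have "\<forall>v\<in>H. om v (?\<theta> v) = h v"
    proof
      fix v assume v: "v \<in> H"
      have "om v (\<Sum>x\<in>R. f x v *s x) = (\<Sum>x\<in>R. f x v * om v x)" if "finite R" for R
        using that by (induction R) (auto simp: om_linear_right, simp add: om_def)
      from this[of ?R] show "om v (?\<theta> v) = h v" using h_eq[OF v] finP by (simp add: f_def)
    qed
    ultimately show "\<exists>\<theta>\<in>log_forms A (D - 1). \<forall>v\<in>H. om v (\<theta> v) = h v"
      by - (rule bexI[of _ ?\<theta>])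
  qed
qed

end

lemma subspace_log_forms: "central_arrangement A \<Longrightarrow> vfun.subspace (log_forms A d)"
  by (rule vfun_subspaceI)
    (auto simp: log_forms_def vec.subspace_0 central_arrangementD intro: vform_zero log_forms_add
      intro!: vform_add vform_mult[OF form_const] vec.subspace_add vec.subspace_scale dest: central_arrangementD)

context plane_chart
begin

lemma hasdim_vanishing:
  assumes R: "finite R" "\<And>x. x \<in> R \<Longrightarrow> x \<in> H" "\<And>x y. x \<in> R \<Longrightarrow> y \<in> R \<Longrightarrow> x \<noteq> y \<Longrightarrow> om x y \<noteq> 0" "0 \<notin> R"
    and D: "D \<ge> int (card R)"
  shows "sfun.hasdim (cutoff H ` {h. form D h \<and> (\<forall>x\<in>R. h x = 0)}) (nat (D + 1 - int (card R)))"
proof -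
  define n where "n = nat (D + 1 - int (card R))"
  have n: "int n - 1 = D - int (card R)" using D by (simp add: n_def)
  define mul :: "(complex^3 \<Rightarrow> complex) \<Rightarrow> complex^3 \<Rightarrow> complex" where "mul f = (\<lambda>v. (\<Prod>x\<in>R. om v x) * f v)" for f
  have lin: "Vector_Spaces.linear sscale sscale mul"
    by (auto simp: linear_fun_simps mul_def sfun.vector_space_axioms algebra_simps)
  have "sfun.hasdim (mul ` cutoff H ` {f. form (int n - 1) f}) n"
  proof (rule ss.hasdim_image[OF lin hasdim_plane_forms])
    fix u assume "u \<in> cutoff H ` {f. form (int n - 1) f}" "mul u = 0"
    then obtain f where f: "form (int n - 1) f" "u = cutoff H f" "mul (cutoff H f) = 0" by auto
    have "(\<Prod>x\<in>R. om_form x \<bullet>c v) * f v = 0" if "v \<in> H" for v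
      using fun_cong[OF f(3), of v] that by (simp add: mul_def cutoff_def om_form)
    moreover have "\<exists>e\<in>H. om_form x \<bullet>c e \<noteq> 0" if x: "x \<in> R" for x
    proof -
      obtain e where "e \<in> H" "om e x = 1" using om_unit[of x] R(2,4) x by metis
      then show ?thesis by (intro bexI[of _ e]) (simp_all flip: om_form)
    qed
    ultimately have "f v = 0" if "v \<in> H" for v using cancel_prod[OF R(1) _ f(1), of om_form] that by blast
    then show "u = 0" using f(2) by (simp add: cutoff_eq_zero_iff)
  qed
  also have "mul ` cutoff H ` {f. form (int n - 1) f} = cutoff H ` {h. form D h \<and> (\<forall>x\<in>R. h x = 0)}"
  proof (intro set_eqI iffI)
    fix u assume "u \<in> mul ` cutoff H ` {f. form (int n - 1) f}"
    then obtain f where f: "form (int n - 1) f" "u = mul (cutoff H f)" by auto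
    have "form (int (card R)) (\<lambda>v. \<Prod>x\<in>R. om v x)" using R(1) by (intro form_prod_linear form_om_const)
    then have "form D (mul f)" unfolding mul_def by (rule form_mult'[OF _ f(1)]) (simp add: n)
    moreover have "mul f x = 0" if "x \<in> R" for x
      using that R(1) by (auto simp: mul_def prod_zero_iff intro: bexI[of _ x])
    moreover have "u = cutoff H (mul f)" using f(2) by (auto simp: mul_def cutoff_def)
    ultimately show "u \<in> cutoff H ` {h. form D h \<and> (\<forall>x\<in>R. h x = 0)}" by blast
  next
    fix u assume "u \<in> cutoff H ` {h. form D h \<and> (\<forall>x\<in>R. h x = 0)}"
    then obtain h where h: "form D h" "\<And>x. x \<in> R \<Longrightarrow> h x = 0" "u = cutoff H h" by blast
    obtain q where q: "form (int n - 1) q" "\<And>v. v \<in> H \<Longrightarrow> h v = (\<Prod>x\<in>R. om v x) * q v"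
      using vanish_factor[OF R(1) h(1) R(2,3,4) h(2)] unfolding n by blast
    have "u = mul (cutoff H q)" using q(2) h(3) by (auto simp: mul_def cutoff_def)
    then show "u \<in> mul ` cutoff H ` {f. form (int n - 1) f}" using q(1) by blast
  qed
  finally show ?thesis by (simp add: n_def)
qed

lemma log_forms_zero_on_plane:
  assumes A: "central_arrangement A" and HA: "H \<in> A"
  shows "(\<lambda>\<psi> v. (al \<bullet>c v) *s \<psi> v) ` log_forms (A - {H}) (d - 1) = {\<theta> \<in> log_forms A d. \<forall>v\<in>H. \<theta> v = 0}"
proof (intro set_eqI iffI)
  fix \<theta> assume "\<theta> \<in> (\<lambda>\<psi> v. (al \<bullet>c v) *s \<psi> v) ` log_forms (A - {H}) (d - 1)"
  then obtain \<psi> where \<psi>: "\<psi> \<in> log_forms (A - {H}) (d - 1)" "\<theta> = (\<lambda>v. (al \<bullet>c v) *s \<psi> v)" by blast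
  have zero: "\<theta> v = 0" if "v \<in> H" for v using that \<psi>(2) by (simp add: mem_H)
  have "\<theta> \<in> log_forms A d"
    unfolding log_forms_def
  proof (intro CollectI conjI ballI)
    show "vform d \<theta>" unfolding \<psi>(2)
      using \<psi>(1) by (intro vform_mult[OF form_dot, of "d - 1"]) (auto simp: log_forms_def)
    fix K v assume K: "K \<in> A" "v \<in> K"
    note sub = central_arrangementD(1)[OF A K(1)]
    show "\<theta> v \<in> K"
    proof (cases "K = H")
      case True
      then show ?thesis using K zero sub by (simp add: vec.subspace_0)
    next
      case False
      then show ?thesis using \<psi> K sub by (auto simp: log_forms_def intro!: vec.subspace_scale)
    qed
  qed
  then show "\<theta> \<in> {\<theta> \<in> log_forms A d. \<forall>v\<in>H. \<theta> v = 0}" using zero by simp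
next
  fix \<theta> assume "\<theta> \<in> {\<theta> \<in> log_forms A d. \<forall>v\<in>H. \<theta> v = 0}"
  then have \<theta>: "\<theta> \<in> log_forms A d" "\<And>v. v \<in> H \<Longrightarrow> \<theta> v = 0" by auto
  obtain \<psi> where \<psi>: "vform (d - 1) \<psi>" "\<And>v. \<theta> v = (al \<bullet>c v) *s \<psi> v"
    using vform_divide_plane[of d \<theta>] \<theta> by (auto simp: log_forms_def)
  have "\<psi> v \<in> K" if K: "K \<in> A - {H}" "v \<in> K" for v K
  proof -
    obtain e where e: "e \<in> K" "e \<notin> H"
      using plane_not_subset[of H K] central_arrangementD[OF A] HA K by blast
    show ?thesis
    proof (rule tangent_cancel[OF _ _ e(1) _ \<psi>(1) _ K(2)])
      show "vec.subspace K" "vec.dim K = 2" using central_arrangementD[OF A] K by auto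
      show "al \<bullet>c e \<noteq> 0" using e by (simp add: mem_H)
      show "(al \<bullet>c v) *s \<psi> v \<in> K" if "v \<in> K" for v
        using \<theta>(1) K that by (simp add: log_forms_def flip: \<psi>(2))
    qed
  qed
  then have "\<psi> \<in> log_forms (A - {H}) (d - 1)" using \<psi>(1) by (auto simp: log_forms_def)
  moreover have "\<theta> = (\<lambda>v. (al \<bullet>c v) *s \<psi> v)" using \<psi>(2) by auto
  ultimately show "\<theta> \<in> (\<lambda>\<psi> v. (al \<bullet>c v) *s \<psi> v) ` log_forms (A - {H}) (d - 1)" by blast
qed

text \<open>Three successive pieces of the logarithmic forms of degree \<open>d\<close>.  The map \<open>\<theta> \<mapsto> om v (\<theta> v)\<close> on \<open>H\<close> is onto the forms of degree
\<open>d + 1\<close> vanishing at the points.  Its kernel consists of the fields radial on \<open>H\<close>, whose restrictions to \<open>H\<close> are the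
multiples of the Euler field by forms of degree \<open>d - 1\<close>.  What is left are the fields vanishing on \<open>H\<close>, that is
\<open>al\<close> times the logarithmic forms of \<open>A - {H}\<close>.\<close>

lemma hasdim_log_forms_step:
  assumes A: "central_arrangement A" and HA: "H \<in> A"
  shows "\<exists>N. \<forall>d\<ge>N. \<forall>k. vfun.hasdim (log_forms (A - {H}) (d - 1)) k \<longrightarrow>
    vfun.hasdim (log_forms A d) (k + nat d + nat (d + 2 - int (card (points_on A H))))"
proof -
  obtain rep where reps: "point_reps A rep" using points_on_reps[OF A HA] by blast
  note rep = point_repsD[OF reps]
  obtain N where N: "\<And>D h. D \<ge> N \<Longrightarrow> form D h \<Longrightarrow> \<forall>X\<in>points_on A H. h (rep X) = 0 \<Longrightarrow>
      \<exists>\<theta>\<in>log_forms A (D - 1). \<forall>v\<in>H. om v (\<theta> v) = h v"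
    using om_surjective_large_degree[OF A HA reps] by blast
  have finP: "finite (points_on A H)" using finite_central[OF A] by (simp add: points_on_def)
  let ?R = "rep ` points_on A H"
  have cardR: "card ?R = card (points_on A H)" by (rule card_image[OF rep(3)])
  define mul :: "(complex^3 \<Rightarrow> complex^3) \<Rightarrow> complex^3 \<Rightarrow> complex^3" where "mul \<psi> = (\<lambda>v. (al \<bullet>c v) *s \<psi> v)" for \<psi>
  define euler :: "(complex^3 \<Rightarrow> complex) \<Rightarrow> complex^3 \<Rightarrow> complex^3" where "euler f = (\<lambda>v. f v *s v)" for f
  define sig :: "(complex^3 \<Rightarrow> complex^3) \<Rightarrow> complex^3 \<Rightarrow> complex" where "sig \<theta> = cutoff H (\<lambda>v. om v (\<theta> v))" for \<theta>
  have lin_mul: "Vector_Spaces.linear vscale vscale mul"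
    by (auto simp: linear_fun_simps mul_def vfun.vector_space_axioms algebra_simps)
  have lin_euler: "Vector_Spaces.linear sscale vscale euler"
    by (auto simp: linear_fun_simps euler_def sfun.vector_space_axioms vfun.vector_space_axioms algebra_simps)
  have lin_sig: "Vector_Spaces.linear vscale sscale sig"
    by (auto simp: Vector_Spaces.linear_iff sscale_def vscale_def fun_eq_iff sig_def cutoff_def om_linear_right
        sfun.vector_space_axioms vfun.vector_space_axioms)
  show ?thesis
  proof (intro exI[of _ "max N (max 1 (int (card ?R)))"] allI impI)
    fix d k assume d: "d \<ge> max N (max 1 (int (card ?R)))"
      and k: "vfun.hasdim (log_forms (A - {H}) (d - 1)) k"
    let ?K = "{\<theta> \<in> log_forms A d. sig \<theta> = 0}"
    have subK: "vfun.subspace ?K"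
    proof -
      have "?K = log_forms A d \<inter> {\<theta>. sig \<theta> = 0}" by auto
      then show ?thesis
        using vfun.subspace_inter[OF subspace_log_forms[OF A] vs.linear_subspace_kernel[OF lin_sig]] by simp
    qed
    have "vfun.hasdim (mul ` log_forms (A - {H}) (d - 1)) k"
    proof (rule vv.hasdim_image[OF lin_mul k])
      fix \<psi> assume \<psi>: "\<psi> \<in> log_forms (A - {H}) (d - 1)" "mul \<psi> = 0"
      have "\<psi> v $ i = 0" for v i
      proof (rule cancel_plane[of "d - 1" "\<lambda>v. \<psi> v $ i"])
        show "form (d - 1) (\<lambda>v. \<psi> v $ i)" using \<psi>(1) by (simp add: log_forms_def vform_def)
        show "(al \<bullet>c v) * \<psi> v $ i = 0" for v
          using fun_cong[OF \<psi>(2), of v] by (auto simp: mul_def vec_eq_iff)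
      qed
      then show "\<psi> = 0" by (simp add: fun_eq_iff vec_eq_iff)
    qed
    also have "mul ` log_forms (A - {H}) (d - 1) = {\<theta> \<in> ?K. cutoff H \<theta> = 0}"
    proof -
      have "\<theta> \<in> ?K \<and> cutoff H \<theta> = 0 \<longleftrightarrow> \<theta> \<in> log_forms A d \<and> (\<forall>v\<in>H. \<theta> v = 0)" for \<theta>
        by (auto simp: sig_def cutoff_eq_zero_iff) (simp add: om_def)
      then show ?thesis using log_forms_zero_on_plane[OF A HA, of d] unfolding mul_def by auto
    qed
    finally have ker: "vfun.hasdim {\<theta> \<in> ?K. cutoff H \<theta> = 0} k" .
    have "vfun.hasdim (euler ` cutoff H ` {f. form (int (nat d) - 1) f}) (nat d)"
    proof (rule sv.hasdim_image[OF lin_euler hasdim_plane_forms])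
      fix u assume "u \<in> cutoff H ` {f. form (int (nat d) - 1) f}" "euler u = 0"
      then obtain f where f: "form (int (nat d) - 1) f" "u = cutoff H f" "euler (cutoff H f) = 0" by auto
      have "om v e2 * f v = 0" if "v \<in> H" for v
        using fun_cong[OF f(3), of v] that by (auto simp: euler_def cutoff_def om_def)
      then have "f v = 0" if "v \<in> H" for v using cancel_point[OF f(1) e2_mem e2_nonzero] that by blast
      then show "u = 0" using f(2) by (simp add: cutoff_eq_zero_iff)
    qed
    also have "euler ` cutoff H ` {f. form (int (nat d) - 1) f} = cutoff H ` ?K"
    proof (intro set_eqI iffI)
      fix u assume "u \<in> euler ` cutoff H ` {f. form (int (nat d) - 1) f}"
      then obtain f where f: "form (d - 1) f" "u = euler (cutoff H f)" using d by auto
      have "euler f \<in> log_forms A d" unfolding euler_def by (rule log_forms_mult[OF A f(1) log_forms_id]) simp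
      moreover have "sig (euler f) = 0" by (simp add: sig_def cutoff_eq_zero_iff euler_def om_linear_right)
      moreover have "u = cutoff H (euler f)" using f(2) by (auto simp: euler_def cutoff_def)
      ultimately show "u \<in> cutoff H ` ?K" by blast
    next
      fix u assume "u \<in> cutoff H ` ?K"
      then obtain \<theta> where \<theta>: "\<theta> \<in> log_forms A d" "sig \<theta> = 0" "u = cutoff H \<theta>" by blast
      obtain f where f: "form (d - 1) f" "\<And>v. v \<in> H \<Longrightarrow> \<theta> v = f v *s v"
        using radial_on_plane[of d \<theta>] \<theta> HA by (auto simp: log_forms_def sig_def cutoff_eq_zero_iff)
      have "u = euler (cutoff H f)" using \<theta>(3) f(2) by (auto simp: euler_def cutoff_def)
      moreover have "form (int (nat d) - 1) f" using f(1) d by simp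
      ultimately show "u \<in> euler ` cutoff H ` {f. form (int (nat d) - 1) f}" by blast
    qed
    finally have im: "vfun.hasdim (cutoff H ` ?K) (nat d)" .
    have K: "vfun.hasdim ?K (k + nat d)"
      by (rule vv.hasdim_rank_nullity[OF linear_cutoff_v subK ker im])
    have "sig ` log_forms A d = cutoff H ` {h. form (d + 1) h \<and> (\<forall>x\<in>?R. h x = 0)}"
    proof (intro set_eqI iffI)
      fix u assume "u \<in> sig ` log_forms A d"
      then obtain \<theta> where \<theta>: "\<theta> \<in> log_forms A d" "u = sig \<theta>" by blast
      have "form (d + 1) (\<lambda>v. om v (\<theta> v))" using \<theta>(1) by (auto simp: log_forms_def intro: form_om)
      moreover have "om x (\<theta> x) = 0" if "x \<in> ?R" for x
        using that om_log_vanishes[OF A HA \<theta>(1)] rep(1) by auto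
      ultimately show "u \<in> cutoff H ` {h. form (d + 1) h \<and> (\<forall>x\<in>?R. h x = 0)}"
        using \<theta>(2) by (auto simp: sig_def)
    next
      fix u assume "u \<in> cutoff H ` {h. form (d + 1) h \<and> (\<forall>x\<in>?R. h x = 0)}"
      then obtain h where h: "form (d + 1) h" "\<forall>X\<in>points_on A H. h (rep X) = 0" "u = cutoff H h" by auto
      obtain \<theta> where "\<theta> \<in> log_forms A (d + 1 - 1)" "\<forall>v\<in>H. om v (\<theta> v) = h v"
        using N[OF _ h(1,2)] d by auto
      then have "\<theta> \<in> log_forms A d" "u = sig \<theta>" using h(3) by (auto simp: sig_def cutoff_def)
      then show "u \<in> sig ` log_forms A d" by blast
    qed
    moreover have "sfun.hasdim (cutoff H ` {h. form (d + 1) h \<and> (\<forall>x\<in>?R. h x = 0)}) (nat (d + 1 + 1 - int (card ?R)))"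
    proof (rule hasdim_vanishing)
      show "finite ?R" using finP by simp
      show "x \<in> H" if "x \<in> ?R" for x using that rep(1) by auto
      show "0 \<notin> ?R" using rep(1) by fastforce
      show "om x y \<noteq> 0" if "x \<in> ?R" "y \<in> ?R" "x \<noteq> y" for x y using that rep(2) by auto
      show "int (card ?R) \<le> d + 1" using d by simp
    qed
    ultimately have im': "sfun.hasdim (sig ` log_forms A d) (nat (d + 2 - int (card (points_on A H))))"
      by (simp add: cardR add.assoc)
    show "vfun.hasdim (log_forms A d) (k + nat d + nat (d + 2 - int (card (points_on A H))))"
      by (rule vs.hasdim_rank_nullity[OF lin_sig subspace_log_forms[OF A] K im'])
  qed
qed

end

theorem hilbert_polynomial:
  assumes "central_arrangement A"
  shows "\<exists>N. \<forall>d\<ge>N. \<exists>k. vfun.hasdim (log_forms A d) k \<and>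
    2 * int k = 3 * d\<^sup>2 + (9 - 2 * int (card A)) * d + 6 + (int (card A))\<^sup>2 - 3 * int (card A) - 2 * int (betti2 A)"
  using finite_central[OF assms] assms
proof (induction A rule: finite_induct)
  case empty
  have eq: "log_forms {} d = {F. \<forall>i. form d (\<lambda>v. F v $ i)}" for d by (simp add: log_forms_def vform_def)
  show ?case
  proof (intro exI[of _ "0::int"] allI impI)
    fix d :: int assume "d \<ge> 0"
    then obtain k where "sfun.hasdim {f. form d f} k" "2 * int k = (d + 1) * (d + 2)"
      using hasdim_forms[of d] by auto
    then show "\<exists>k. vfun.hasdim (log_forms {} d) k \<and> 2 * int k = 3 * d\<^sup>2 + (9 - 2 * int (card {})) * d + 6
        + (int (card {}))\<^sup>2 - 3 * int (card {}) - 2 * int (betti2 {})"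
      using hasdim_form_triples[of "\<lambda>_. d" "\<lambda>_. k"] unfolding eq
      by (intro exI[of _ "k + k + k"]) (simp add: betti2_def points_def power2_eq_square algebra_simps)
  qed
next
  case (insert H A)
  have A: "central_arrangement A" using insert.prems by (rule central_subset) auto
  obtain al xi et e0 e1 e2 where "plane_chart H al xi et e0 e1 e2"
    using plane_chart_exists central_arrangementD[OF insert.prems, of H] by blast
  then interpret plane_chart H al xi et e0 e1 e2 .
  let ?A = "insert H A" and ?p = "int (card (points_on (insert H A) H))"
  have del: "?A - {H} = A" using insert.hyps by auto
  obtain N where N: "\<And>d. d \<ge> N \<Longrightarrow> \<exists>k. vfun.hasdim (log_forms A d) k \<and>
    2 * int k = 3 * d\<^sup>2 + (9 - 2 * int (card A)) * d + 6 + (int (card A))\<^sup>2 - 3 * int (card A) - 2 * int (betti2 A)"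
    using insert.IH[OF A] by blast
  obtain M where M: "\<And>d k. d \<ge> M \<Longrightarrow> vfun.hasdim (log_forms A (d - 1)) k \<Longrightarrow>
    vfun.hasdim (log_forms ?A d) (k + nat d + nat (d + 2 - ?p))"
    using hasdim_log_forms_step[OF insert.prems, unfolded del] by blast
  have betti2: "int (betti2 ?A) = int (betti2 A) + ?p"
    using betti2_delete[OF insert.prems, of H] del by simp
  have card: "int (card ?A) = int (card A) + 1" using insert.hyps by simp
  show ?case
  proof (intro exI[of _ "max (N + 1) (max M (max 0 ?p))"] allI impI)
    fix d assume d: "d \<ge> max (N + 1) (max M (max 0 ?p))"
    then obtain k where k: "vfun.hasdim (log_forms A (d - 1)) k"
      "2 * int k = 3 * (d - 1)\<^sup>2 + (9 - 2 * int (card A)) * (d - 1) + 6 + (int (card A))\<^sup>2 - 3 * int (card A) - 2 * int (betti2 A)"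
      using N[of "d - 1"] by auto
    have "2 * int (k + nat d + nat (d + 2 - ?p)) = 2 * int k + 2 * d + 2 * (d + 2 - ?p)" using d by simp
    also have "\<dots> = 3 * d\<^sup>2 + (9 - 2 * int (card ?A)) * d + 6 + (int (card ?A))\<^sup>2 - 3 * int (card ?A) - 2 * int (betti2 ?A)"
      unfolding k(2) betti2 card by (simp add: power2_eq_square algebra_simps)
    finally show "\<exists>k. vfun.hasdim (log_forms ?A d) k \<and> 2 * int k = 3 * d\<^sup>2 + (9 - 2 * int (card ?A)) * d + 6
        + (int (card ?A))\<^sup>2 - 3 * int (card ?A) - 2 * int (betti2 ?A)"
      using M[OF _ k(1)] d by auto
  qed
qed

text \<open>The two formulas for the dimension agree for all large degrees, hence as polynomials: the linear coefficient gives
\<open>card A\<close>, the constant one \<open>betti2 A\<close>.\<close>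

theorem free_exp_numerics:
  assumes A: "central_arrangement A" and free: "free_exp A a b"
  shows "int (card A) = 1 + a + b" "int (betti2 A) = a + b + a * b"
proof -
  obtain \<theta> \<phi> where basis: "free_basis A a b \<theta> \<phi>" using free by (auto simp: free_exp_def)
  define n where "n = int (card A)"
  obtain N where N: "\<And>d. d \<ge> N \<Longrightarrow> \<exists>k. vfun.hasdim (log_forms A d) k \<and>
    2 * int k = 3 * d\<^sup>2 + (9 - 2 * n) * d + 6 + n\<^sup>2 - 3 * n - 2 * int (betti2 A)"
    using hilbert_polynomial[OF A] unfolding n_def by blast
  define d where "d = max N (max 0 (max a b))"
  define u where "u = 2 - 2 * (1 + a + b)"
  have eq: "3 * t\<^sup>2 + (9 - 2 * n) * t + 6 + n\<^sup>2 - 3 * n - 2 * int (betti2 A)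
      = t * (t + 1) + (t - a + 1) * (t - a + 2) + (t - b + 1) * (t - b + 2)" if "t \<ge> d" for t
  proof -
    obtain k where k: "vfun.hasdim (log_forms A t) k"
      "2 * int k = 3 * t\<^sup>2 + (9 - 2 * n) * t + 6 + n\<^sup>2 - 3 * n - 2 * int (betti2 A)"
      using N[of t] \<open>t \<ge> d\<close> by (auto simp: d_def)
    obtain l where l: "vfun.hasdim (log_forms A t) l"
      "2 * int l = t * (t + 1) + (t - a + 1) * (t - a + 2) + (t - b + 1) * (t - b + 2)"
      using hasdim_free[OF A basis, of t] \<open>t \<ge> d\<close> by (auto simp: d_def)
    show ?thesis using vfun.hasdim_unique[OF k(1) l(1)] k(2) l(2) by simp
  qed
  have n: "n = 1 + a + b"
    using eq[of d] eq[of "d + 1"] by (simp add: power2_eq_square algebra_simps)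
  then show "int (card A) = 1 + a + b" by (simp add: n_def)
  show "int (betti2 A) = a + b + a * b"
    using eq[of d] unfolding n by (simp add: power2_eq_square algebra_simps)
qed

section \<open>Polynomials as polynomial functions\<close>

definition weight :: "(3 \<Rightarrow>\<^sub>0 nat) \<Rightarrow> nat" where
  "weight m = (\<Sum>i\<in>UNIV. Poly_Mapping.lookup m i)"

definition peval :: "poly3 \<Rightarrow> complex^3 \<Rightarrow> complex" where
  "peval p v = (\<Sum>m\<in>Poly_Mapping.keys p. Poly_Mapping.lookup p m * (\<Prod>i\<in>UNIV. v $ i ^ Poly_Mapping.lookup m i))"

lemma peval_superset:
  assumes "finite S" "Poly_Mapping.keys p \<subseteq> S"
  shows "peval p v = (\<Sum>m\<in>S. Poly_Mapping.lookup p m * (\<Prod>i\<in>UNIV. v $ i ^ Poly_Mapping.lookup m i))"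
  unfolding peval_def using assms by (intro sum.mono_neutral_left) (auto simp: in_keys_iff)

lemma peval_zero [simp]: "peval 0 v = 0"
  by (simp add: peval_def)

lemma peval_add: "peval (p + q) v = peval p v + peval q v"
proof -
  let ?S = "Poly_Mapping.keys p \<union> Poly_Mapping.keys q"
  have "peval (p + q) v = (\<Sum>m\<in>?S. Poly_Mapping.lookup (p + q) m * (\<Prod>i\<in>UNIV. v $ i ^ Poly_Mapping.lookup m i))"
    by (intro peval_superset) (auto simp: Poly_Mapping.keys_add)
  then show ?thesis
    by (simp add: peval_superset[of ?S p] peval_superset[of ?S q] lookup_add algebra_simps sum.distrib)
qed

lemma peval_sum: "peval (\<Sum>i\<in>I. f i) v = (\<Sum>i\<in>I. peval (f i) v)"
  by (induction I rule: infinite_finite_induct) (auto simp: peval_add)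

lemma peval_single: "peval (Poly_Mapping.single m c) v = c * (\<Prod>i\<in>UNIV. v $ i ^ Poly_Mapping.lookup m i)"
  by (cases "c = 0") (auto simp: peval_def)

lemma peval_coordinate: "peval (Poly_Mapping.single (Poly_Mapping.single i 1) c) v = c * v $ i"
proof -
  have "(\<Prod>j\<in>UNIV. v $ j ^ Poly_Mapping.lookup (Poly_Mapping.single i 1) j) = (\<Prod>j\<in>UNIV. if j = i then v $ j else 1)"
    by (intro prod.cong) (auto simp: lookup_single when_def)
  then show ?thesis by (simp add: peval_single)
qed

lemma poly_sum_singles: "p = (\<Sum>m\<in>Poly_Mapping.keys p. Poly_Mapping.single m (Poly_Mapping.lookup p m))"
proof (rule poly_mapping_eqI)
  fix k
  show "Poly_Mapping.lookup p k
      = Poly_Mapping.lookup (\<Sum>m\<in>Poly_Mapping.keys p. Poly_Mapping.single m (Poly_Mapping.lookup p m)) k"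
    by (simp add: lookup_sum lookup_single when_def in_keys_iff)
qed

lemma peval_mult: "peval (p * q) v = peval p v * peval q v"
proof -
  have single: "peval (Poly_Mapping.single m c * Poly_Mapping.single n d) v
      = peval (Poly_Mapping.single m c) v * peval (Poly_Mapping.single n d) v" for m n c d
    by (simp add: mult_single peval_single lookup_add power_add prod.distrib)
  let ?s = "\<lambda>p m. Poly_Mapping.single m (Poly_Mapping.lookup p m)"
  have "p * q = (\<Sum>m\<in>Poly_Mapping.keys p. \<Sum>n\<in>Poly_Mapping.keys q. ?s p m * ?s q n)"
    by (subst (1) poly_sum_singles, subst (3) poly_sum_singles) (simp add: sum_product)
  then have "peval (p * q) v = (\<Sum>m\<in>Poly_Mapping.keys p. \<Sum>n\<in>Poly_Mapping.keys q. peval (?s p m) v * peval (?s q n) v)"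
    by (simp add: peval_sum single)
  also have "\<dots> = peval (\<Sum>m\<in>Poly_Mapping.keys p. ?s p m) v * peval (\<Sum>n\<in>Poly_Mapping.keys q. ?s q n) v"
    by (simp add: peval_sum sum_product)
  finally show ?thesis by (simp flip: poly_sum_singles)
qed

lemma peval_uminus: "peval (- p) v = - peval p v"
  using peval_add[of p "- p" v] by (simp add: eq_neg_iff_add_eq_0 add.commute)

lemma peval_diff: "peval (p - q) v = peval p v - peval q v"
  using peval_add[of p "- q" v] by (simp add: peval_uminus)

lemma base_digits_inject:
  fixes a b c a' b' c' N :: nat
  assumes "a + N * (b + N * c) = a' + N * (b' + N * c')" "a < N" "b < N" "a' < N" "b' < N"
  shows "a = a' \<and> b = b' \<and> c = c'"
proof -
  have 1: "x = x' \<and> y = y'" if eq: "x + N * y = x' + N * y'" and x: "x < N" "x' < N" for x y x' y' :: nat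
  proof -
    have "(x + N * y) mod N = x" "(x' + N * y') mod N = x'" using x by simp_all
    then show ?thesis using eq x by auto
  qed
  show ?thesis using 1[OF assms(1,2,4)] 1[of b c b' c'] assms by blast
qed

lemma peval_eq_zeroD:
  assumes "\<And>v. peval p v = 0" shows "p = 0"
proof (rule ccontr)
  assume "p \<noteq> 0"
  then obtain m0 where m0: "m0 \<in> Poly_Mapping.keys p" by (metis all_not_in_conv keys_eq_empty)
  define N where "N = Suc (\<Sum>m\<in>Poly_Mapping.keys p. weight m)"
  have small: "Poly_Mapping.lookup m i < N" if "m \<in> Poly_Mapping.keys p" for m i
  proof -
    have "Poly_Mapping.lookup m i \<le> weight m" unfolding weight_def by (intro member_le_sum) auto
    also have "\<dots> \<le> (\<Sum>m\<in>Poly_Mapping.keys p. weight m)" using that by (intro member_le_sum) auto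
    finally show ?thesis by (simp add: N_def)
  qed
  \<comment> \<open>On the curve \<open>(t, t^N, t^(N^2))\<close> distinct monomials of \<open>p\<close> become distinct powers of \<open>t\<close>.\<close>
  define code where "code m = Poly_Mapping.lookup m 1 + N * (Poly_Mapping.lookup m 2 + N * Poly_Mapping.lookup m 3)"
    for m :: "3 \<Rightarrow>\<^sub>0 nat"
  have inj: "m = m'" if "m \<in> Poly_Mapping.keys p" "m' \<in> Poly_Mapping.keys p" "code m = code m'" for m m'
  proof -
    have "Poly_Mapping.lookup m 1 = Poly_Mapping.lookup m' 1 \<and> Poly_Mapping.lookup m 2 = Poly_Mapping.lookup m' 2
        \<and> Poly_Mapping.lookup m 3 = Poly_Mapping.lookup m' 3"
      using that by (intro base_digits_inject) (auto simp: code_def small)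
    then show ?thesis by (intro poly_mapping_eqI) (metis exhaust_3)
  qed
  define q where "q = (\<Sum>m\<in>Poly_Mapping.keys p. monom (Poly_Mapping.lookup p m) (code m))"
  have "poly q t = peval p (vector [t, t ^ N, t ^ (N * N)])" for t
  proof -
    have "a + N * (b + N * c) = a + N * b + N * N * c" for a b c by (simp add: algebra_simps)
    then have pow: "t ^ (a + N * (b + N * c)) = t ^ a * ((t ^ N) ^ b * (t ^ (N * N)) ^ c)" for a b c
      by (simp only: power_add power_mult mult.assoc)
    let ?w = "vector [t, t ^ N, t ^ (N * N)] :: complex^3"
    have w: "?w $ 1 = t" "?w $ 2 = t ^ N" "?w $ 3 = t ^ (N * N)" by (rule vector_3)+
    have "(\<Prod>i\<in>UNIV. ?w $ i ^ f i) = ?w $ 1 ^ f 1 * (?w $ 2 ^ f 2 * ?w $ 3 ^ f 3)" for f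
      by (simp only: UNIV_3) simp
    then have "(\<Prod>i\<in>UNIV. ?w $ i ^ Poly_Mapping.lookup m i) = t ^ code m" for m
      by (simp only: w pow code_def)
    then have "peval p ?w = (\<Sum>m\<in>Poly_Mapping.keys p. Poly_Mapping.lookup p m * t ^ code m)"
      by (simp only: peval_def)
    then show ?thesis by (simp add: q_def poly_sum poly_monom)
  qed
  then have "q = 0" using assms by (simp flip: poly_all_0_iff_0)
  then have "0 = coeff q (code m0)" by simp
  also have "\<dots> = (\<Sum>m\<in>Poly_Mapping.keys p. if m = m0 then Poly_Mapping.lookup p m else 0)"
    unfolding q_def coeff_sum using inj m0 by (intro sum.cong) auto
  also have "\<dots> = Poly_Mapping.lookup p m0" using m0 by simp
  finally show False using m0 by (simp add: in_keys_iff)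
qed

lemma peval_inject: "(\<And>v. peval p v = peval q v) \<Longrightarrow> p = q"
  using peval_eq_zeroD[of "p - q"] by (simp add: peval_diff)

lemma homogeneous_iff: "homogeneous d p \<longleftrightarrow> (\<forall>m\<in>Poly_Mapping.keys p. weight m = d)"
  by (simp add: homogeneous_def weight_def)

lemma weight_add: "weight (m + n) = weight m + weight n"
  by (simp add: weight_def lookup_add sum.distrib)

lemma homogeneous_add: "homogeneous d p \<Longrightarrow> homogeneous d q \<Longrightarrow> homogeneous d (p + q)"
  unfolding homogeneous_iff using Poly_Mapping.keys_add[of p q] by blast

lemma homogeneous_mult: "homogeneous d p \<Longrightarrow> homogeneous e q \<Longrightarrow> homogeneous (d + e) (p * q)"
  unfolding homogeneous_iff using keys_mult[of p q] by (fastforce simp: weight_add)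

lemma homogeneous_zero [simp]: "homogeneous d 0"
  by (simp add: homogeneous_iff)

lemma form_peval: "homogeneous d p \<Longrightarrow> form (int d) (peval p)"
proof -
  assume p: "homogeneous d p"
  have "form (int d) (\<lambda>v. Poly_Mapping.lookup p m * (\<Prod>i\<in>UNIV. v $ i ^ Poly_Mapping.lookup m i))"
    if "m \<in> Poly_Mapping.keys p" for m
  proof -
    have "form (\<Sum>i\<in>UNIV. int (Poly_Mapping.lookup m i) * 1) (\<lambda>v. \<Prod>i\<in>UNIV. v $ i ^ Poly_Mapping.lookup m i)"
      by (intro form_prod form_power form_coord) auto
    moreover have "(\<Sum>i\<in>UNIV. int (Poly_Mapping.lookup m i) * 1) = int d"
      using p that by (simp add: homogeneous_def flip: of_nat_sum)
    ultimately show ?thesis by (intro form_scale) simp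
  qed
  then have "form (int d) (\<lambda>v. \<Sum>m\<in>Poly_Mapping.keys p. Poly_Mapping.lookup p m * (\<Prod>i\<in>UNIV. v $ i ^ Poly_Mapping.lookup m i))"
    by (rule form_sum)
  then show ?thesis unfolding peval_def .
qed

lemma form_polynomial: "form d f \<Longrightarrow> \<exists>p. (0 \<le> d \<longrightarrow> homogeneous (nat d) p) \<and> (\<forall>v. peval p v = f v)"
proof (induction rule: form.induct)
  case (form_zero d)
  then show ?case by (intro exI[of _ 0]) simp
next
  case (form_const c)
  show ?case
    by (intro exI[of _ "Poly_Mapping.single 0 c"]) (auto simp: homogeneous_def peval_single)
next
  case (form_coord i)
  show ?case
    by (intro exI[of _ "Poly_Mapping.single (Poly_Mapping.single i 1) 1"])
      (auto simp: homogeneous_def peval_coordinate[unfolded One_nat_def] lookup_single when_def)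
next
  case (form_add d f g)
  then obtain p q where "0 \<le> d \<longrightarrow> homogeneous (nat d) p" "\<forall>v. peval p v = f v"
    "0 \<le> d \<longrightarrow> homogeneous (nat d) q" "\<forall>v. peval q v = g v" by blast
  then show ?case by (intro exI[of _ "p + q"]) (auto simp: peval_add homogeneous_add)
next
  case (form_mult d f e g)
  show ?case
  proof (cases "0 \<le> d \<and> 0 \<le> e")
    case True
    from form_mult.IH obtain p q where "0 \<le> d \<longrightarrow> homogeneous (nat d) p" "\<forall>v. peval p v = f v"
      "0 \<le> e \<longrightarrow> homogeneous (nat e) q" "\<forall>v. peval q v = g v" by blast
    then show ?thesis
      using True by (intro exI[of _ "p * q"]) (auto simp: peval_mult nat_add_distrib homogeneous_mult)
  next
    case False
    then have "f v * g v = 0" for v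
      using form_negative_degree[OF form_mult.hyps(1)] form_negative_degree[OF form_mult.hyps(2)] by auto
    then show ?thesis by (intro exI[of _ 0]) simp
  qed
qed

text \<open>The homogeneous part of degree \<open>d\<close>; the integer degree makes it zero for \<open>d < 0\<close>, in step with \<open>form\<close>.\<close>

definition component :: "int \<Rightarrow> poly3 \<Rightarrow> poly3" where
  "component d p = (\<Sum>m\<in>{m \<in> Poly_Mapping.keys p. int (weight m) = d}. Poly_Mapping.single m (Poly_Mapping.lookup p m))"

lemma lookup_component:
  "Poly_Mapping.lookup (component d p) m = (if int (weight m) = d then Poly_Mapping.lookup p m else 0)"
  by (auto simp: component_def lookup_sum lookup_single when_def in_keys_iff)

lemma component_add: "component d (p + q) = component d p + component d q"
  by (rule poly_mapping_eqI) (simp add: lookup_component lookup_add)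

lemma component_zero [simp]: "component d 0 = 0"
  by (rule poly_mapping_eqI) (simp add: lookup_component)

lemma component_sum: "component d (\<Sum>i\<in>I. f i) = (\<Sum>i\<in>I. component d (f i))"
  by (induction I rule: infinite_finite_induct) (auto simp: component_add)

lemma homogeneous_component: "homogeneous (nat d) (component d p)"
  by (auto simp: homogeneous_iff in_keys_iff lookup_component split: if_splits)

lemma component_negative: "d < 0 \<Longrightarrow> component d p = 0"
  by (rule poly_mapping_eqI) (simp add: lookup_component)

lemma form_component: "form d (peval (component d p))"
proof (cases "d < 0")
  case True
  have "peval 0 = (\<lambda>_. 0)" by auto
  then show ?thesis using form_zero[of d] component_negative[OF True] by simp
next
  case False
  then show ?thesis using form_peval[OF homogeneous_component[of d p]] by simp
qed

lemma component_homogeneous: "homogeneous e p \<Longrightarrow> component d p = (if d = int e then p else 0)"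
  by (rule poly_mapping_eqI) (auto simp: lookup_component homogeneous_iff in_keys_iff)

text \<open>A bound on the degrees of the monomials; the sum, unlike a maximum, is defined for the zero polynomial as well.\<close>

definition weight_bound :: "poly3 \<Rightarrow> nat" where
  "weight_bound p = (\<Sum>m\<in>Poly_Mapping.keys p. weight m)"

lemma sum_components: "n \<ge> weight_bound p \<Longrightarrow> (\<Sum>k\<le>n. component (int k) p) = p"
proof (rule poly_mapping_eqI)
  fix m assume n: "n \<ge> weight_bound p"
  have "weight m \<le> n" if "m \<in> Poly_Mapping.keys p"
    using n that member_le_sum[of m "Poly_Mapping.keys p" weight] by (auto simp: weight_bound_def)
  then show "Poly_Mapping.lookup (\<Sum>k\<le>n. component (int k) p) m = Poly_Mapping.lookup p m"
    by (auto simp: lookup_sum lookup_component in_keys_iff)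
qed

lemma component_outside: "\<not> (0 \<le> d \<and> d \<le> int (weight_bound p)) \<Longrightarrow> component d p = 0"
proof (rule poly_mapping_eqI)
  fix m assume d: "\<not> (0 \<le> d \<and> d \<le> int (weight_bound p))"
  have "weight m \<le> weight_bound p" if "m \<in> Poly_Mapping.keys p"
    using that member_le_sum[of m "Poly_Mapping.keys p" weight] by (auto simp: weight_bound_def)
  then show "Poly_Mapping.lookup (component d p) m = Poly_Mapping.lookup 0 m"
    using d by (cases "m \<in> Poly_Mapping.keys p") (auto simp: lookup_component in_keys_iff)
qed

lemma component_mult:
  assumes "homogeneous e q"
  shows "component d (p * q) = component (d - int e) p * q"
proof -
  let ?n = "weight_bound p"
  have "component d (p * q) = component d ((\<Sum>k\<le>?n. component (int k) p) * q)" by (simp add: sum_components)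
  also have "\<dots> = (\<Sum>k\<le>?n. component d (component (int k) p * q))"
    by (simp add: sum_distrib_right component_sum)
  also have "\<dots> = (\<Sum>k\<le>?n. if int k = d - int e then component (d - int e) p * q else 0)"
  proof (rule sum.cong[OF refl])
    fix k
    have "homogeneous (k + e) (component (int k) p * q)"
      using homogeneous_mult[OF homogeneous_component[of "int k" p] assms] by simp
    from component_homogeneous[OF this, of d]
    show "component d (component (int k) p * q) = (if int k = d - int e then component (d - int e) p * q else 0)"
      by auto
  qed
  also have "\<dots> = component (d - int e) p * q"
  proof (cases "0 \<le> d - int e \<and> d - int e \<le> int ?n")
    case True
    then have "(\<Sum>k\<le>?n. if int k = d - int e then component (d - int e) p * q else 0)
        = (\<Sum>k\<le>?n. if k = nat (d - int e) then component (d - int e) p * q else 0)"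
      by (intro sum.cong) auto
    moreover have "nat (d - int e) \<le> ?n" using True by linarith
    ultimately show ?thesis by simp
  next
    case False
    then have "component (d - int e) p * q = 0" using component_outside[of "d - int e" p] by simp
    then show ?thesis by (simp only: if_cancel sum.neutral_const)
  qed
  finally show ?thesis .
qed

text \<open>On a cone, \<open>q\<close> along a ray through \<open>v\<close> is a polynomial in the scaling factor, with the values of the components as coefficients.\<close>

lemma component_vanishes:
  assumes "\<And>v. v \<in> H \<Longrightarrow> peval q v = 0" "\<And>t v. v \<in> H \<Longrightarrow> t *s v \<in> H" "v \<in> H"
  shows "peval (component d q) v = 0"
proof (cases "0 \<le> d \<and> d \<le> int (weight_bound q)")
  case True
  have "(\<Sum>k\<le>weight_bound q. peval (component (int k) q) v * t ^ k) = 0" for t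
  proof -
    have "(\<Sum>k\<le>weight_bound q. peval (component (int k) q) v * t ^ k)
        = (\<Sum>k\<le>weight_bound q. peval (component (int k) q) (t *s v))"
      by (intro sum.cong refl) (simp add: form_homogeneous[OF form_component] mult.commute)
    also have "\<dots> = peval q (t *s v)" by (simp add: sum_components flip: peval_sum)
    finally show ?thesis using assms by simp
  qed
  then have "\<forall>k\<le>weight_bound q. peval (component (int k) q) v = 0"
    using polyfun_eq_0[of "\<lambda>k. peval (component (int k) q) v" "weight_bound q"] by blast
  then show ?thesis using True by (metis nat_le_iff int_nat_eq)
next
  case False
  then show ?thesis using component_outside[of d q] by simp
qed

section \<open>Derivations as vector fields\<close>

definition pvec :: "poly3^3 \<Rightarrow> complex^3 \<Rightarrow> complex^3" where
  "pvec \<theta> v = (\<chi> i. peval (\<theta> $ i) v)"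

lemma pvec_add: "pvec (\<theta> + \<phi>) v = pvec \<theta> v + pvec \<phi> v"
  by (simp add: pvec_def vec_eq_iff peval_add)

lemma pvec_scale: "pvec (p *s \<theta>) v = peval p v *s pvec \<theta> v"
  by (simp add: pvec_def vec_eq_iff peval_mult)

lemma pvec_zero [simp]: "pvec 0 v = 0"
  by (simp add: pvec_def vec_eq_iff)

lemma pvec_inject: "(\<And>v. pvec \<theta> v = pvec \<phi> v) \<Longrightarrow> \<theta> = \<phi>"
  by (auto simp: pvec_def vec_eq_iff intro: peval_inject)

lemma peval_linear_form: "peval (linear_form a) v = a \<bullet>c v"
  by (simp only: linear_form_def peval_sum peval_coordinate dot_def)

lemma partial_deriv_linear_form: "partial_deriv i (linear_form a) = Poly_Mapping.single 0 (a $ i)"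
proof -
  let ?e = "\<lambda>j::3. Poly_Mapping.single j (1::nat)"
  have inj: "?e j = ?e k \<longleftrightarrow> j = k" for j k by (metis lookup_single_eq lookup_single_not_eq zero_neq_one)
  have lookup: "Poly_Mapping.lookup (linear_form a) (?e j) = a $ j" for j
    by (simp add: linear_form_def lookup_sum lookup_single when_def inj[unfolded One_nat_def])
  have keys: "Poly_Mapping.keys (linear_form a) \<subseteq> range ?e"
  proof
    fix m assume m: "m \<in> Poly_Mapping.keys (linear_form a)"
    show "m \<in> range ?e"
    proof (rule ccontr)
      assume "m \<notin> range ?e"
      then have "?e j \<noteq> m" for j by blast
      then have "Poly_Mapping.lookup (linear_form a) m = 0"
        by (simp add: linear_form_def lookup_sum lookup_single when_def)
      then show False using m by (simp add: in_keys_iff)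
    qed
  qed
  let ?t = "\<lambda>m. Poly_Mapping.single (m - ?e i) (of_nat (Poly_Mapping.lookup m i) * Poly_Mapping.lookup (linear_form a) m)"
  have "partial_deriv i (linear_form a) = (\<Sum>m\<in>range ?e. ?t m)"
    unfolding partial_deriv_def using keys by (intro sum.mono_neutral_left) (auto simp: in_keys_iff)
  also have "\<dots> = (\<Sum>j\<in>UNIV. ?t (?e j))"
    by (rule sum.reindex_cong[of ?e]) (auto simp: inj_on_def inj[unfolded One_nat_def])
  also have "\<dots> = (\<Sum>j\<in>UNIV. if j = i then Poly_Mapping.single 0 (a $ i) else 0)"
    by (intro sum.cong refl) (auto simp: lookup[unfolded One_nat_def] lookup_single when_def)
  finally show ?thesis by simp
qed

lemma peval_apply_derivation: "peval (apply_derivation \<theta> (linear_form a)) v = a \<bullet>c pvec \<theta> v"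
  by (simp add: apply_derivation_def partial_deriv_linear_form peval_sum peval_mult peval_single
      dot_def pvec_def mult.commute)

lemma mem_linear_form_kernel: "v \<in> linear_form_kernel a \<longleftrightarrow> a \<bullet>c v = 0"
  by (simp add: linear_form_kernel_def dot_def)

text \<open>The factor theorem for formal polynomials: it holds for each homogeneous component as a form, and a polynomial is
determined by its values.\<close>

lemma linear_form_dvd_iff:
  assumes H: "vec.subspace H" "vec.dim H = 2" "H = linear_form_kernel a"
  shows "linear_form a dvd q \<longleftrightarrow> (\<forall>v\<in>H. peval q v = 0)"
proof
  assume "linear_form a dvd q"
  then show "\<forall>v\<in>H. peval q v = 0"
    by (auto simp: dvd_def peval_mult peval_linear_form H(3) mem_linear_form_kernel)
next
  assume q: "\<forall>v\<in>H. peval q v = 0"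
  have "H \<noteq> UNIV" using H(2) vec.dim_UNIV by (auto simp: card_cart_basis)
  then obtain e where "e \<notin> H" by blast
  then have "a \<bullet>c e \<noteq> 0" by (simp add: H(3) mem_linear_form_kernel)
  then have e: "a \<bullet>c ((1 / (a \<bullet>c e)) *s e) = 1" by (simp add: dot_scale_right)
  have "\<exists>r. \<forall>v. peval (component d q) v = (a \<bullet>c v) * peval r v" for d
  proof -
    have "peval (component d q) v = 0" if "a \<bullet>c v = 0" for v
    proof (rule component_vanishes[of H])
      show "peval q v = 0" if "v \<in> H" for v using q that by blast
      show "t *s v \<in> H" if "v \<in> H" for t v using that H(1) by (rule vec.subspace_scale[rotated])
      show "v \<in> H" using that by (simp add: H(3) mem_linear_form_kernel)
    qed
    then obtain f where f: "form (d - 1) f" "\<And>v. peval (component d q) v = (a \<bullet>c v) * f v"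
      using form_divide_on[OF form_component vec.subspace_UNIV UNIV_I e, of d q] by auto
    obtain r where "\<And>v. peval r v = f v" using form_polynomial[OF f(1)] by blast
    then show ?thesis using f(2) by (intro exI[of _ r]) simp
  qed
  then obtain r where r: "\<And>d v. peval (component d q) v = (a \<bullet>c v) * peval (r d) v" by metis
  have "q = linear_form a * (\<Sum>k\<le>weight_bound q. r (int k))"
  proof (rule peval_inject)
    fix v
    have "peval q v = peval (\<Sum>k\<le>weight_bound q. component (int k) q) v" by (simp add: sum_components)
    then show "peval q v = peval (linear_form a * (\<Sum>k\<le>weight_bound q. r (int k))) v"
      by (simp add: peval_sum r peval_mult peval_linear_form sum_distrib_left)
  qed
  then show "linear_form a dvd q" by (rule dvdI)
qed

lemma defining_form_kernel:
  assumes "vec.subspace H" "vec.dim H = 2"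
  shows "\<exists>a. defining_form H = linear_form a \<and> H = linear_form_kernel a"
proof -
  obtain al xi et e0 e1 e2 where "plane_chart H al xi et e0 e1 e2" using plane_chart_exists[OF assms] by blast
  then interpret plane_chart H al xi et e0 e1 e2 .
  have "linear_form_kernel al = H" by (auto simp: mem_H mem_linear_form_kernel)
  then have "linear_form_kernel (SOME a. linear_form_kernel a = H) = H" by (rule someI)
  then show ?thesis unfolding defining_form_def by auto
qed

lemma log_derivations_iff:
  assumes A: "central_arrangement A"
  shows "\<theta> \<in> log_derivations A \<longleftrightarrow> (\<forall>H\<in>A. \<forall>v\<in>H. pvec \<theta> v \<in> H)"
proof -
  have "defining_form H dvd apply_derivation \<theta> (defining_form H) \<longleftrightarrow> (\<forall>v\<in>H. pvec \<theta> v \<in> H)" if HA: "H \<in> A" for H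
  proof -
    obtain a where a: "defining_form H = linear_form a" "H = linear_form_kernel a"
      using defining_form_kernel[OF central_arrangementD[OF A HA]] by blast
    have "w \<in> H \<longleftrightarrow> a \<bullet>c w = 0" for w using a(2) mem_linear_form_kernel by blast
    then show ?thesis
      unfolding a(1) linear_form_dvd_iff[OF central_arrangementD[OF A HA] a(2)] peval_apply_derivation by simp
  qed
  then show ?thesis by (simp add: log_derivations_def)
qed

definition vcomponent :: "int \<Rightarrow> poly3^3 \<Rightarrow> poly3^3" where
  "vcomponent d \<theta> = (\<chi> i. component d (\<theta> $ i))"

lemma vcomponent_add: "vcomponent d (\<theta> + \<phi>) = vcomponent d \<theta> + vcomponent d \<phi>"
  by (simp add: vcomponent_def vec_eq_iff component_add)

lemma vcomponent_zero [simp]: "vcomponent d 0 = 0"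
  by (simp add: vcomponent_def vec_eq_iff)

lemma vcomponent_scale:
  "homogeneous_derivation e \<theta> \<Longrightarrow> vcomponent d (p *s \<theta>) = component (d - int e) p *s \<theta>"
  by (simp add: vcomponent_def vec_eq_iff homogeneous_derivation_def component_mult)

lemma vcomponent_homogeneous: "homogeneous_derivation e \<theta> \<Longrightarrow> vcomponent (int e) \<theta> = \<theta>"
  by (simp add: vcomponent_def vec_eq_iff homogeneous_derivation_def component_homogeneous[of e _ "int e"])

lemma homogeneous_vcomponent: "homogeneous_derivation (nat d) (vcomponent d \<theta>)"
  by (simp add: homogeneous_derivation_def vcomponent_def homogeneous_component)

lemma sum_vcomponents: "\<exists>n. \<theta> = (\<Sum>k\<le>n. vcomponent (int k) \<theta>)"
proof -
  let ?n = "\<Sum>i\<in>UNIV. weight_bound (\<theta> $ i)"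
  have "weight_bound (\<theta> $ i) \<le> ?n" for i by (intro member_le_sum) auto
  then have "\<theta> = (\<Sum>k\<le>?n. vcomponent (int k) \<theta>)"
    by (simp add: vec_eq_iff sum_component vcomponent_def sum_components)
  then show ?thesis by blast
qed

lemma vform_pvec: "homogeneous_derivation d \<theta> \<Longrightarrow> vform (int d) (pvec \<theta>)"
  by (simp add: vform_def pvec_def homogeneous_derivation_def form_peval)

lemma vform_polynomial:
  assumes "vform (int d) \<theta>" shows "\<exists>\<Theta>. homogeneous_derivation d \<Theta> \<and> pvec \<Theta> = \<theta>"
proof -
  have "\<forall>i. \<exists>p. homogeneous d p \<and> (\<forall>v. peval p v = \<theta> v $ i)"
    using form_polynomial[of "int d"] assms by (auto simp: vform_def)
  from choice[OF this] obtain p where "\<And>i. homogeneous d (p i)" "\<And>i v. peval (p i) v = \<theta> v $ i" by blast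
  then show ?thesis
    by (intro exI[of _ "\<chi> i. p i"]) (auto simp: homogeneous_derivation_def pvec_def vec_eq_iff)
qed

lemma pvec_log_forms:
  assumes "central_arrangement A" "homogeneous_derivation d \<Theta>"
  shows "pvec \<Theta> \<in> log_forms A (int d) \<longleftrightarrow> \<Theta> \<in> log_derivations A"
  using vform_pvec[OF assms(2)] by (simp add: log_forms_def log_derivations_iff[OF assms(1)])

text \<open>\<open>D(A)\<close> is a graded module, since planes are cones.\<close>

lemma vcomponent_log_derivations:
  assumes A: "central_arrangement A" and \<theta>: "\<theta> \<in> log_derivations A"
  shows "vcomponent d \<theta> \<in> log_derivations A"
  unfolding log_derivations_iff[OF A]
proof (intro ballI)
  fix H v assume H: "H \<in> A" and v: "v \<in> H"
  obtain al xi et e0 e1 e2 where "plane_chart H al xi et e0 e1 e2"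
    using plane_chart_exists[OF central_arrangementD[OF A H]] by blast
  then interpret plane_chart H al xi et e0 e1 e2 .
  define q where "q = (\<Sum>i\<in>UNIV. Poly_Mapping.single 0 (al $ i) * \<theta> $ i)"
  have q: "peval q w = al \<bullet>c pvec \<theta> w" for w
    by (simp add: q_def peval_sum peval_mult peval_single dot_def pvec_def)
  have "component d (Poly_Mapping.single 0 c * p) = Poly_Mapping.single 0 c * component d p" for c p
    using component_mult[of 0 "Poly_Mapping.single 0 c" d p] by (simp add: homogeneous_def mult.commute)
  then have "peval (component d q) v = al \<bullet>c pvec (vcomponent d \<theta>) v"
    by (simp add: q_def component_sum peval_sum peval_mult peval_single dot_def pvec_def vcomponent_def)
  moreover have "peval (component d q) v = 0"
  proof (rule component_vanishes[OF _ _ v])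
    show "peval q w = 0" if "w \<in> H" for w
      using \<theta> H that unfolding log_derivations_iff[OF A] q by (simp flip: mem_H)
    show "t *s w \<in> H" if "w \<in> H" for t w using that subspace_H by (rule vec.subspace_scale[rotated])
  qed
  ultimately show "pvec (vcomponent d \<theta>) v \<in> H" by (simp add: mem_H)
qed

lemma span_triple:
  "\<theta> \<in> der.span {\<theta>1, \<theta>2, \<theta>3} \<longleftrightarrow> (\<exists>f g h. \<theta> = f *s \<theta>1 + g *s \<theta>2 + h *s \<theta>3)"
proof -
  have "\<theta> \<in> der.span {\<theta>1, \<theta>2, \<theta>3} \<longleftrightarrow> (\<exists>f g h. \<theta> - f *s \<theta>1 - g *s \<theta>2 - h *s \<theta>3 = 0)"
    by (simp add: der.span_breakdown_eq del: right_minus_eq)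
  then show ?thesis by (simp add: algebra_simps eq_diff_eq diff_eq_eq)
qed

lemma independent_triple:
  "distinct [\<theta>1, \<theta>2, \<theta>3] \<and> der.independent {\<theta>1, \<theta>2, \<theta>3} \<longleftrightarrow>
    (\<forall>f g h. f *s \<theta>1 + g *s \<theta>2 + h *s \<theta>3 = 0 \<longrightarrow> f = 0 \<and> g = 0 \<and> h = 0)"
proof
  assume *: "distinct [\<theta>1, \<theta>2, \<theta>3] \<and> der.independent {\<theta>1, \<theta>2, \<theta>3}"
  then have ne: "\<theta>1 \<noteq> \<theta>2" "\<theta>2 \<noteq> \<theta>1" "\<theta>1 \<noteq> \<theta>3" "\<theta>3 \<noteq> \<theta>1" "\<theta>2 \<noteq> \<theta>3" "\<theta>3 \<noteq> \<theta>2" by auto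
  show "\<forall>f g h. f *s \<theta>1 + g *s \<theta>2 + h *s \<theta>3 = 0 \<longrightarrow> f = 0 \<and> g = 0 \<and> h = 0"
  proof (intro allI impI)
    fix f g h assume z: "f *s \<theta>1 + g *s \<theta>2 + h *s \<theta>3 = 0"
    define u where "u v = (if v = \<theta>1 then f else if v = \<theta>2 then g else h)" for v
    have sum: "(\<Sum>v\<in>{\<theta>1, \<theta>2, \<theta>3}. u v *s v) = 0" using z by (simp add: u_def ne add.assoc)
    have "u v = 0" if "v \<in> {\<theta>1, \<theta>2, \<theta>3}" for v
      using der.independentD[OF conjunct2[OF *] _ subset_refl sum that] by simp
    from this[of \<theta>1] this[of \<theta>2] this[of \<theta>3] show "f = 0 \<and> g = 0 \<and> h = 0"
      by (simp add: u_def ne)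
  qed
next
  assume *: "\<forall>f g h. f *s \<theta>1 + g *s \<theta>2 + h *s \<theta>3 = 0 \<longrightarrow> f = 0 \<and> g = 0 \<and> h = 0"
  have "\<theta>1 \<noteq> \<theta>2" using *[rule_format, of 1 "-1" 0] by auto
  moreover have "\<theta>1 \<noteq> \<theta>3" using *[rule_format, of 1 0 "-1"] by auto
  moreover have "\<theta>2 \<noteq> \<theta>3" using *[rule_format, of 0 1 "-1"] by auto
  ultimately have dist: "distinct [\<theta>1, \<theta>2, \<theta>3]" by simp
  moreover have "der.independent {\<theta>1, \<theta>2, \<theta>3}"
  proof
    assume "der.dependent {\<theta>1, \<theta>2, \<theta>3}"
    then obtain u v where u: "(\<Sum>v\<in>{\<theta>1, \<theta>2, \<theta>3}. u v *s v) = 0" and v: "v \<in> {\<theta>1, \<theta>2, \<theta>3}" "u v \<noteq> 0"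
      unfolding der.dependent_finite[OF finite.insertI[OF finite.insertI[OF finite.insertI[OF finite.emptyI]]]] by blast
    have "u \<theta>1 *s \<theta>1 + u \<theta>2 *s \<theta>2 + u \<theta>3 *s \<theta>3 = 0" using u dist by (simp add: add.assoc)
    then show False using * v by blast
  qed
  ultimately show "distinct [\<theta>1, \<theta>2, \<theta>3] \<and> der.independent {\<theta>1, \<theta>2, \<theta>3}" by simp
qed

section \<open>Freeness in terms of logarithmic forms\<close>

text \<open>In a basis, \<open>\<theta>1\<close> may be replaced by the Euler field if its coefficient there is a nonzero constant.\<close>

lemma log_basis_exchange:
  assumes A: "central_arrangement A" and B: "log_basis A 1 a b \<theta>1 \<theta>2 \<theta>3"
    and c: "c \<noteq> 0" and g: "form (1 - a) g" and h: "form (1 - b) h"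
    and id: "\<And>v. v = c *s \<theta>1 v + g v *s \<theta>2 v + h v *s \<theta>3 v"
  shows "free_exp A a b"
proof -
  have "log_basis A 1 a b (\<lambda>v. v) \<theta>2 \<theta>3"
    unfolding log_basis_def
  proof (intro conjI allI ballI impI log_forms_id log_basis_memD[OF B])
    fix d \<psi> assume "\<psi> \<in> log_forms A d"
    from log_basis_spanD[OF B this] obtain f' g' h' where f: "form (d - 1) f'" "form (d - a) g'" "form (d - b) h'"
      and eq: "\<And>v. \<psi> v = f' v *s \<theta>1 v + g' v *s \<theta>2 v + h' v *s \<theta>3 v" by metis
    have f1: "form (d - 1) (\<lambda>v. (1 / c) * f' v)" using f(1) by (rule form_scale)
    show "\<exists>f g h. form (d - 1) f \<and> form (d - a) g \<and> form (d - b) h \<and>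
        (\<forall>v. \<psi> v = f v *s v + g v *s \<theta>2 v + h v *s \<theta>3 v)"
    proof (intro exI conjI allI)
      show "form (d - 1) (\<lambda>v. (1 / c) * f' v)" by fact
      show "form (d - a) (\<lambda>v. g' v - ((1 / c) * f' v) * g v)"
        by (rule form_diff[OF f(2) form_mult'[OF f1 g]]) simp
      show "form (d - b) (\<lambda>v. h' v - ((1 / c) * f' v) * h v)"
        by (rule form_diff[OF f(3) form_mult'[OF f1 h]]) simp
      fix v
      have "\<theta>1 v = (1 / c) *s (v - g v *s \<theta>2 v - h v *s \<theta>3 v)"
        by (subst (2) id) (use c in simp)
      then have th: "\<theta>1 v $ i = (1 / c) * (v $ i - g v * \<theta>2 v $ i - h v * \<theta>3 v $ i)" for i
        by (simp add: diff_divide_distrib)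
      show "\<psi> v = ((1 / c) * f' v) *s v + (g' v - ((1 / c) * f' v) * g v) *s \<theta>2 v
          + (h' v - ((1 / c) * f' v) * h v) *s \<theta>3 v"
        by (simp add: eq vec_eq_iff th algebra_simps diff_divide_distrib)
    qed
  next
    fix d f' g' h' v
    assume f: "form (d - 1) f'" "form (d - a) g'" "form (d - b) h'"
      and eq: "\<forall>v. f' v *s v + g' v *s \<theta>2 v + h' v *s \<theta>3 v = 0"
    have 1: "form (d - 1) (\<lambda>v. c * f' v)" using f(1) by (rule form_scale)
    have 2: "form (d - a) (\<lambda>v. g' v + f' v * g v)" by (rule form_add[OF f(2) form_mult'[OF f(1) g]]) simp
    have 3: "form (d - b) (\<lambda>v. h' v + f' v * h v)" by (rule form_add[OF f(3) form_mult'[OF f(1) h]]) simp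
    have 4: "(c * f' w) *s \<theta>1 w + (g' w + f' w * g w) *s \<theta>2 w + (h' w + f' w * h w) *s \<theta>3 w = 0" for w
    proof -
      have "(c * f' w) *s \<theta>1 w + (g' w + f' w * g w) *s \<theta>2 w + (h' w + f' w * h w) *s \<theta>3 w
          = f' w *s (c *s \<theta>1 w + g w *s \<theta>2 w + h w *s \<theta>3 w) + g' w *s \<theta>2 w + h' w *s \<theta>3 w"
        by (simp add: vec_eq_iff algebra_simps)
      also have "\<dots> = 0" unfolding id[symmetric] by (rule eq[rule_format])
      finally show ?thesis .
    qed
    note z = log_basis_indepD[OF B 1 2 3 4]
    show "f' v = 0" using z(1)[of v] c by simp
    then show "g' v = 0" "h' v = 0" using z(2)[of v] z(3)[of v] by auto
  qed
  then show ?thesis unfolding free_exp_def by blast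
qed

text \<open>The coefficient \<open>g\<close> that \<open>\<theta>\<close> has in the Euler field is zero if \<open>a > 1\<close>, and \<open>\<theta>\<close> is constant if \<open>a = 0\<close> and zero if \<open>a < 0\<close>.\<close>

lemma degree_one_multiple_of_lower:
  assumes \<theta>: "vform a \<theta>" and g: "form (1 - a) g" and deg: "a = 1 \<Longrightarrow> g v = 0"
  shows "\<exists>c. g v *s \<theta> v = c *s \<theta> 0"
proof -
  consider "a < 0" | "a = 0" | "a = 1" | "a > 1" by linarith
  then show ?thesis
  proof cases
    case 1
    then show ?thesis using vform_negative_degree[OF \<theta>] by (intro exI[of _ 0]) simp
  next
    case 2
    then have "\<theta> v = \<theta> 0"
      using \<theta> form_degree_zero[of a "\<lambda>v. \<theta> v $ _" v] by (simp add: vform_def vec_eq_iff)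
    then show ?thesis by auto
  next
    case 3
    then show ?thesis using deg by (intro exI[of _ 0]) simp
  next
    case 4
    then show ?thesis using form_negative_degree[OF g] by (intro exI[of _ 0]) simp
  qed
qed

text \<open>Any homogeneous basis with an element of degree one can be changed to contain the Euler field, with the same degrees.
A basis field of degree one with nonzero coefficient in the Euler field can be exchanged for it.  If there were none,
the Euler field would be a combination of the constant basis fields, of which there are at most two.\<close>

lemma log_basis_euler:
  assumes A: "central_arrangement A" and B: "log_basis A 1 a b \<theta>1 \<theta>2 \<theta>3"
  shows "free_exp A a b"
proof (rule ccontr)
  assume not_free: "\<not> free_exp A a b"
  from log_basis_spanD[OF B log_forms_id] obtain f g h where
    f: "form (1 - 1) f" and g: "form (1 - a) g" and h: "form (1 - b) h"
    and id: "\<And>v. v = f v *s \<theta>1 v + g v *s \<theta>2 v + h v *s \<theta>3 v" by metis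
  have const: "k v = k 0" if "form (1 - 1) k" for k v using form_degree_zero[OF that] by simp
  have "f v = 0" for v
  proof (rule ccontr)
    assume "f v \<noteq> 0"
    then have f0: "f 0 \<noteq> 0" using const[OF f, of v] by simp
    have "free_exp A a b"
    proof (rule log_basis_exchange[OF A B f0 g h])
      show "v = f 0 *s \<theta>1 v + g v *s \<theta>2 v + h v *s \<theta>3 v" for v
        using id[of v] const[OF f, of v] by simp
    qed
    then show False using not_free by simp
  qed
  then have id': "v = g v *s \<theta>2 v + h v *s \<theta>3 v" for v using id[of v] by simp
  have ga: "g v = 0" if a: "a = 1" for v
  proof (rule ccontr)
    assume "g v \<noteq> 0"
    then have g0: "g 0 \<noteq> 0" using const[of g v] g a by simp
    have B': "log_basis A 1 1 b \<theta>2 \<theta>1 \<theta>3" using log_basis_swap12[OF B] a by simp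
    have "free_exp A 1 b"
    proof (rule log_basis_exchange[OF A B' g0 form_zero h])
      show "v = g 0 *s \<theta>2 v + 0 *s \<theta>1 v + h v *s \<theta>3 v" for v
        using id'[of v] const[of g v] g a by simp
    qed
    then show False using not_free a by simp
  qed
  have hb: "h v = 0" if b: "b = 1" for v
  proof (rule ccontr)
    assume "h v \<noteq> 0"
    then have h0: "h 0 \<noteq> 0" using const[of h v] h b by simp
    have B': "log_basis A 1 a 1 \<theta>3 \<theta>2 \<theta>1" using log_basis_swap12[OF log_basis_swap23[OF log_basis_swap12[OF B]]] b by simp
    have "free_exp A a 1"
    proof (rule log_basis_exchange[OF A B' h0 g form_zero])
      show "v = h 0 *s \<theta>3 v + g v *s \<theta>2 v + 0 *s \<theta>1 v" for v
        using id'[of v] const[of h v] h b by (simp add: add.commute)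
    qed
    then show False using not_free b by simp
  qed
  \<comment> \<open>Otherwise only constant fields contribute, and two of them cannot span the space.\<close>
  have vf: "vform a \<theta>2" "vform b \<theta>3" using log_basis_memD[OF B] by (auto simp: log_forms_def)
  have "v \<in> vec.span {\<theta>2 0, \<theta>3 0}" for v
  proof -
    obtain c where c: "g v *s \<theta>2 v = c *s \<theta>2 0" using degree_one_multiple_of_lower[OF vf(1) g ga] by blast
    obtain c' where c': "h v *s \<theta>3 v = c' *s \<theta>3 0" using degree_one_multiple_of_lower[OF vf(2) h hb] by blast
    have "c *s \<theta>2 0 + c' *s \<theta>3 0 \<in> vec.span {\<theta>2 0, \<theta>3 0}"
      by (intro vec.span_add vec.span_scale vec.span_base) auto
    then show ?thesis using id'[of v] c c' by simp
  qed
  then have "vec.dim (UNIV :: (complex^3) set) \<le> card {\<theta>2 0, \<theta>3 0}"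
    by (intro vec.dim_le_card) auto
  moreover have "card {\<theta>2 0, \<theta>3 0} \<le> 2" by (simp add: card_insert_le_m1)
  moreover have "vec.dim (UNIV :: (complex^3) set) = 3" using vec.dim_UNIV by (simp add: card_cart_basis)
  ultimately show False by simp
qed

lemma free_with_exponents_log_basis:
  assumes A: "central_arrangement A" and free: "free_with_exponents A d1 d2 d3"
  shows "\<exists>\<theta>1 \<theta>2 \<theta>3. log_basis A (int d1) (int d2) (int d3) \<theta>1 \<theta>2 \<theta>3"
proof -
  obtain T1 T2 T3 where T: "homogeneous_derivation d1 T1" "homogeneous_derivation d2 T2" "homogeneous_derivation d3 T3"
    and basis: "distinct [T1, T2, T3] \<and> der.independent {T1, T2, T3}"
    and span: "der.span {T1, T2, T3} = log_derivations A"
    using free by (auto simp: free_with_exponents_def)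
  have ind: "f = 0 \<and> g = 0 \<and> h = 0" if "f *s T1 + g *s T2 + h *s T3 = 0" for f g h
    using basis that unfolding independent_triple by blast
  have mem: "T1 \<in> log_derivations A" "T2 \<in> log_derivations A" "T3 \<in> log_derivations A"
    unfolding span[symmetric] by (auto intro: der.span_base)
  have "log_basis A (int d1) (int d2) (int d3) (pvec T1) (pvec T2) (pvec T3)"
    unfolding log_basis_def
  proof (intro conjI allI ballI impI)
    show "pvec T1 \<in> log_forms A (int d1)" "pvec T2 \<in> log_forms A (int d2)" "pvec T3 \<in> log_forms A (int d3)"
      using mem pvec_log_forms[OF A] T by auto
  next
    fix d \<psi> assume \<psi>: "\<psi> \<in> log_forms A d"
    show "\<exists>f g h. form (d - int d1) f \<and> form (d - int d2) g \<and> form (d - int d3) h \<and>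
        (\<forall>v. \<psi> v = f v *s pvec T1 v + g v *s pvec T2 v + h v *s pvec T3 v)"
    proof (cases "d < 0")
      case True
      then have "\<psi> v = 0" for v using \<psi> vform_negative_degree by (auto simp: log_forms_def)
      then show ?thesis using form_zero by (intro exI[of _ "\<lambda>_. 0"]) simp
    next
      case False
      then have d: "int (nat d) = d" by simp
      have "vform (int (nat d)) \<psi>" using \<psi> d by (simp add: log_forms_def)
      then obtain S where S: "homogeneous_derivation (nat d) S" "pvec S = \<psi>" using vform_polynomial by blast
      have "S \<in> log_derivations A" using pvec_log_forms[OF A S(1)] S(2) \<psi> d by simp
      then obtain f g h where "S = f *s T1 + g *s T2 + h *s T3" unfolding span[symmetric] span_triple by blast
      then have "vcomponent d S = component (d - int d1) f *s T1 + component (d - int d2) g *s T2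
          + component (d - int d3) h *s T3"
        by (simp add: vcomponent_add vcomponent_scale[OF T(1)] vcomponent_scale[OF T(2)] vcomponent_scale[OF T(3)])
      then have "S = component (d - int d1) f *s T1 + component (d - int d2) g *s T2 + component (d - int d3) h *s T3"
        using vcomponent_homogeneous[OF S(1)] d by simp
      then have "\<psi> v = peval (component (d - int d1) f) v *s pvec T1 v + peval (component (d - int d2) g) v *s pvec T2 v
          + peval (component (d - int d3) h) v *s pvec T3 v" for v
        using S(2) by (metis pvec_add pvec_scale)
      then show ?thesis using form_component by blast
    qed
  next
    fix d f g h v
    assume fgh: "form (d - int d1) f" "form (d - int d2) g" "form (d - int d3) h"
      and eq: "\<forall>v. f v *s pvec T1 v + g v *s pvec T2 v + h v *s pvec T3 v = 0"
    obtain F where F: "\<And>v. peval F v = f v" using form_polynomial[OF fgh(1)] by blast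
    obtain G where G: "\<And>v. peval G v = g v" using form_polynomial[OF fgh(2)] by blast
    obtain K where K: "\<And>v. peval K v = h v" using form_polynomial[OF fgh(3)] by blast
    have "F *s T1 + G *s T2 + K *s T3 = 0"
      by (rule pvec_inject) (simp add: pvec_add pvec_scale F G K eq)
    from ind[OF this] show "f v = 0" "g v = 0" "h v = 0" using F[of v] G[of v] K[of v] by auto
  qed
  then show ?thesis by blast
qed

lemma log_basis_free_with_exponents:
  assumes A: "central_arrangement A" and B: "log_basis A (int d1) (int d2) (int d3) \<theta>1 \<theta>2 \<theta>3"
  shows "free_with_exponents A d1 d2 d3"
proof -
  note mem = log_basis_memD[OF B]
  then have vf: "vform (int d1) \<theta>1" "vform (int d2) \<theta>2" "vform (int d3) \<theta>3" by (auto simp: log_forms_def)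
  obtain T1 where T1: "homogeneous_derivation d1 T1" "pvec T1 = \<theta>1"
    using vform_polynomial[OF vf(1)] by blast
  obtain T2 where T2: "homogeneous_derivation d2 T2" "pvec T2 = \<theta>2"
    using vform_polynomial[OF vf(2)] by blast
  obtain T3 where T3: "homogeneous_derivation d3 T3" "pvec T3 = \<theta>3"
    using vform_polynomial[OF vf(3)] by blast
  have ind: "f = 0 \<and> g = 0 \<and> h = 0" if z: "f *s T1 + g *s T2 + h *s T3 = 0" for f g h
  proof -
    have comp: "component (d - int d1) f = 0 \<and> component (d - int d2) g = 0 \<and> component (d - int d3) h = 0" for d
    proof -
      have "vcomponent d (f *s T1 + g *s T2 + h *s T3) = 0" using z by simp
      then have "component (d - int d1) f *s T1 + component (d - int d2) g *s T2 + component (d - int d3) h *s T3 = 0"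
        by (simp add: vcomponent_add vcomponent_scale[OF T1(1)] vcomponent_scale[OF T2(1)] vcomponent_scale[OF T3(1)])
      then have eq: "peval (component (d - int d1) f) v *s \<theta>1 v + peval (component (d - int d2) g) v *s \<theta>2 v
          + peval (component (d - int d3) h) v *s \<theta>3 v = 0" for v
        by (metis pvec_add pvec_scale pvec_zero T1(2) T2(2) T3(2))
      note z = log_basis_indepD[OF B form_component form_component form_component eq]
      show ?thesis using z by (auto intro: peval_eq_zeroD)
    qed
    have "component e f = 0 \<and> component e g = 0 \<and> component e h = 0" for e
      using comp[of "e + int d1"] comp[of "e + int d2"] comp[of "e + int d3"] by simp
    then show ?thesis
      using sum_components[OF order_refl, of f] sum_components[OF order_refl, of g]
        sum_components[OF order_refl, of h] by simp
  qed
  have span: "der.span {T1, T2, T3} = log_derivations A"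
  proof (intro equalityI subsetI)
    fix S assume "S \<in> der.span {T1, T2, T3}"
    then obtain f g h where S: "S = f *s T1 + g *s T2 + h *s T3" unfolding span_triple by blast
    show "S \<in> log_derivations A"
      unfolding log_derivations_iff[OF A]
    proof (intro ballI)
      fix H v assume "H \<in> A" "v \<in> H"
      then have "\<theta>1 v \<in> H" "\<theta>2 v \<in> H" "\<theta>3 v \<in> H" using mem by (auto simp: log_forms_def)
      then show "pvec S v \<in> H"
        using central_arrangementD(1)[OF A \<open>H \<in> A\<close>]
        by (simp add: S pvec_add pvec_scale T1 T2 T3 vec.subspace_add vec.subspace_scale)
    qed
  next
    fix S assume S: "S \<in> log_derivations A"
    have "vcomponent (int k) S \<in> der.span {T1, T2, T3}" for k
    proof -
      have "pvec (vcomponent (int k) S) \<in> log_forms A (int k)"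
        using vcomponent_log_derivations[OF A S, of "int k"] pvec_log_forms[OF A homogeneous_vcomponent[of "int k" S]]
        by simp
      from log_basis_spanD[OF B this] obtain f g h where
        fgh: "form (int k - int d1) f" "form (int k - int d2) g" "form (int k - int d3) h"
        and eq: "\<And>v. pvec (vcomponent (int k) S) v = f v *s \<theta>1 v + g v *s \<theta>2 v + h v *s \<theta>3 v" by metis
      obtain F where F: "\<And>v. peval F v = f v" using form_polynomial[OF fgh(1)] by blast
      obtain G where G: "\<And>v. peval G v = g v" using form_polynomial[OF fgh(2)] by blast
      obtain K where K: "\<And>v. peval K v = h v" using form_polynomial[OF fgh(3)] by blast
      have "vcomponent (int k) S = F *s T1 + G *s T2 + K *s T3"
        by (rule pvec_inject) (simp add: eq pvec_add pvec_scale F G K T1 T2 T3)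
      then show ?thesis unfolding span_triple by blast
    qed
    moreover obtain n where "S = (\<Sum>k\<le>n. vcomponent (int k) S)" using sum_vcomponents by blast
    ultimately show "S \<in> der.span {T1, T2, T3}" by (metis der.span_sum)
  qed
  have "distinct [T1, T2, T3] \<and> der.independent {T1, T2, T3}" unfolding independent_triple using ind by blast
  then show ?thesis unfolding free_with_exponents_def using T1(1) T2(1) T3(1) span by blast
qed

section \<open>Free arrangements with a small exponent\<close>

lemma free_basis_degree_nonneg:
  assumes B: "free_basis A a b \<theta> \<phi>" shows "a \<ge> 0"
proof (rule ccontr)
  assume "\<not> a \<ge> 0"
  then have "\<theta> v = 0" for v using B vform_negative_degree by (auto simp: log_basis_def log_forms_def)
  then have eq: "0 *s v + 1 *s \<theta> v + 0 *s \<phi> v = 0" for v by simp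
  have "form (a - a) (\<lambda>_. 1)" using form_const[of 1] by simp
  from log_basis_indepD(2)[OF B form_zero this form_zero eq] show False by simp
qed

lemma free_exp_free_arrangement:
  assumes A: "central_arrangement A" and free: "free_exp A a b"
  shows "free_arrangement A"
proof -
  obtain \<theta> \<phi> where B: "free_basis A a b \<theta> \<phi>" using free by (auto simp: free_exp_def)
  have "a \<ge> 0" "b \<ge> 0" using free_basis_degree_nonneg B log_basis_swap23[OF B] by blast+
  then have "log_basis A (int 1) (int (nat a)) (int (nat b)) (\<lambda>v. v) \<theta> \<phi>"
    using B by simp
  from log_basis_free_with_exponents[OF A this] show ?thesis unfolding free_arrangement_def by blast
qed

lemma inductively_free_insert:
  assumes "finite A" "H \<in> A" "free_arrangement A" "inductively_free (A - {H})"
  shows "inductively_free A"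
proof -
  let ?n = "card A"
  have n: "card (A - {H}) = ?n - 1" "?n > 0" using assms(1,2) by (auto simp: card_gt_0_iff)
  obtain F where "F (?n - 1) = A - {H} \<and> (\<forall>i. 1 \<le> i \<and> i < ?n - 1 \<longrightarrow> F i \<subset> F (Suc i)) \<and>
      (\<forall>i. 1 \<le> i \<and> i \<le> ?n - 1 \<longrightarrow> card (F i) = i \<and> free_arrangement (F i))"
    using assms(4) unfolding inductively_free_def n(1) by (rule exE)
  then have F: "F (?n - 1) = A - {H}" "\<And>i. 1 \<le> i \<Longrightarrow> i < ?n - 1 \<Longrightarrow> F i \<subset> F (Suc i)"
    "\<And>i. 1 \<le> i \<Longrightarrow> i \<le> ?n - 1 \<Longrightarrow> card (F i) = i \<and> free_arrangement (F i)"
    by (blast, blast, blast)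
  show ?thesis
    unfolding inductively_free_def
  proof (intro exI[of _ "F(?n := A)"] conjI allI impI)
    fix i assume i: "1 \<le> i \<and> i < ?n"
    show "(F(?n := A)) i \<subset> (F(?n := A)) (Suc i)"
    proof (cases "Suc i = ?n")
      case True
      then have "i = ?n - 1" by simp
      then show ?thesis using True F(1) assms(2) by auto
    next
      case False
      then have "i < ?n - 1" using i by linarith
      then show ?thesis using F(2)[of i] i False by simp
    qed
  next
    fix i assume i: "1 \<le> i \<and> i \<le> ?n"
    show "card ((F(?n := A)) i) = i" "free_arrangement ((F(?n := A)) i)"
      using F(3)[of i] i assms(3) by (cases "i = ?n"; force)+
  qed simp
qed

lemma dual_hesse_betti2: "central_arrangement A \<Longrightarrow> dual_hesse A \<Longrightarrow> betti2 A = 24"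
  by (simp add: dual_hesse_iff betti2_def)

lemma dual_hesse_points_on:
  assumes A: "central_arrangement A" "dual_hesse A" and H: "H \<in> A"
  shows "card (points_on A H) = 4"
proof -
  have D: "card A = 9" "\<And>X. X \<in> points A \<Longrightarrow> planes_through A X = 3" using A dual_hesse_iff by auto
  have "(\<Sum>X\<in>points_on A H. planes_through A X - 1) = (\<Sum>X\<in>points_on A H. 2)"
    using D(2) points_on_eq[OF A(1) H] by (intro sum.cong) auto
  then show ?thesis using sum_planes_through_on[OF A(1) H] D(1) by simp
qed

text \<open>Counting shows \<open>a = 4\<close>, \<open>b = 5\<close> and that \<open>H\<close> has five points.  In the dual Hesse arrangement \<open>A - {H}\<close> each of them lies on
one or three planes, and the sum of these numbers is nine, so both kinds occur.  The plane \<open>K\<close> through a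
point \<open>Y\<close> of the first kind has the point \<open>Y\<close> in addition to its four old ones.  A point \<open>X\<close> of the second kind lies on
four planes of \<open>A\<close> and not on \<open>K\<close>, so it prevents \<open>A - {K}\<close> from being dual Hesse.\<close>

lemma dual_hesse_extension:
  assumes A: "central_arrangement A" and free: "free_exp A a b" and ab: "a \<le> b"
    and H: "H \<in> A" and free': "free_exp (A - {H}) (a - 1) b \<or> free_exp (A - {H}) a (b - 1)"
    and hesse: "dual_hesse (A - {H})"
  obtains K where "K \<in> A" "a = 4" "a < int (card (points_on A K))" "\<not> dual_hesse (A - {K})"
proof -
  let ?B = "A - {H}"
  note fin = finite_central[OF A]
  have B: "central_arrangement ?B" using A by (rule central_subset) auto
  have D: "card ?B = 9" "\<And>X. X \<in> points ?B \<Longrightarrow> planes_through ?B X = 3" using hesse dual_hesse_iff[OF B] by auto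
  have "p = 4 \<and> q = 4" if "free_exp ?B p q" for p q
  proof -
    have pq: "p + q = 8" "p * q = 16" using free_exp_numerics[OF B that] D(1) dual_hesse_betti2[OF B hesse] by auto
    then have q: "q = 8 - p" by simp
    have "p * (8 - p) = 16" using pq(2) unfolding q .
    then have "(p - 4) * (p - 4) = 0" by (simp add: algebra_simps)
    then show ?thesis using pq(1) by auto
  qed
  then have a4: "a = 4" and b5: "b = 5" using free' ab by fastforce+
  have on_H: "card (points_on A H) = 5"
    using free_exp_numerics(2)[OF A free] betti2_delete[OF A H] dual_hesse_betti2[OF B hesse] a4 b5 by simp
  have m: "planes_through A X - 1 = planes_through ?B X" if "X \<in> points_on A H" for X
    using planes_through_delete[OF fin H, of X] that points_on_eq[OF A H] by auto
  have "(\<Sum>X\<in>points_on A H. planes_through ?B X) = card A - 1"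
    using sum_planes_through_on[OF A H] m by (metis (no_types, lifting) sum.cong)
  then have sum9: "(\<Sum>X\<in>points_on A H. planes_through ?B X) = 9" using D(1) H fin by simp
  have m13: "planes_through ?B X = 1 \<and> X \<notin> points ?B \<or> planes_through ?B X = 3" if X: "X \<in> points_on A H" for X
  proof -
    have XA: "X \<in> points A" using X points_on_eq[OF A H] by auto
    have "planes_through ?B X \<ge> 1" using planes_through_ge_2[OF A XA] m[OF X] by simp
    then show ?thesis
      using D(2)[of X] points_of_subarrangement[OF A _ XA, of ?B] by fastforce
  qed
  \<comment> \<open>Five points with multiplicities one or three and sum nine: both values occur.\<close>
  obtain X where X: "X \<in> points_on A H" "planes_through ?B X = 3"
  proof -
    have "\<exists>X\<in>points_on A H. planes_through ?B X = 3"
    proof (rule ccontr)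
      assume "\<not> ?thesis"
      then have "(\<Sum>X\<in>points_on A H. planes_through ?B X) = (\<Sum>X\<in>points_on A H. 1)" using m13 by (intro sum.cong) auto
      then show False using sum9 on_H by simp
    qed
    then show ?thesis using that by blast
  qed
  obtain Y where Y: "Y \<in> points_on A H" "planes_through ?B Y = 1" "Y \<notin> points ?B"
  proof -
    have "\<exists>Y\<in>points_on A H. planes_through ?B Y \<noteq> 3"
    proof (rule ccontr)
      assume "\<not> ?thesis"
      then have "(\<Sum>X\<in>points_on A H. planes_through ?B X) = (\<Sum>X\<in>points_on A H. 3)" by (intro sum.cong) auto
      then show False using sum9 on_H by simp
    qed
    then show ?thesis using that m13 by blast
  qed
  obtain K where K: "K \<in> A" "K \<noteq> H" "Y = H \<inter> K" using Y(1) by (auto simp: points_on_def)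
  have "A - {K} = insert H (?B - {K})" using H K by auto
  then have "points_on A K = insert Y (points_on ?B K)" using K(3) by (auto simp: points_on_def)
  moreover have "Y \<notin> points_on ?B K" using Y(3) points_on_eq[OF B, of K] K by auto
  moreover have "finite (points_on ?B K)" using fin by (simp add: points_on_def)
  ultimately have on_K: "card (points_on A K) = 5" using dual_hesse_points_on[OF B hesse, of K] K by simp
  have XA: "X \<in> points A" "X \<subseteq> H" using X(1) points_on_eq[OF A H] by auto
  have "\<not> X \<subseteq> K"
  proof
    assume "X \<subseteq> K"
    then have "X = Y" using point_eq[OF A XA(1) H K(1)] K XA(2) by auto
    then show False using X(2) Y(2) by simp
  qed
  then have m4: "planes_through (A - {K}) X = 4"
    using planes_through_delete[OF fin K(1), of X] planes_through_delete[OF fin H, of X] X(2) XA(2) by simp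
  have "\<not> dual_hesse (A - {K})"
  proof
    assume hK: "dual_hesse (A - {K})"
    have "central_arrangement (A - {K})" using A by (rule central_subset) auto
    then have "planes_through (A - {K}) X = 3"
      using hK points_of_subarrangement[OF A _ XA(1), of "A - {K}"] m4 by (simp add: dual_hesse_iff)
    then show False using m4 by simp
  qed
  then show ?thesis using that[of K] K(1) a4 on_K by simp
qed

theorem free_exp_classification:
  assumes "central_arrangement A" "free_exp A a b" "min a b \<le> 4"
  shows "inductively_free A \<or> dual_hesse A"
  using assms
proof (induction "card A" arbitrary: A a b rule: less_induct)
  case less
  note A = less.prems(1)
  note fin = finite_central[OF A]
  have free_arr: "free_arrangement A" using free_exp_free_arrangement[OF A less.prems(2)] .
  have "\<exists>a b. free_exp A a b \<and> a \<le> b \<and> a \<le> 4"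
  proof (cases "a \<le> b")
    case True
    then show ?thesis using less.prems by auto
  next
    case False
    then show ?thesis using less.prems free_exp_sym[OF less.prems(2)] by (intro exI[of _ b] exI[of _ a]) auto
  qed
  then obtain a b where free: "free_exp A a b" and ab: "a \<le> b" and a4: "a \<le> 4" by blast
  have IH: "inductively_free (A - {H}) \<or> dual_hesse (A - {H})"
    if H: "H \<in> A" and fr: "free_exp (A - {H}) (a - 1) b \<or> free_exp (A - {H}) a (b - 1)" for H
  proof -
    have cen: "central_arrangement (A - {H})" using A by (rule central_subset) auto
    have card: "card (A - {H}) < card A" using H fin by (rule card_Diff1_less[rotated])
    from fr show ?thesis
    proof
      assume "free_exp (A - {H}) (a - 1) b"
      from less.hyps[OF card cen this] show ?thesis using a4 by simp
    next
      assume "free_exp (A - {H}) a (b - 1)"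
      from less.hyps[OF card cen this] show ?thesis using a4 by simp
    qed
  qed
  consider "card A \<le> 1" | H where "H \<in> A" "a < int (card (points_on A H))"
    | "card A \<ge> 2" "\<And>H. H \<in> A \<Longrightarrow> int (card (points_on A H)) \<le> a"
    by force
  then show ?case
  proof cases
    case 1
    have "inductively_free A"
      unfolding inductively_free_def
      by (intro exI[of _ "\<lambda>_. A"]) (use 1 free_arr in \<open>auto simp: le_Suc_eq\<close>)
    then show ?thesis ..
  next
    case (2 H)
    note del = free_exp_delete[OF A free 2(1) ab 2(2)]
    show ?thesis
    proof (cases "dual_hesse (A - {H})")
      case False
      then have "inductively_free (A - {H})" using IH[OF 2(1) del] by simp
      then show ?thesis using inductively_free_insert[OF fin 2(1) free_arr] by simp
    next
      case True
      obtain K where K: "K \<in> A" "a < int (card (points_on A K))" "\<not> dual_hesse (A - {K})"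
        using dual_hesse_extension[OF A free ab 2(1) del True] by metis
      have "inductively_free (A - {K})" using IH[OF K(1) free_exp_delete[OF A free K(1) ab K(2)]] K(3) by simp
      then show ?thesis using inductively_free_insert[OF fin K(1) free_arr] by simp
    qed
  next
    case 3
    then show ?thesis
      using few_points_dual_hesse[OF A 3(1) free_exp_numerics[OF A free] 3(2) ab a4] by simp
  qed
qed

theorem corollary1p3:
  fixes A :: "(complex^3) set set" and a b :: nat
  assumes "central_arrangement A"
    and "free_with_exponents A 1 a b"
    and "min a b \<le> 4"
  shows "inductively_free A \<or> dual_hesse A"
proof -
  obtain \<theta>1 \<theta>2 \<theta>3 where "log_basis A (int 1) (int a) (int b) \<theta>1 \<theta>2 \<theta>3"
    using free_with_exponents_log_basis[OF assms(1,2)] by blast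
  then have "free_exp A (int a) (int b)" using log_basis_euler[OF assms(1)] by simp
  then show ?thesis using assms(3) by (intro free_exp_classification[OF assms(1)]) auto
qed

end
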